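(* Let $V:\mathbb{R}^k\to\mathbb{R}$ and let $\sigma^-\neq\sigma^+$ be two elements of $\Sigma=\{\sigma_1,\dots,\sigma_l\}$, $l\ge 2$. Assume the following. (a) $V\in C^2_{\mathrm{loc}}(\mathbb{R}^k)$, $V\ge 0$ in $\mathbb{R}^k$, and $V(\mathbf{u})=0$ if and only if $\mathbf{u}\in\Sigma$. (b) There exist $\alpha_0,\beta_0,R_0>0$ such that for all $\mathbf{u}\in\mathbb{R}^k$ with $|\mathbf{u}|\ge R_0$ one has $\langle\nabla V(\mathbf{u}),\mathbf{u}\rangle\ge\alpha_0|\mathbf{u}|^2$ and $V(\mathbf{u})\ge\beta_0$. (c) For all $\sigma\in\Sigma$ the matrix $D^2V(\sigma)$ is positive definite. (d) The set $\mathcal{F}$ of globally minimizing curves satisfies $\mathcal{F}=\mathcal{F}_0\cup\mathcal{F}_1$ with $\mathcal{F}_0,\mathcal{F}_1$ nonempty and $d(\mathcal{F}_0,\mathcal{F}_1)>0$. (e) $\mathfrak{c}<\mathfrak{m}^\star$, where $\mathfrak{c}$ is the mountain pass value associated with $\mathcal{F}_0,\mathcal{F}_1$. (f) There exists a closed set $K\subset\mathbb{R}^k$ such that: (f1) there exists $\nu_0>0$ with $\mathrm{dist}(\mathfrak{q}(\mathbb{R}),K)\ge\nu_0$ for all $\mathfrak{q}\in\mathcal{F}$ ($\mathrm{dist}$ is the Euclidean distance between two sets in $\mathbb{R}^k$); (f2) there exists $M>\mathfrak{c}$ such that for any $\gamma\in\Gamma$ with $\max_{s\in[0,1]}J(\gamma(s))\le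 M$ there exists $s_\gamma\in[0,1]$ such that $J(\gamma(s_\gamma))\ge\mathfrak{c}$ and $(\gamma(s_\gamma)+\psi)(\mathbb{R})\cap K\neq\emptyset$. Then there exists $\mathfrak{u}\in H^1_{\mathrm{loc}}(\mathbb{R},\mathbb{R}^k)\cap C^2(\mathbb{R},\mathbb{R}^k)$, a solution of $\mathfrak{u}''=\nabla V(\mathfrak{u})$ in $\mathbb{R}$, that satisfies one of the two following conditions: 1. $\mathfrak{u}$ is not constant, $E(\mathfrak{u})\le\mathfrak{c}$, and there exists $\sigma\in\{\sigma^-,\sigma^+\}$ such that $\lim_{t\to\pm\infty}\mathfrak{u}(t)=\sigma$. 2. $\mathfrak{u}\in X(\sigma^-,\sigma^+)$ and $\mathfrak{c}\ge E(\mathfrak{u})>\mathfrak{m}$. Moreover, $\mathfrak{u}(0)\in K$.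
   Context: $k\ge 2$; $\langle\cdot,\cdot\rangle$ and $|\cdot|$ are the Euclidean inner product and norm on $\mathbb{R}^k$. Curves in $H^1_{\mathrm{loc}}(\mathbb{R},\mathbb{R}^k)$ are identified with their continuous representatives. $\mathscr{H}:=H^1(\mathbb{R},\mathbb{R}^k)$. Energy: $E(q):=\int_{\mathbb{R}}\left[\tfrac12|q'(t)|^2+V(q(t))\right]dt$ for $q\in H^1_{\mathrm{loc}}(\mathbb{R},\mathbb{R}^k)$. For $\sigma_i,\sigma_j\in\Sigma$: $X(\sigma_i,\sigma_j):=\{q\in H^1_{\mathrm{loc}}(\mathbb{R},\mathbb{R}^k): E(q)<+\infty,\ \lim_{t\to-\infty}q(t)=\sigma_i,\ \lim_{t\to+\infty}q(t)=\sigma_j\}$ and $\mathfrak{m}_{\sigma_i\sigma_j}:=\inf\{E(q):q\in X(\sigma_i,\sigma_j)\}$. Set $\mathfrak{m}:=\mathfrak{m}_{\sigma^-\sigma^+}$ and $\mathfrak{m}^\star:=\min\{\mathfrak{m}_{\sigma^-\sigma}+\mathfrak{m}_{\sigma\sigma^+}:\sigma\in\Sigma\setminus\{\sigma^-,\sigma^+\}\}$ ($=+\infty$ if $\Sigma=\{\sigma^-,\sigma^+\}$). $\mathcal{F}:=\{\mathfrak{q}\in X(\sigma^-,\sigma^+):E(\mathfrak{q})=\mathfrak{m}\}$. For $q,\tilde q\in X(\sigma^-,\sigma^+)$ one has $q-\tilde q\in\mathscr{H}$, and $d(q,\tilde q):=\|q-\tilde q\|_{\mathscr{H}}$; for sets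 $A,B$, $d(A,B):=\inf_{a\in A,b\in B}d(a,b)$. $\psi(t):=\sigma^-$ for $t\le-1$, $\psi(t):=\frac{t+1}{2}\sigma^++\frac{1-t}{2}\sigma^-$ for $-1\le t\le1$, $\psi(t):=\sigma^+$ for $t\ge1$. For $v\in\mathscr{H}$ one has $v+\psi\in X(\sigma^-,\sigma^+)$, and $J(v):=E(v+\psi)$ for $v\in\mathscr{H}$. For $i\in\{0,1\}$, $\mathcal{V}_i:=\mathcal{F}_i-\{\psi\}=\{\mathfrak{q}-\psi:\mathfrak{q}\in\mathcal{F}_i\}\subset\mathscr{H}$. Mountain pass family: $\Gamma:=\{\gamma\in C([0,1],\mathscr{H}):\gamma(0)\in\mathcal{V}_0,\ \gamma(1)\in\mathcal{V}_1\}$; mountain pass value: $\mathfrak{c}:=\inf_{\gamma\in\Gamma}\max_{s\in[0,1]}J(\gamma(s))<+\infty$. *)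

theory Defs
  imports "HOL-Analysis.Analysis"
begin

section \<open>Gradient, Hessian, functions of class C2\<close>

definition grad :: "(real ^ 'n \<Rightarrow> real) \<Rightarrow> real ^ 'n \<Rightarrow> real ^ 'n" where
  "grad f u = (THE D. GDERIV f u :> D)"

definition hessian :: "(real ^ 'n \<Rightarrow> real) \<Rightarrow> real ^ 'n \<Rightarrow> real ^ 'n ^ 'n" where
  "hessian f u = matrix (frechet_derivative (grad f) (at u))"

definition C2_function :: "(real ^ 'n \<Rightarrow> real) \<Rightarrow> bool" where
  "C2_function f \<longleftrightarrow>
     f differentiable_on UNIV \<and> grad f differentiable_on UNIV \<and> continuous_on UNIV (hessian f)"

text \<open>Symmetry is not required here: it is automatic for the Hessian of a C2 function.\<close>

definition positive_definite :: "real ^ 'n ^ 'n \<Rightarrow> bool" where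
  "positive_definite A \<longleftrightarrow> (\<forall>x. x \<noteq> 0 \<longrightarrow> x \<bullet> (A *v x) > 0)"

definition C2_curve :: "(real \<Rightarrow> real ^ 'n) \<Rightarrow> bool" where
  "C2_curve u \<longleftrightarrow>
     u C1_differentiable_on UNIV \<and> (\<lambda>t. vector_derivative u (at t)) C1_differentiable_on UNIV"

section \<open>Sobolev spaces of curves\<close>

definition L2_curve :: "(real \<Rightarrow> real ^ 'n) \<Rightarrow> bool" where
  "L2_curve q \<longleftrightarrow> q \<in> borel_measurable lborel \<and> integrable lborel (\<lambda>t. (norm (q t))\<^sup>2)"

definition L2loc_curve :: "(real \<Rightarrow> real ^ 'n) \<Rightarrow> bool" where
  "L2loc_curve q \<longleftrightarrow>
     q \<in> borel_measurable lborel \<and> (\<forall>a b. set_integrable lborel {a..b} (\<lambda>t. (norm (q t))\<^sup>2))"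

definition test_function :: "(real \<Rightarrow> real) \<Rightarrow> bool" where
  "test_function \<phi> \<longleftrightarrow> \<phi> C1_differentiable_on UNIV \<and> compact (closure {t. \<phi> t \<noteq> 0})"

text \<open>Weak derivatives are tested against compactly supported C1 functions; for locally
  integrable functions this gives the same notion as smooth test functions (by mollification).\<close>

definition has_weak_derivative :: "(real \<Rightarrow> real ^ 'n) \<Rightarrow> (real \<Rightarrow> real ^ 'n) \<Rightarrow> bool" where
  "has_weak_derivative q p \<longleftrightarrow>
     (\<forall>\<phi>. test_function \<phi> \<longrightarrow>
        (LINT t|lborel. deriv \<phi> t *\<^sub>R q t) = - (LINT t|lborel. \<phi> t *\<^sub>R p t))"

text \<open>Elements of the Sobolev spaces are identified with their continuous representatives, so the
  spaces are sets of continuous functions.\<close>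

definition H1loc :: "(real \<Rightarrow> real ^ 'n) set" where
  "H1loc = {q. continuous_on UNIV q \<and> L2loc_curve q \<and>
               (\<exists>p. L2loc_curve p \<and> has_weak_derivative q p)}"

definition H1 :: "(real \<Rightarrow> real ^ 'n) set" where
  "H1 = {q. continuous_on UNIV q \<and> L2_curve q \<and>
            (\<exists>p. L2_curve p \<and> has_weak_derivative q p)}"

text \<open>The weak derivative is unique only up to null sets; a representative is chosen, and it is
  used below only under integrals.\<close>

definition weak_derivative :: "(real \<Rightarrow> real ^ 'n) \<Rightarrow> real \<Rightarrow> real ^ 'n" where
  "weak_derivative q = (SOME p. L2loc_curve p \<and> has_weak_derivative q p)"

definition H1_norm :: "(real \<Rightarrow> real ^ 'n) \<Rightarrow> real" where
  "H1_norm v = sqrt ((LINT t|lborel. (norm (v t))\<^sup>2) +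
                     (LINT t|lborel. (norm (weak_derivative v t))\<^sup>2))"

definition H1_dist :: "(real \<Rightarrow> real ^ 'n) \<Rightarrow> (real \<Rightarrow> real ^ 'n) \<Rightarrow> real" where
  "H1_dist q r = H1_norm (\<lambda>t. q t - r t)"

text \<open>Meaningful for nonempty sets of curves with pairwise differences in \<open>H1\<close>.\<close>

definition H1_setdist :: "(real \<Rightarrow> real ^ 'n) set \<Rightarrow> (real \<Rightarrow> real ^ 'n) set \<Rightarrow> real" where
  "H1_setdist A B = (INF (a, b)\<in>A \<times> B. H1_dist a b)"

section \<open>Energy and connecting curves\<close>

text \<open>Energies and infima of energies are extended nonnegative reals. The potential is always
  assumed nonnegative, so \<open>ennreal\<close> does not truncate the integrand.\<close>

definition energy :: "(real ^ 'n \<Rightarrow> real) \<Rightarrow> (real \<Rightarrow> real ^ 'n) \<Rightarrow> ennreal" where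
  "energy V q = (\<integral>\<^sup>+ t. ennreal (1/2 * (norm (weak_derivative q t))\<^sup>2 + V (q t)) \<partial>lborel)"

definition connecting ::
  "(real ^ 'n \<Rightarrow> real) \<Rightarrow> real ^ 'n \<Rightarrow> real ^ 'n \<Rightarrow> (real \<Rightarrow> real ^ 'n) set" where
  "connecting V a b = {q \<in> H1loc. energy V q < \<infinity> \<and> (q \<longlongrightarrow> a) at_bot \<and> (q \<longlongrightarrow> b) at_top}"

definition min_energy :: "(real ^ 'n \<Rightarrow> real) \<Rightarrow> real ^ 'n \<Rightarrow> real ^ 'n \<Rightarrow> ennreal" where
  "min_energy V a b = (INF q\<in>connecting V a b. energy V q)"

text \<open>For a finite set of wells the infimum is a minimum, and it is \<open>\<infinity>\<close> if there is no third well.\<close>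

definition m_star ::
  "(real ^ 'n \<Rightarrow> real) \<Rightarrow> (real ^ 'n) set \<Rightarrow> real ^ 'n \<Rightarrow> real ^ 'n \<Rightarrow> ennreal" where
  "m_star V S a b = (INF s\<in>S - {a, b}. min_energy V a s + min_energy V s b)"

definition minimizers ::
  "(real ^ 'n \<Rightarrow> real) \<Rightarrow> real ^ 'n \<Rightarrow> real ^ 'n \<Rightarrow> (real \<Rightarrow> real ^ 'n) set" where
  "minimizers V a b = {q \<in> connecting V a b. energy V q = min_energy V a b}"

section \<open>Mountain passes\<close>

definition psi :: "real ^ 'n \<Rightarrow> real ^ 'n \<Rightarrow> real \<Rightarrow> real ^ 'n" where
  "psi a b t = (if t \<le> -1 then a
                else if t \<le> 1 then ((t + 1) / 2) *\<^sub>R b + ((1 - t) / 2) *\<^sub>R a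
                else b)"

definition J ::
  "(real ^ 'n \<Rightarrow> real) \<Rightarrow> real ^ 'n \<Rightarrow> real ^ 'n \<Rightarrow> (real \<Rightarrow> real ^ 'n) \<Rightarrow> ennreal" where
  "J V a b v = energy V (\<lambda>t. v t + psi a b t)"

definition shifted ::
  "real ^ 'n \<Rightarrow> real ^ 'n \<Rightarrow> (real \<Rightarrow> real ^ 'n) set \<Rightarrow> (real \<Rightarrow> real ^ 'n) set" where
  "shifted a b F = (\<lambda>q t. q t - psi a b t) ` F"

text \<open>Paths are total functions of which only the restriction to the unit interval matters;
  continuity is with respect to the \<open>H1\<close> norm.\<close>

definition mp_paths ::
  "real ^ 'n \<Rightarrow> real ^ 'n \<Rightarrow> (real \<Rightarrow> real ^ 'n) set \<Rightarrow> (real \<Rightarrow> real ^ 'n) set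
     \<Rightarrow> (real \<Rightarrow> real \<Rightarrow> real ^ 'n) set" where
  "mp_paths a b F0 F1 =
     {\<gamma>. (\<forall>s\<in>{0..1}. \<gamma> s \<in> H1) \<and>
         (\<forall>s\<in>{0..1}. ((\<lambda>r. H1_dist (\<gamma> r) (\<gamma> s)) \<longlongrightarrow> 0) (at s within {0..1})) \<and>
         \<gamma> 0 \<in> shifted a b F0 \<and> \<gamma> 1 \<in> shifted a b F1}"

text \<open>The supremum along a path is attained, \<open>J\<close> being continuous on \<open>H1\<close>.\<close>

definition max_J ::
  "(real ^ 'n \<Rightarrow> real) \<Rightarrow> real ^ 'n \<Rightarrow> real ^ 'n \<Rightarrow> (real \<Rightarrow> real \<Rightarrow> real ^ 'n) \<Rightarrow> ennreal" where
  "max_J V a b \<gamma> = (SUP s\<in>{0..1}. J V a b (\<gamma> s))"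

definition mp_value ::
  "(real ^ 'n \<Rightarrow> real) \<Rightarrow> real ^ 'n \<Rightarrow> real ^ 'n
     \<Rightarrow> (real \<Rightarrow> real ^ 'n) set \<Rightarrow> (real \<Rightarrow> real ^ 'n) set \<Rightarrow> ennreal" where
  "mp_value V a b F0 F1 = (INF \<gamma>\<in>mp_paths a b F0 F1. max_J V a b \<gamma>)"

end

theory Submission
  imports Defs "HOL-Complex_Analysis.Great_Picard"
begin

text \<open>Suppose that no critical curve \<open>u\<close> with \<open>u 0 \<in> K\<close>, energy at most \<open>c\<close> and limits in the two
  wells exists. Then the energy has, uniformly near every connecting curve of energy close to \<open>c\<close> that
  comes close to \<open>K\<close>, a descent direction of unit size. Otherwise translate a sequence of
  counterexamples so that they come close to \<open>K\<close> at time 0; energy bounds give a pointwise convergent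
  subsequence, whose limit is critical, meets \<open>K\<close> at time 0 and has energy at most \<open>c\<close>. Its limits
  at infinity are wells, and a third well is excluded by cutting the approximating curves there, which
  would give \<open>m_star \<le> c\<close>. Given uniform descent directions, glue them along a nearly optimal path with a
  partition of unity and take one step of fixed size: the new path is below \<open>c\<close> wherever it meets
  \<open>K\<close>, contradicting the hypothesis on \<open>K\<close>.

  It suffices to test with hat functions. The derivative of the energy along a hat is a second
  difference plus an integral of the gradient, both continuous under pointwise convergence, so that
  no compactness in the Sobolev norm is required. In the end \<open>u\<close> is not a minimizer and not a constant
  because \<open>u 0 \<in> K\<close>, whereas minimizers, and hence both wells, stay away from \<open>K\<close>.\<close>

section \<open>Absolutely continuous curves\<close>

text \<open>The energy is invariant under translations of the line, and curves of bounded energy may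
  break into pieces that drift apart, so sublevels of \<open>J\<close> are not compact. A local
  limit keeps just two things: the value at a chosen time and an upper bound for the energy. The
  conclusion is tailored to these two, contact with \<open>K\<close> at time 0 and energy at most
  \<open>c\<close>; strictness above the minimal energy is then read off from the contact and not
  from a lower bound along the sequence. The hypothesis on \<open>K\<close> shapes the deformation.
  It supplies one parameter where the level is at least \<open>c\<close> and the curve meets
  \<open>K\<close> simultaneously. Hence the new path has to be below \<open>c\<close> only where it
  meets \<open>K\<close>, and below \<open>M\<close> everywhere else. Two smallness conditions fix
  the step length: the quadratic remainder must leave part of the first order gain, and a curve that
  meets \<open>K\<close> after the step must have been close to \<open>K\<close> before it, so that
  a descent direction was available there.\<close>

text \<open>Absolute continuity as an integral identity with a named density. Pairs of a curve and a
  density are stable under linear maps, shifts, reflections and gluing, whereas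
  \<open>weak_derivative\<close> is a choice that commutes with none of these on the nose.\<close>

definition primitive :: "(real \<Rightarrow> 'a::euclidean_space) \<Rightarrow> (real \<Rightarrow> 'a) \<Rightarrow> bool" where
  "primitive q p \<longleftrightarrow> p \<in> borel_measurable lborel \<and> (\<forall>a b. set_integrable lborel {a..b} p) \<and>
     (\<forall>a b. a \<le> b \<longrightarrow> q b - q a = (LBINT t:{a..b}. p t))"

lemma primitiveD:
  assumes "primitive q p"
  shows "p \<in> borel_measurable borel" "set_integrable lborel {a..b} p"
    "a \<le> b \<Longrightarrow> q b - q a = (LBINT t:{a..b}. p t)"
  using assms by (auto simp: primitive_def)

lemma primitive_continuous:
  fixes q :: "real \<Rightarrow> 'a::euclidean_space"
  assumes "primitive q p"
  shows "continuous_on UNIV q"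
proof -
  have "isCont q x" for x
  proof -
    have int: "set_integrable lborel {x-1..x+1} p" using assms by (rule primitiveD)
    have p: "p integrable_on {x-1..x+1}" 
      using set_borel_integral_eq_integral(1)[OF int] .
    have "continuous_on {x-1..x+1} (\<lambda>t. q (x-1) + integral {x-1..t} p)"
      by (intro continuous_intros indefinite_integral_continuous_1 p)
    moreover have "q (x-1) + integral {x-1..t} p = q t" if "t \<in> {x-1..x+1}" for t
    proof -
      have "q t - q (x-1) = (LBINT t:{x-1..t}. p t)"
        using primitiveD(3)[OF assms, of "x-1" t] that by auto
      also have "\<dots> = integral {x-1..t} p"
        using set_borel_integral_eq_integral(2)[OF primitiveD(2)[OF assms]] .
      finally show ?thesis by (simp add: algebra_simps)
    qed
    ultimately have "continuous_on {x-1..x+1} q"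
      using continuous_on_cong by (metis (no_types, lifting))
    then show "isCont q x"
      by (rule continuous_on_interior) (auto simp: interior_atLeastAtMost_real)
  qed
  then show ?thesis by (simp add: continuous_at_imp_continuous_on)
qed

text \<open>The continuous factor is bounded on the compact interval, which gives an integrable
  majorant. An arbitrary bounded bilinear product covers the inner product and scalar multiplication
  at once.\<close>

lemma set_integrable_continuous_bilinear:
  fixes f :: "real \<Rightarrow> 'a::{real_normed_vector,second_countable_topology}"
    and g :: "real \<Rightarrow> 'b::{banach,second_countable_topology}"
    and prod :: "'a \<Rightarrow> 'b \<Rightarrow> 'c::{banach,second_countable_topology}"
  assumes "bounded_bilinear prod" "continuous_on UNIV f" "set_integrable lborel {a..b} g"
  shows "set_integrable lborel {a..b} (\<lambda>t. prod (f t) (g t))"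
proof -
  interpret bounded_bilinear prod by fact
  obtain K where K: "K > 0" "\<And>x y. norm (prod x y) \<le> norm x * norm y * K"
    using pos_bounded by blast
  have "bounded (f ` {a..b})"
    using assms(2) by (intro compact_imp_bounded compact_continuous_image)
      (auto intro: continuous_on_subset)
  then obtain B where B: "\<And>t. t \<in> {a..b} \<Longrightarrow> norm (f t) \<le> B"
    unfolding bounded_iff by (metis imageI)
  have [measurable]: "f \<in> borel_measurable borel"
    using assms(2) by (rule borel_measurable_continuous_onI)
  have gi: "integrable lborel (\<lambda>t. indicator {a..b} t *\<^sub>R g t)"
    using assms(3) by (simp add: set_integrable_def)
  have eq: "(\<lambda>t. prod (f t) (indicator {a..b} t *\<^sub>R g t)) = (\<lambda>t. indicator {a..b} t *\<^sub>R prod (f t) (g t))"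
    by (auto simp: indicator_def zero_right)
  have m: "(\<lambda>t. prod (f t) (indicator {a..b} t *\<^sub>R g t)) \<in> borel_measurable lborel"
    by (rule borel_measurable_continuous_Pair)
      (use borel_measurable_integrable[OF gi] in \<open>auto intro: continuous_on intro!: continuous_intros\<close>)
  have "integrable lborel (\<lambda>t. prod (f t) (indicator {a..b} t *\<^sub>R g t))"
  proof (rule Bochner_Integration.integrable_bound)
    show "integrable lborel (\<lambda>t. (B * K) *\<^sub>R norm (indicator {a..b} t *\<^sub>R g t))"
      using gi by (intro integrable_scaleR_right integrable_norm)
    show "AE x in lborel. norm (prod (f x) (indicat_real {a..b} x *\<^sub>R g x)) \<le> norm ((B * K) *\<^sub>R norm (indicat_real {a..b} x *\<^sub>R g x))"
    proof (intro AE_I2)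
      fix x
      show "norm (prod (f x) (indicat_real {a..b} x *\<^sub>R g x)) \<le> norm ((B * K) *\<^sub>R norm (indicat_real {a..b} x *\<^sub>R g x))"
      proof (cases "x \<in> {a..b}")
        case True
        have "norm (prod (f x) (g x)) \<le> norm (f x) * norm (g x) * K" by (rule K)
        also have "\<dots> \<le> B * norm (g x) * K" using B[OF True] K(1) by (simp add: mult_right_mono)
        also have "\<dots> \<le> \<bar>B * K\<bar> * norm (g x)" using K(1) by (simp add: mult_right_mono abs_mult algebra_simps)
        finally show ?thesis using True by (simp add: abs_mult)
      qed (simp add: zero_right)
    qed
  qed (use m in auto)
  then show ?thesis unfolding set_integrable_def eq .
qed

lemmas set_integrable_continuous_inner = set_integrable_continuous_bilinear[OF bounded_bilinear_inner]
lemmas set_integrable_continuous_scaleR = set_integrable_continuous_bilinear[OF bounded_bilinear_scaleR]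

text \<open>Fubini on the triangle \<open>a \<le> x \<le> y \<le> b\<close>, where the kernel
  \<open>?k\<close> is the product of the two densities. Integrating over \<open>x\<close> first
  produces \<open>g y \<bullet> (q y - q a)\<close>, integrating over \<open>y\<close> first
  produces \<open>(f b - f x) \<bullet> p x\<close>; equating the results is integration by parts,
  with no pointwise derivative involved.\<close>

lemma primitive_by_parts:
  fixes q f :: "real \<Rightarrow> 'a::euclidean_space"
  assumes q: "primitive q p" and f: "primitive f g" and ab: "a \<le> b"
  shows "(LBINT t:{a..b}. g t \<bullet> q t) + (LBINT t:{a..b}. f t \<bullet> p t) = f b \<bullet> q b - f a \<bullet> q a"
proof -
  let ?P = "\<lambda>x. indicator {a..b} x *\<^sub>R p x" and ?G = "\<lambda>y. indicator {a..b} y *\<^sub>R g y"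
  let ?k = "\<lambda>x y. (if x \<le> y then 1 else 0) * (?G y \<bullet> ?P x)"
  have iP: "integrable lborel ?P" and iG: "integrable lborel ?G"
    using primitiveD(2)[OF q, of a b] primitiveD(2)[OF f, of a b] by (auto simp: set_integrable_def)
  have pm [measurable]: "p \<in> borel_measurable borel" and gm [measurable]: "g \<in> borel_measurable borel"
    using primitiveD(1)[OF q] primitiveD(1)[OF f] by auto
  have km: "case_prod ?k \<in> borel_measurable (lborel \<Otimes>\<^sub>M lborel)"
    by measurable
  have "(\<integral>\<^sup>+z. ennreal (norm (case_prod ?k z)) \<partial>(lborel \<Otimes>\<^sub>M lborel))
      \<le> (\<integral>\<^sup>+z. (case z of (x, y) \<Rightarrow> ennreal (norm (?P x)) * ennreal (norm (?G y))) \<partial>(lborel \<Otimes>\<^sub>M lborel))"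
  proof (intro nn_integral_mono, clarify)
    fix x y
    have "norm (?k x y) \<le> norm (?P x) * norm (?G y)"
      using Cauchy_Schwarz_ineq2[of "?G y" "?P x"] by (auto simp: mult.commute)
    then show "ennreal (norm (?k x y)) \<le> ennreal (norm (?P x)) * ennreal (norm (?G y))"
      by (simp add: ennreal_mult[symmetric] del: norm_scaleR norm_mult)
  qed
  also have "\<dots> = (\<integral>\<^sup>+x. (\<integral>\<^sup>+y. ennreal (norm (?P x)) * ennreal (norm (?G y)) \<partial>lborel) \<partial>lborel)"
    by (subst lborel.nn_integral_fst[symmetric]) auto
  also have "\<dots> = (\<integral>\<^sup>+x. ennreal (norm (?P x)) \<partial>lborel) * (\<integral>\<^sup>+y. ennreal (norm (?G y)) \<partial>lborel)"
    by (simp add: nn_integral_cmult nn_integral_multc)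
  also have "\<dots> < \<infinity>"
    using iP iG unfolding integrable_iff_bounded by (simp only: ennreal_mult_less_top infinity_ennreal_def) blast
  finally have ik: "integrable (lborel \<Otimes>\<^sub>M lborel) (case_prod ?k)"
    using km by (intro integrableI_bounded)
  have F: "(\<integral>y. (\<integral>x. ?k x y \<partial>lborel) \<partial>lborel) = (\<integral>x. (\<integral>y. ?k x y \<partial>lborel) \<partial>lborel)"
    using lborel_pair.Fubini_integral[OF ik] .
  have L: "(\<integral>x. ?k x y \<partial>lborel) = indicator {a..b} y *\<^sub>R (g y \<bullet> (q y - q a))" for y
  proof (cases "y \<in> {a..b}")
    case True
    have "(\<integral>x. ?k x y \<partial>lborel) = (\<integral>x. g y \<bullet> (indicator {a..y} x *\<^sub>R p x) \<partial>lborel)"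
      using True by (intro Bochner_Integration.integral_cong) (auto simp: indicator_def)
    also have "\<dots> = g y \<bullet> (\<integral>x. indicator {a..y} x *\<^sub>R p x \<partial>lborel)"
      using primitiveD(2)[OF q, of a y] by (intro integral_inner_right) (simp add: set_integrable_def)
    also have "\<dots> = g y \<bullet> (q y - q a)"
      using primitiveD(3)[OF q, of a y] True by (simp add: set_lebesgue_integral_def)
    finally show ?thesis using True by simp
  qed simp
  have R: "(\<integral>y. ?k x y \<partial>lborel) = indicator {a..b} x *\<^sub>R ((f b - f x) \<bullet> p x)" for x
  proof (cases "x \<in> {a..b}")
    case True
    have "(\<integral>y. ?k x y \<partial>lborel) = (\<integral>y. (indicator {x..b} y *\<^sub>R g y) \<bullet> p x \<partial>lborel)"
      using True by (intro Bochner_Integration.integral_cong) (auto simp: indicator_def)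
    also have "\<dots> = (\<integral>y. indicator {x..b} y *\<^sub>R g y \<partial>lborel) \<bullet> p x"
      using primitiveD(2)[OF f, of x b] by (intro integral_inner_left) (simp add: set_integrable_def)
    also have "\<dots> = (f b - f x) \<bullet> p x"
      using primitiveD(3)[OF f, of x b] True by (simp add: set_lebesgue_integral_def)
    finally show ?thesis using True by simp
  qed simp
  have qc: "continuous_on UNIV q" and fc: "continuous_on UNIV f"
    using primitive_continuous q f by auto
  have "set_integrable lborel {a..b} (\<lambda>t. q t \<bullet> g t)"
    using set_integrable_continuous_inner[OF qc primitiveD(2)[OF f]] .
  then have i1: "set_integrable lborel {a..b} (\<lambda>t. g t \<bullet> q t)" by (simp add: inner_commute)
  have i2: "set_integrable lborel {a..b} (\<lambda>t. f t \<bullet> p t)"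
    using set_integrable_continuous_inner[OF fc primitiveD(2)[OF q]] .
  have i3: "set_integrable lborel {a..b} (\<lambda>t. q a \<bullet> g t)"
    using set_integrable_continuous_inner[OF _ primitiveD(2)[OF f], of "\<lambda>_. q a"] by auto
  have i4: "set_integrable lborel {a..b} (\<lambda>t. f b \<bullet> p t)"
    using set_integrable_continuous_inner[OF _ primitiveD(2)[OF q], of "\<lambda>_. f b"] by auto
  have e3: "(LBINT t:{a..b}. q a \<bullet> g t) = q a \<bullet> (f b - f a)"
  proof -
    have "(LBINT t:{a..b}. q a \<bullet> g t) = (\<integral>t. q a \<bullet> ?G t \<partial>lborel)"
      unfolding set_lebesgue_integral_def by (intro Bochner_Integration.integral_cong) auto
    also have "\<dots> = q a \<bullet> (\<integral>t. ?G t \<partial>lborel)" using iG by (intro integral_inner_right) auto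
    finally show ?thesis using primitiveD(3)[OF f ab] by (simp add: set_lebesgue_integral_def)
  qed
  have e4: "(LBINT t:{a..b}. f b \<bullet> p t) = f b \<bullet> (q b - q a)"
  proof -
    have "(LBINT t:{a..b}. f b \<bullet> p t) = (\<integral>t. f b \<bullet> ?P t \<partial>lborel)"
      unfolding set_lebesgue_integral_def by (intro Bochner_Integration.integral_cong) auto
    also have "\<dots> = f b \<bullet> (\<integral>t. ?P t \<partial>lborel)" using iP by (intro integral_inner_right) auto
    finally show ?thesis using primitiveD(3)[OF q ab] by (simp add: set_lebesgue_integral_def)
  qed
  have "(LBINT t:{a..b}. g t \<bullet> q t - q a \<bullet> g t) = (LBINT t:{a..b}. f b \<bullet> p t - f t \<bullet> p t)"
    using F unfolding L R set_lebesgue_integral_def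
    by (simp add: inner_diff_left inner_diff_right inner_commute)
  then have "(LBINT t:{a..b}. g t \<bullet> q t) - q a \<bullet> (f b - f a)
      = f b \<bullet> (q b - q a) - (LBINT t:{a..b}. f t \<bullet> p t)"
    using i1 i2 i3 i4 e3 e4 by (simp add: set_integral_diff)
  then show ?thesis by (simp add: inner_diff_right inner_commute)
qed

text \<open>\<open>ennreal\<close> truncates at 0, so \<open>?M\<close> and \<open>?N\<close> have
  the positive and the negative part of \<open>r\<close> as densities. The vanishing integrals make
  these measures agree, with finite values, on compact intervals, an intersection stable generator
  of the Borel sets. Hence the two parts coincide almost everywhere, and a number whose positive and
  negative parts are equal is 0.\<close>

lemma lborel_AE_zeroI:
  fixes r :: "real \<Rightarrow> real"
  assumes rm [measurable]: "r \<in> borel_measurable borel"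
    and int: "\<And>a b. set_integrable lborel {a..b} r"
    and zero: "\<And>a b. a \<le> b \<Longrightarrow> (LBINT t:{a..b}. r t) = 0"
  shows "AE t in lborel. r t = 0"
proof -
  let ?M = "density lborel (\<lambda>t. ennreal (r t))" and ?N = "density lborel (\<lambda>t. ennreal (- r t))"
  let ?E = "range (\<lambda>(a, b). {a..b::real})"
  have em: "emeasure ?M {a..b} = emeasure ?N {a..b}" "emeasure ?M {a..b} \<noteq> \<infinity>" for a b
  proof -
    have i: "integrable lborel (\<lambda>t. indicator {a..b} t *\<^sub>R r t)"
      using int by (simp add: set_integrable_def)
    have ip: "integrable lborel (\<lambda>t. max 0 (indicator {a..b} t *\<^sub>R r t))"
      "integrable lborel (\<lambda>t. max 0 (- (indicator {a..b} t *\<^sub>R r t)))"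
      using i by auto
    have 1: "emeasure ?M {a..b} = ennreal (\<integral>t. max 0 (indicator {a..b} t *\<^sub>R r t) \<partial>lborel)"
      by (subst emeasure_density, simp, simp, subst nn_integral_eq_integral[symmetric])
        (use ip in \<open>auto intro!: nn_integral_cong simp: indicator_def max_def ennreal_neg\<close>)
    have 2: "emeasure ?N {a..b} = ennreal (\<integral>t. max 0 (- (indicator {a..b} t *\<^sub>R r t)) \<partial>lborel)"
      by (subst emeasure_density, simp, simp, subst nn_integral_eq_integral[symmetric])
        (use ip in \<open>auto intro!: nn_integral_cong simp: indicator_def max_def ennreal_neg\<close>)
    have "(\<integral>t. indicator {a..b} t *\<^sub>R r t \<partial>lborel) = 0"
      using zero[of a b] by (cases "a \<le> b") (auto simp: set_lebesgue_integral_def)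
    moreover have "(\<integral>t. indicator {a..b} t *\<^sub>R r t \<partial>lborel)
       = (\<integral>t. max 0 (indicator {a..b} t *\<^sub>R r t) - max 0 (- (indicator {a..b} t *\<^sub>R r t)) \<partial>lborel)"
      by (intro Bochner_Integration.integral_cong) (auto simp: max_def)
    ultimately have "(\<integral>t. max 0 (indicator {a..b} t *\<^sub>R r t) \<partial>lborel)
        = (\<integral>t. max 0 (- (indicator {a..b} t *\<^sub>R r t)) \<partial>lborel)"
      using Bochner_Integration.integral_diff[OF ip] by linarith
    with 1 2 show "emeasure ?M {a..b} = emeasure ?N {a..b}" "emeasure ?M {a..b} \<noteq> \<infinity>" by auto
  qed
  have "?M = ?N"
  proof (rule measure_eqI_generator_eq[where E = ?E and \<Omega> = UNIV and A = "\<lambda>n. {- real n..real n}"])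
    show "Int_stable ?E"
    proof (rule Int_stableI)
      fix A B assume "A \<in> ?E" "B \<in> ?E"
      then obtain a b c d where "A = {a..b}" "B = {c..d}" by auto
      then have "A \<inter> B = {max a c..min b d}" by auto
      then show "A \<inter> B \<in> ?E" by auto
    qed
    show "sets ?M = sigma_sets UNIV ?E" "sets ?N = sigma_sets UNIV ?E"
      unfolding sets_density sets_lborel
      by (simp_all add: borel_eq_atLeastAtMost sets_measure_of)
    show "\<And>X. X \<in> ?E \<Longrightarrow> emeasure ?M X = emeasure ?N X" using em by auto
    show "(\<Union>i. {- real i..real i}) = UNIV"
    proof -
      have "\<exists>i. - real i \<le> x \<and> x \<le> real i" for x
        using real_arch_simple[of "\<bar>x\<bar>"] by (metis abs_le_D1 abs_le_D2 minus_le_iff)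
      then show ?thesis by auto
    qed
    show "\<And>i. emeasure ?M {- real i..real i} \<noteq> \<infinity>" using em by auto
  qed auto
  then have "AE t in lborel. ennreal (r t) = ennreal (- r t)"
    by (intro sigma_finite_measure.density_unique[OF sigma_finite_lborel]) auto
  then show ?thesis
  proof eventually_elim
    case (elim t)
    then show ?case by (cases "r t \<ge> 0") (auto simp: ennreal_neg)
  qed
qed

section \<open>Operations on absolutely continuous curves\<close>

lemma primitive_add:
  assumes "primitive q p" "primitive f g"
  shows "primitive (\<lambda>t. q t + f t) (\<lambda>t. p t + g t)"
  unfolding primitive_def
proof (intro conjI allI impI)
  show "(\<lambda>t. p t + g t) \<in> borel_measurable lborel"
    using primitiveD(1)[OF assms(1)] primitiveD(1)[OF assms(2)] by auto
  show "set_integrable lborel {a..b} (\<lambda>t. p t + g t)" for a b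
    using primitiveD(2)[OF assms(1)] primitiveD(2)[OF assms(2)] by (rule set_integral_add)
  show "(q b + f b) - (q a + f a) = (LBINT t:{a..b}. p t + g t)" if "a \<le> b" for a b
    using primitiveD(3)[OF assms(1) that] primitiveD(3)[OF assms(2) that]
    by (subst set_integral_add(2)) (auto intro!: primitiveD assms simp: algebra_simps)
qed

lemma primitive_bounded_linear:
  assumes "primitive q p" "bounded_linear L"
  shows "primitive (\<lambda>t. L (q t)) (\<lambda>t. L (p t))"
  unfolding primitive_def
proof (intro conjI allI impI)
  interpret bounded_linear L by fact
  have [measurable]: "L \<in> borel_measurable borel"
    by (intro borel_measurable_continuous_onI linear_continuous_on) fact
  have [measurable]: "p \<in> borel_measurable borel" using primitiveD(1)[OF assms(1)] .
  show "(\<lambda>t. L (p t)) \<in> borel_measurable lborel" by measurable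
  have i: "integrable lborel (\<lambda>t. L (indicator {a..b} t *\<^sub>R p t))" 
    "(\<integral>t. L (indicator {a..b} t *\<^sub>R p t) \<partial>lborel) = L (\<integral>t. indicator {a..b} t *\<^sub>R p t \<partial>lborel)" for a b
    using primitiveD(2)[OF assms(1), of a b] unfolding set_integrable_def 
    by (auto intro: integrable_bounded_linear[OF assms(2)] integral_bounded_linear[OF assms(2)])
  show "set_integrable lborel {a..b} (\<lambda>t. L (p t))" for a b
    using i(1)[of a b] by (simp add: set_integrable_def scaleR)
  show "L (q b) - L (q a) = (LBINT t:{a..b}. L (p t))" if "a \<le> b" for a b
    using i(2)[of a b] primitiveD(3)[OF assms(1) that]
    by (simp add: set_lebesgue_integral_def scaleR diff[symmetric])
qed

lemma primitive_diff:
  assumes "primitive q p" "primitive f g"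
  shows "primitive (\<lambda>t. q t - f t) (\<lambda>t. p t - g t)"
  using primitive_add[OF assms(1) primitive_bounded_linear[OF assms(2), of uminus]]
  by (simp add: bounded_linear_minus[OF bounded_linear_ident])

lemma primitive_scaleR:
  assumes "primitive q p" shows "primitive (\<lambda>t. c *\<^sub>R q t) (\<lambda>t. c *\<^sub>R p t)"
  using primitive_bounded_linear[OF assms, of "scaleR c"] by (simp add: bounded_linear_scaleR_right)

lemma primitive_const: "primitive (\<lambda>t. c) (\<lambda>t. 0)"
  by (simp add: primitive_def set_integrable_def set_lebesgue_integral_def)

lemma primitive_sum:
  assumes "finite I" "\<And>i. i \<in> I \<Longrightarrow> primitive (q i) (p i)"
  shows "primitive (\<lambda>t. \<Sum>i\<in>I. q i t) (\<lambda>t. \<Sum>i\<in>I. p i t)"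
  using assms by (induction I rule: finite_induct) (auto intro: primitive_const primitive_add)

lemma primitive_unique:
  assumes "primitive q p" "primitive q p'"
  shows "AE t in lborel. p t = p' t"
proof -
  have "AE t in lborel. (p t - p' t) \<bullet> e = 0" if "e \<in> Basis" for e
  proof (rule lborel_AE_zeroI)
    have *: "primitive (\<lambda>t. (q t - q t) \<bullet> e) (\<lambda>t. (p t - p' t) \<bullet> e)"
      by (rule primitive_bounded_linear[OF primitive_diff[OF assms] bounded_linear_inner_left])
    show "(\<lambda>t. (p t - p' t) \<bullet> e) \<in> borel_measurable borel"
      "\<And>a b. set_integrable lborel {a..b} (\<lambda>t. (p t - p' t) \<bullet> e)"
      "\<And>a b. a \<le> b \<Longrightarrow> (LBINT t:{a..b}. (p t - p' t) \<bullet> e) = 0"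
      using primitiveD[OF *] by auto
  qed
  then have "AE t in lborel. \<forall>e\<in>Basis. (p t - p' t) \<bullet> e = 0"
    by (intro AE_finite_allI) auto
  then show ?thesis by eventually_elim (metis euclidean_eqI inner_zero_left right_minus_eq)
qed

lemma primitive_C1:
  fixes f :: "real \<Rightarrow> 'a::euclidean_space"
  assumes "\<And>t. (f has_vector_derivative g t) (at t)" "continuous_on UNIV g"
  shows "primitive f g"
  unfolding primitive_def
proof (intro conjI allI impI)
  show "g \<in> borel_measurable lborel"
    using borel_measurable_continuous_onI[OF assms(2)] by simp
  show i: "set_integrable lborel {a..b} g" for a b
    unfolding set_integrable_def
    using borel_integrable_compact[of "{a..b}" g] continuous_on_subset[OF assms(2)]
    by (simp add: indicator_def if_distrib cong: if_cong)
  show "f b - f a = (LBINT t:{a..b}. g t)" if "a \<le> b" for a b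
  proof -
    have "(g has_integral (f b - f a)) {a..b}"
      using that assms(1) by (intro fundamental_theorem_of_calculus)
        (auto intro: has_vector_derivative_at_within)
    then show ?thesis using set_borel_integral_eq_integral(2)[OF i] by (simp add: integral_unique)
  qed
qed

lemma primitive_shift:
  assumes "primitive q p"
  shows "primitive (\<lambda>t. q (t + c)) (\<lambda>t. p (t + c))"
  unfolding primitive_def
proof (intro conjI allI impI)
  have [measurable]: "p \<in> borel_measurable borel" using primitiveD(1)[OF assms] .
  show "(\<lambda>t. p (t + c)) \<in> borel_measurable lborel" by measurable
  \<comment> \<open>The factor 1 gives the argument the shape \<open>c + r * t\<close> of the affine
    substitution rule; the reflection below uses the same form with factor -1.\<close>
  have eq: "(\<lambda>t. indicator {a+c..b+c} (c + 1 * t) *\<^sub>R p (c + 1 * t)) = (\<lambda>t. indicator {a..b} t *\<^sub>R p (t + c))" for a b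
    by (auto simp: indicator_def algebra_simps)
  show "set_integrable lborel {a..b} (\<lambda>t. p (t + c))" for a b
    using lborel_integrable_real_affine[of "\<lambda>t. indicator {a+c..b+c} t *\<^sub>R p t" 1 c, unfolded eq]
      primitiveD(2)[OF assms] by (simp add: set_integrable_def)
  show "q (b + c) - q (a + c) = (LBINT t:{a..b}. p (t + c))" if "a \<le> b" for a b
    using primitiveD(3)[OF assms, of "a + c" "b + c"] that
      lborel_integral_real_affine[of 1 "\<lambda>t. indicator {a+c..b+c} t *\<^sub>R p t" c, unfolded eq]
    by (simp add: set_lebesgue_integral_def)
qed

lemma primitive_reflect:
  assumes "primitive q p"
  shows "primitive (\<lambda>t. q (- t)) (\<lambda>t. - p (- t))"
  unfolding primitive_def
proof (intro conjI allI impI)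
  have [measurable]: "p \<in> borel_measurable borel" using primitiveD(1)[OF assms] .
  show "(\<lambda>t. - p (- t)) \<in> borel_measurable lborel" by measurable
  have eq: "(\<lambda>t. indicator {-b..-a} (0 + (-1) * t) *\<^sub>R p (0 + (-1) * t)) = (\<lambda>t. indicator {a..b} t *\<^sub>R p (- t))" for a b :: real
    by (auto simp: indicator_def algebra_simps)
  show "set_integrable lborel {a..b} (\<lambda>t. - p (- t))" for a b
    using lborel_integrable_real_affine[of "\<lambda>t. indicator {-b..-a} t *\<^sub>R p t" "-1" 0, unfolded eq]
      primitiveD(2)[OF assms] by (simp add: set_integrable_def)
  show "q (- b) - q (- a) = (LBINT t:{a..b}. - p (- t))" if "a \<le> b" for a b
    using primitiveD(3)[OF assms, of "- b" "- a"] that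
      lborel_integral_real_affine[of "-1" "\<lambda>t. indicator {-b..-a} t *\<^sub>R p t" 0, unfolded eq]
    by (simp add: set_lebesgue_integral_def algebra_simps)
qed

text \<open>Only intervals with \<open>T\<close> inside need an argument: there the increments of
  the two pieces add up because the curves agree at \<open>T\<close>. To the right of
  \<open>T\<close> the glued density differs from \<open>g\<close> at most at the single point
  \<open>T\<close>, a null set.\<close>

lemma primitive_glue:
  assumes q: "primitive q p" and f: "primitive f g" and T: "q T = f T"
  shows "primitive (\<lambda>t. if t \<le> T then q t else f t) (\<lambda>t. if t \<le> T then p t else g t)"
    (is "primitive ?h ?k")
  unfolding primitive_def
proof (intro conjI allI impI)
  have [measurable]: "p \<in> borel_measurable borel" "g \<in> borel_measurable borel"
    using primitiveD(1)[OF q] primitiveD(1)[OF f] .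
  show "?k \<in> borel_measurable lborel" by measurable
  show i: "set_integrable lborel {a..b} ?k" for a b
  proof -
    have 1: "set_integrable lborel ({a..b} \<inter> {..T}) p" 
      by (rule set_integrable_subset[OF primitiveD(2)[OF q, of a b]]) auto
    have 2: "set_integrable lborel ({a..b} \<inter> {T<..}) g"
      by (rule set_integrable_subset[OF primitiveD(2)[OF f, of a b]]) auto
    have eq: "(\<lambda>t. indicator ({a..b} \<inter> {..T}) t *\<^sub>R p t + indicator ({a..b} \<inter> {T<..}) t *\<^sub>R g t) 
       = (\<lambda>t. indicator {a..b} t *\<^sub>R ?k t)" by (auto simp: indicator_def)
    show ?thesis
      using Bochner_Integration.integrable_add[OF 1[unfolded set_integrable_def] 2[unfolded set_integrable_def]]
      unfolding set_integrable_def eq .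
  qed
  have left: "?h b - ?h a = (LBINT t:{a..b}. ?k t)" if "a \<le> b" "b \<le> T" for a b
  proof -
    have "(LBINT t:{a..b}. ?k t) = (LBINT t:{a..b}. p t)"
      by (rule set_lebesgue_integral_cong) (use that in auto)
    then show ?thesis using primitiveD(3)[OF q that(1)] that by simp
  qed
  have right: "?h b - ?h a = (LBINT t:{a..b}. ?k t)" if "a \<le> b" "T \<le> a" for a b
  proof -
    have "(LBINT t:{a..b}. ?k t) = (LBINT t:{a..b}. g t)"
    proof (rule set_lebesgue_integral_cong_AE)
      have "AE t in lborel. t \<noteq> T" by (rule AE_lborel_singleton)
      then show "AE t\<in>{a..b} in lborel. ?k t = g t"
        by eventually_elim (use that in auto)
    qed auto
    moreover have "?h b = f b" using that T by (cases "b = T") auto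
    moreover have "?h a = f a" using that T by (cases "a = T") auto
    ultimately show ?thesis using primitiveD(3)[OF f that(1)] that by simp
  qed
  show "?h b - ?h a = (LBINT t:{a..b}. ?k t)" if ab: "a \<le> b" for a b
  proof -
    consider "b \<le> T" | "T \<le> a" | "a \<le> T" "T \<le> b" by linarith
    then show ?thesis
    proof cases
      case 3
      have "(LBINT t:{a..b}. ?k t) = (LBINT t:{a..T}. ?k t) + (LBINT t:{T..b}. ?k t)"
        unfolding set_borel_integral_eq_integral(2)[OF i]
        using 3 set_borel_integral_eq_integral(1)[OF i]
        by (intro Henstock_Kurzweil_Integration.integral_combine[symmetric]) auto
      with left[OF 3(1)] right[OF 3(2)] show ?thesis by (simp add: algebra_simps)
    qed (use left right ab in blast)+
  qed
qed

section \<open>Hat functions and weak derivatives\<close>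

text \<open>The tent of height \<open>h\<close> over the window from \<open>a - h\<close> to
  \<open>a + h\<close>, written as a second difference of the ramp \<open>max 0 (t - c)\<close>. In
  this form the density \<open>hat'\<close> and the antiderivative \<open>hat_prim\<close> come by
  linearity from those of a single ramp.\<close>

definition hat :: "real \<Rightarrow> real \<Rightarrow> real \<Rightarrow> real" where
  "hat a h t = max 0 (t - (a - h)) - 2 * max 0 (t - a) + max 0 (t - (a + h))"

definition hat' :: "real \<Rightarrow> real \<Rightarrow> real \<Rightarrow> real" where
  "hat' a h t = indicator {a - h..} t - 2 * indicator {a..} t + indicator {a + h..} t"

lemma hat_eq: "h > 0 \<Longrightarrow> hat a h t = max 0 (h - \<bar>t - a\<bar>)"
  by (auto simp: hat_def max_def abs_if)

lemma hat'_eq: "h > 0 \<Longrightarrow> hat' a h t = (if a - h \<le> t \<and> t < a then 1 else if a \<le> t \<and> t < a + h then -1 else 0)"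
  by (auto simp: hat'_def indicator_def)

lemma hat_nonneg: "h > 0 \<Longrightarrow> 0 \<le> hat a h t"
  by (simp add: hat_eq)

lemma hat_le: "h > 0 \<Longrightarrow> hat a h t \<le> h"
  by (simp add: hat_eq)

lemma hat_outside: "h > 0 \<Longrightarrow> t \<notin> {a-h..a+h} \<Longrightarrow> hat a h t = 0"
  by (auto simp: hat_eq)

lemma continuous_hat [continuous_intros]: "continuous_on S (hat a h)"
  unfolding hat_def by (intro continuous_intros)

lemma primitive_ramp: "primitive (\<lambda>t. max 0 (t - c)) (indicator {c..} :: real \<Rightarrow> real)"
  unfolding primitive_def
proof (intro conjI allI impI)
  show "indicator {c..} \<in> borel_measurable lborel" by auto
  have eq: "(\<lambda>t. indicator {a..b} t *\<^sub>R indicator {c..} t) = (indicator {max a c..b} :: real \<Rightarrow> real)" for a b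
    by (auto simp: indicator_def)
  show "set_integrable lborel {a..b} (indicator {c..} :: real \<Rightarrow> real)" for a b
    unfolding set_integrable_def eq by (auto simp: emeasure_lborel_Icc_eq)
  show "max 0 (b - c) - max 0 (a - c) = (LBINT t:{a..b}. indicator {c..} t)" if "a \<le> b" for a b
    unfolding set_lebesgue_integral_def eq using that by (auto simp: measure_def emeasure_lborel_Icc_eq max_def)
qed

lemma primitive_hat: "primitive (hat a h) (hat' a h)"
proof -
  have "primitive (\<lambda>t. max 0 (t - (a - h)) - 2 *\<^sub>R max 0 (t - a) + max 0 (t - (a + h)))
     (\<lambda>t. indicator {a - h..} t - 2 *\<^sub>R indicator {a..} t + indicator {a + h..} t)"
    by (intro primitive_add primitive_diff primitive_scaleR primitive_ramp)
  then show ?thesis by (simp add: hat_def[abs_def] hat'_def[abs_def])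
qed

text \<open>Each ramp of \<open>hat\<close> is replaced by half its square. The result rises from 0
  to \<open>h\<^sup>2\<close>, the mass of the tent, which explains the factor
  \<open>h\<^sup>2\<close> in the averages below.\<close>

definition hat_prim :: "real \<Rightarrow> real \<Rightarrow> real \<Rightarrow> real" where
  "hat_prim a h t = (max 0 (t - (a - h)))\<^sup>2 / 2 - (max 0 (t - a))\<^sup>2 + (max 0 (t - (a + h)))\<^sup>2 / 2"

lemma has_derivative_ramp_square:
  "((\<lambda>t. (max 0 (t - c))\<^sup>2) has_real_derivative 2 * max 0 (x - c)) (at x)"
proof -
  consider "x < c" | "x > c" | "x = c" by linarith
  then show ?thesis
  proof cases
    case 1
    have "((\<lambda>t. 0) has_real_derivative 2 * max 0 (x - c)) (at x)"
      using 1 by (auto simp: max_def)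
    then show ?thesis
      by (rule has_field_derivative_transform_within_open[where S = "{..<c}"]) (use 1 in \<open>auto simp: max_def\<close>)
  next
    case 2
    have "((\<lambda>t. (t - c)\<^sup>2) has_real_derivative 2 * max 0 (x - c)) (at x)"
      using 2 by (auto intro!: derivative_eq_intros simp: max_def)
    then show ?thesis
      by (rule has_field_derivative_transform_within_open[where S = "{c<..}"]) (use 2 in \<open>auto simp: max_def\<close>)
  next
    case 3
    have *: "((\<lambda>h. max 0 h) \<longlongrightarrow> 0) (at (0::real))"
      using tendsto_max[OF tendsto_const[of 0 "at (0::real)"] tendsto_ident_at[of "0::real" UNIV]] by simp
    have "((\<lambda>h. (max 0 h)\<^sup>2 / h) \<longlongrightarrow> 0) (at (0::real))"
      using * by (rule Lim_transform_eventually) 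
        (auto simp: eventually_at max_def power2_eq_square intro!: exI[of _ 1])
    then show ?thesis using 3 by (simp add: DERIV_def)
  qed
qed

lemma hat_prim_has_derivative: "(hat_prim a h has_real_derivative hat a h t) (at t)"
proof -
  have "hat_prim a h = (\<lambda>t. (max 0 (t - (a - h)))\<^sup>2 / 2 - (max 0 (t - a))\<^sup>2 + (max 0 (t - (a + h)))\<^sup>2 / 2)"
    by (auto simp: hat_prim_def)
  moreover have "(\<dots> has_real_derivative 2 * max 0 (t - (a - h)) / 2 - 2 * max 0 (t - a) + 2 * max 0 (t - (a + h)) / 2) (at t)"
    by (intro DERIV_add DERIV_diff DERIV_cdivide has_derivative_ramp_square)
  ultimately show ?thesis by (simp add: hat_def)
qed

lemma hat_prim_left: "h > 0 \<Longrightarrow> t \<le> a - h \<Longrightarrow> hat_prim a h t = 0"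
  by (simp add: hat_prim_def max_def)

lemma hat_prim_right: "h > 0 \<Longrightarrow> t \<ge> a + h \<Longrightarrow> hat_prim a h t = h\<^sup>2"
  by (simp add: hat_prim_def max_def power2_eq_square field_simps)

lemma hat_integral:
  assumes "h > 0"
  shows "set_integrable lborel {a-h..a+h} (hat a h)" "(LBINT t:{a-h..a+h}. hat a h t) = h\<^sup>2"
proof -
  have *: "primitive (hat_prim a h) (hat a h)"
    by (intro primitive_C1 continuous_hat)
      (use hat_prim_has_derivative in \<open>simp add: has_real_derivative_iff_has_vector_derivative\<close>)
  show "set_integrable lborel {a-h..a+h} (hat a h)" using primitiveD(2)[OF *] .
  show "(LBINT t:{a-h..a+h}. hat a h t) = h\<^sup>2"
    using primitiveD(3)[OF *, of "a-h" "a+h"] assms hat_prim_left[of h "a-h" a] hat_prim_right[of h a "a+h"] by simp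
qed

section \<open>Weak derivatives and absolute continuity\<close>

lemma test_functionE:
  assumes "test_function \<phi>"
  obtains N where "N > 0" "\<And>t. \<bar>t\<bar> \<ge> N \<Longrightarrow> \<phi> t = 0 \<and> deriv \<phi> t = 0"
    "\<And>t. (\<phi> has_real_derivative deriv \<phi> t) (at t)" "continuous_on UNIV (deriv \<phi>)"
proof -
  obtain D where D: "\<And>t. (\<phi> has_vector_derivative D t) (at t)" "continuous_on UNIV D"
    using assms unfolding test_function_def C1_differentiable_on_def by blast
  have D': "(\<phi> has_real_derivative D t) (at t)" for t
    using D(1) by (simp add: has_real_derivative_iff_has_vector_derivative)
  have der: "deriv \<phi> = D" using D' by (intro ext DERIV_imp_deriv)
  have "bounded (closure {t. \<phi> t \<noteq> 0})"
    using assms unfolding test_function_def by (intro compact_imp_bounded) blast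
  then obtain B where B: "\<And>t. t \<in> closure {t. \<phi> t \<noteq> 0} \<Longrightarrow> \<bar>t\<bar> \<le> B"
    unfolding bounded_iff real_norm_def by blast
  have out: "\<phi> t = 0" "D t = 0" if "\<bar>t\<bar> > B" for t
  proof -
    have t: "t \<notin> closure {t. \<phi> t \<noteq> 0}" using B[of t] that by fastforce
    have z: "\<phi> s = 0" if "s \<notin> closure {t. \<phi> t \<noteq> 0}" for s
      using that closure_subset[of "{t. \<phi> t \<noteq> 0}"] by blast
    show "\<phi> t = 0" using z[OF t] .
    \<comment> \<open>Off the closed support the function agrees with 0 on an open set, so its
      derivative vanishes there too.\<close>
    have "((\<lambda>_. 0) has_real_derivative 0) (at t)" by simp
    then have "(\<phi> has_real_derivative 0) (at t)"
    proof (rule has_field_derivative_transform_within_open[where S = "- closure {t. \<phi> t \<noteq> 0}"])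
      show "open (- closure {t. \<phi> t \<noteq> 0})" by (simp add: open_Compl)
      show "t \<in> - closure {t. \<phi> t \<noteq> 0}" using t by simp
      show "\<And>x. x \<in> - closure {t. \<phi> t \<noteq> 0} \<Longrightarrow> 0 = \<phi> x"
        by (rule z[symmetric], drule ComplD)
    qed
    then show "D t = 0" by (rule DERIV_unique[OF D'])
  qed
  show ?thesis
  proof (rule that)
    show "\<bar>B\<bar> + 1 > 0" by simp
    show "\<phi> t = 0 \<and> deriv \<phi> t = 0" if "\<bar>B\<bar> + 1 \<le> \<bar>t\<bar>" for t
      using that out[of t] der by simp
    show "(\<phi> has_real_derivative deriv \<phi> t) (at t)" for t using D' der by simp
    show "continuous_on UNIV (deriv \<phi>)" using D(2) der by simp
  qed
qed

lemma set_integrable_continuous: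
  fixes f :: "real \<Rightarrow> 'a::{banach,second_countable_topology}"
  assumes "continuous_on UNIV f"
  shows "set_integrable lborel {a..b} f"
  unfolding set_integrable_def
  using borel_integrable_compact[of "{a..b}" f] continuous_on_subset[OF assms]
  by (simp add: indicator_def if_distrib cong: if_cong)

lemma set_integral_inner_left:
  fixes g :: "real \<Rightarrow> 'a::euclidean_space"
  assumes "set_integrable M A g"
  shows "(LINT t:A|M. g t) \<bullet> e = (LINT t:A|M. g t \<bullet> e)"
  using assms unfolding set_lebesgue_integral_def set_integrable_def
  by (simp flip: integral_inner_left)

lemma lborel_integral_Icc:
  fixes g :: "real \<Rightarrow> 'a::euclidean_space"
  assumes "\<And>t. t \<notin> {a..b} \<Longrightarrow> g t = 0"
  shows "(LBINT t. g t) = (LBINT t:{a..b}. g t)"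
  unfolding set_lebesgue_integral_def
  by (rule Bochner_Integration.integral_cong) (use assms in \<open>auto simp: indicator_def\<close>)

text \<open>On a window beyond which the test function vanishes, integration by parts has no
  boundary terms. The vector identity is obtained by testing with every fixed vector
  \<open>e\<close>.\<close>

lemma primitive_imp_weak_derivative:
  fixes q :: "real \<Rightarrow> real ^ 'n"
  assumes q: "primitive q p"
  shows "has_weak_derivative q p"
  unfolding has_weak_derivative_def
proof (intro allI impI)
  fix \<phi> :: "real \<Rightarrow> real" assume "test_function \<phi>"
  then obtain N where N: "N > 0" "\<And>t. \<bar>t\<bar> \<ge> N \<Longrightarrow> \<phi> t = 0 \<and> deriv \<phi> t = 0"
    "\<And>t. (\<phi> has_real_derivative deriv \<phi> t) (at t)" "continuous_on UNIV (deriv \<phi>)"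
    by (rule test_functionE) blast
  have prim: "primitive \<phi> (deriv \<phi>)"
    using N by (intro primitive_C1) (simp_all add: has_real_derivative_iff_has_vector_derivative)
  have \<phi>c: "continuous_on UNIV \<phi>" by (rule primitive_continuous[OF prim])
  have qc: "continuous_on UNIV q" by (rule primitive_continuous[OF q])
  have i1: "set_integrable lborel {-N..N} (\<lambda>t. deriv \<phi> t *\<^sub>R q t)"
    using N(4) qc by (intro set_integrable_continuous_scaleR set_integrable_continuous)
  have i2: "set_integrable lborel {-N..N} (\<lambda>t. \<phi> t *\<^sub>R p t)"
    using \<phi>c primitiveD(2)[OF q] by (intro set_integrable_continuous_scaleR)
  have e1: "(LBINT t. deriv \<phi> t *\<^sub>R q t) = (LBINT t:{-N..N}. deriv \<phi> t *\<^sub>R q t)"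
    by (rule lborel_integral_Icc) (use N(2) in \<open>auto simp: abs_real_def\<close>)
  have e2: "(LBINT t. \<phi> t *\<^sub>R p t) = (LBINT t:{-N..N}. \<phi> t *\<^sub>R p t)"
    by (rule lborel_integral_Icc) (use N(2) in \<open>auto simp: abs_real_def\<close>)
  have "(LBINT t:{-N..N}. deriv \<phi> t *\<^sub>R q t) \<bullet> e = - (LBINT t:{-N..N}. \<phi> t *\<^sub>R p t) \<bullet> e" for e
  proof -
    have "primitive (\<lambda>t. \<phi> t *\<^sub>R e) (\<lambda>t. deriv \<phi> t *\<^sub>R e)"
      by (rule primitive_bounded_linear[OF prim bounded_linear_scaleR_left])
    from primitive_by_parts[OF q this, of "-N" N] N(1) N(2)[of N] N(2)[of "-N"]
    show ?thesis
      unfolding inner_minus_left set_integral_inner_left[OF i1] set_integral_inner_left[OF i2]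
      by (simp add: inner_commute)
  qed
  then show "(LBINT t. deriv \<phi> t *\<^sub>R q t) = - (LBINT t. \<phi> t *\<^sub>R p t)"
    unfolding e1 e2 by (rule vector_eq_rdot[THEN iffD1, OF allI])
qed

lemma set_integral_Icc_combine:
  fixes p :: "real \<Rightarrow> 'a::euclidean_space"
  assumes "\<And>a b. set_integrable lborel {a..b} p" "a \<le> c" "c \<le> b"
  shows "(LBINT t:{a..b}. p t) = (LBINT t:{a..c}. p t) + (LBINT t:{c..b}. p t)"
  unfolding set_borel_integral_eq_integral(2)[OF assms(1)]
  using assms(2,3) set_borel_integral_eq_integral(1)[OF assms(1)]
  by (intro Henstock_Kurzweil_Integration.integral_combine[symmetric]) auto

text \<open>An interval \<open>{a..b}\<close> with \<open>b < a\<close> is empty, so the difference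
  \<open>?I 0 t - ?I t 0\<close> is the oriented integral from 0 to \<open>t\<close>; the three
  cases below are its additivity.\<close>

lemma primitive_exists:
  fixes p :: "real \<Rightarrow> 'a::euclidean_space"
  assumes p: "p \<in> borel_measurable lborel" "\<And>a b. set_integrable lborel {a..b} p"
  obtains P where "primitive P p"
proof
  let ?I = "\<lambda>a b. LBINT t:{a..b}. p t"
  have z: "?I a b = 0" if "b \<le> a" for a b
  proof -
    have "?I a b = integral {a..b} p" by (rule set_borel_integral_eq_integral(2)[OF p(2)])
    also have "\<dots> = 0" using that by (cases "a = b") (auto intro: integral_unique)
    finally show ?thesis .
  qed
  have add: "?I a b = ?I a c + ?I c b" if "a \<le> c" "c \<le> b" for a b c
    by (rule set_integral_Icc_combine[OF p(2) that])
  have "?I 0 b - ?I b 0 - (?I 0 a - ?I a 0) = ?I a b" if "a \<le> b" for a b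
  proof -
    consider "0 \<le> a" | "a \<le> 0" "0 \<le> b" | "b \<le> 0" by linarith
    then show ?thesis
    proof cases
      case 1
      then have "?I a 0 = 0" "?I b 0 = 0" using that by (intro z; simp)+
      with add[OF 1 that] show ?thesis by (simp only: diff_zero add_diff_cancel_left')
    next
      case 2
      then have "?I 0 a = 0" "?I b 0 = 0" by (intro z; simp)+
      with add[OF 2] show ?thesis by (simp only: diff_zero) simp
    next
      case 3
      then have "?I 0 a = 0" "?I 0 b = 0" using that by (intro z; simp)+
      with add[OF that 3] show ?thesis by (simp only: diff_zero) simp
    qed
  qed
  then show "primitive (\<lambda>t. ?I 0 t - ?I t 0) p"
    using p by (simp add: primitive_def)
qed

text \<open>Tents of equal width have equal mass, so their antiderivatives agree far to the right as
  well as far to the left and the difference has compact support. These are the only test functions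
  used to pass from weak derivatives to densities.\<close>

lemma test_function_hat_diff:
  assumes "h > 0"
  shows "test_function (\<lambda>t. hat_prim a h t - hat_prim b h t)"
    "deriv (\<lambda>t. hat_prim a h t - hat_prim b h t) t = hat a h t - hat b h t"
proof -
  have d: "((\<lambda>t. hat_prim a h t - hat_prim b h t) has_real_derivative hat a h t - hat b h t) (at t)" for t
    by (intro DERIV_diff hat_prim_has_derivative)
  then show "deriv (\<lambda>t. hat_prim a h t - hat_prim b h t) t = hat a h t - hat b h t"
    by (rule DERIV_imp_deriv)
  have "t \<in> {min a b - h..max a b + h}" if "hat_prim a h t - hat_prim b h t \<noteq> 0" for t
  proof (rule ccontr)
    assume "t \<notin> {min a b - h..max a b + h}"
    then have "t \<le> a - h \<and> t \<le> b - h \<or> t \<ge> a + h \<and> t \<ge> b + h"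
      unfolding atLeastAtMost_iff min_def max_def by argo
    then have "hat_prim a h t - hat_prim b h t = 0"
      by (elim disjE conjE) (simp_all add: hat_prim_left[OF assms] hat_prim_right[OF assms])
    then show False using that by simp
  qed
  then have "{t. hat_prim a h t - hat_prim b h t \<noteq> 0} \<subseteq> {min a b - h..max a b + h}"
    by (intro subsetI) (simp only: mem_Collect_eq)
  then have "compact (closure {t. hat_prim a h t - hat_prim b h t \<noteq> 0})"
    unfolding compact_closure by (rule bounded_subset[OF bounded_closed_interval])
  moreover have "(\<lambda>t. hat_prim a h t - hat_prim b h t) C1_differentiable_on UNIV"
    unfolding C1_differentiable_on_def
  proof (intro exI conjI ballI)
    show "((\<lambda>t. hat_prim a h t - hat_prim b h t) has_vector_derivative hat a h t - hat b h t) (at t)" for t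
      using d[of t] unfolding has_real_derivative_iff_has_vector_derivative .
    show "continuous_on UNIV (\<lambda>t. hat a h t - hat b h t)" by (intro continuous_intros)
  qed
  ultimately show "test_function (\<lambda>t. hat_prim a h t - hat_prim b h t)"
    by (simp add: test_function_def)
qed

lemma hat_average_inner_lower:
  fixes g :: "real \<Rightarrow> 'a::euclidean_space"
  assumes h: "h > 0" and g: "continuous_on UNIV g" and close: "\<And>t. t \<in> {a-h..a+h} \<Longrightarrow> m \<le> g t \<bullet> e"
  shows "h\<^sup>2 * m \<le> (LBINT t. hat a h t *\<^sub>R g t) \<bullet> e"
proof -
  have i: "set_integrable lborel {a-h..a+h} (\<lambda>t. hat a h t *\<^sub>R g t)"
    by (intro set_integrable_continuous_scaleR set_integrable_continuous continuous_hat g)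
  have eq: "(LBINT t. hat a h t *\<^sub>R g t) \<bullet> e = (LBINT t:{a-h..a+h}. hat a h t * (g t \<bullet> e))"
  proof -
    have "(LBINT t. hat a h t *\<^sub>R g t) = (LBINT t:{a-h..a+h}. hat a h t *\<^sub>R g t)"
      by (rule lborel_integral_Icc) (subst hat_outside[OF h], simp_all)
    then show ?thesis by (simp add: set_integral_inner_left[OF i])
  qed
  have "h\<^sup>2 * m = (LBINT t:{a-h..a+h}. hat a h t * m)"
    using hat_integral(2)[OF h, of a] by simp
  also have "\<dots> \<le> (LBINT t:{a-h..a+h}. hat a h t * (g t \<bullet> e))"
  proof (rule set_integral_mono)
    show "set_integrable lborel {a - h..a + h} (\<lambda>t. hat a h t * m)"
      using hat_integral(1)[OF h] by simp
    show "set_integrable lborel {a - h..a + h} (\<lambda>t. hat a h t * (g t \<bullet> e))"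
      by (intro set_integrable_continuous continuous_intros g)
    fix t assume "t \<in> {a - h..a + h}"
    then show "hat a h t * m \<le> hat a h t * (g t \<bullet> e)"
      by (intro mult_left_mono close hat_nonneg[OF h])
  qed
  finally show ?thesis unfolding eq .
qed

text \<open>The du Bois-Reymond lemma. With \<open>P\<close> a primitive of \<open>p\<close>, the
  continuous function \<open>g = q - P\<close> has weak derivative 0; testing with differences of
  tent antiderivatives shows that tent averages of \<open>g\<close> of equal width do not depend on
  the centre. If \<open>g a\<close> and \<open>g b\<close> differed, narrow averages around them
  would be separated in the direction \<open>g a - g b\<close>.\<close>

lemma weak_derivative_imp_primitive:
  fixes q :: "real \<Rightarrow> real ^ 'n"
  assumes qc: "continuous_on UNIV q" and w: "has_weak_derivative q p"
    and p: "p \<in> borel_measurable lborel" "\<And>a b. set_integrable lborel {a..b} p"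
  shows "primitive q p"
proof -
  obtain P where P: "primitive P p" using primitive_exists[OF p] by blast
  have Pc: "continuous_on UNIV P" by (rule primitive_continuous[OF P])
  define g where "g t = q t - P t" for t
  have gc: "continuous_on UNIV g" unfolding g_def by (intro continuous_intros qc Pc)
  have eq: "(LBINT t. hat a h t *\<^sub>R g t) = (LBINT t. hat b h t *\<^sub>R g t)" if h: "h > 0" for a b h
  proof -
    have i: "integrable lborel (\<lambda>t. hat c h t *\<^sub>R f t)" if "continuous_on UNIV f" for c and f :: "real \<Rightarrow> real ^ 'n"
    proof -
      have *: "(\<lambda>t. indicator {c-h..c+h} t *\<^sub>R hat c h t *\<^sub>R f t) = (\<lambda>t. hat c h t *\<^sub>R f t)"
      proof
        fix t show "indicator {c-h..c+h} t *\<^sub>R hat c h t *\<^sub>R f t = hat c h t *\<^sub>R f t"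
          by (cases "t \<in> {c-h..c+h}") (simp, subst (1 2) hat_outside[OF h], simp_all)
      qed
      have "set_integrable lborel {c-h..c+h} (\<lambda>t. hat c h t *\<^sub>R f t)"
        using that by (intro set_integrable_continuous_scaleR set_integrable_continuous continuous_hat)
      then show ?thesis unfolding set_integrable_def * .
    qed
    let ?\<phi> = "\<lambda>t. hat_prim a h t - hat_prim b h t"
    note t = test_function_hat_diff[OF h, of a b]
    have "(LBINT t. deriv ?\<phi> t *\<^sub>R q t) = (LBINT t. deriv ?\<phi> t *\<^sub>R P t)"
      using w primitive_imp_weak_derivative[OF P] t(1) by (simp add: has_weak_derivative_def)
    then have "(LBINT t. hat a h t *\<^sub>R q t - hat b h t *\<^sub>R q t) = (LBINT t. hat a h t *\<^sub>R P t - hat b h t *\<^sub>R P t)"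
      by (simp add: t(2) scaleR_diff_left)
    then have "(LBINT t. hat a h t *\<^sub>R q t) - (LBINT t. hat b h t *\<^sub>R q t)
      = (LBINT t. hat a h t *\<^sub>R P t) - (LBINT t. hat b h t *\<^sub>R P t)"
      by (simp add: Bochner_Integration.integral_diff i qc Pc)
    then show ?thesis
      by (simp add: g_def scaleR_diff_right Bochner_Integration.integral_diff i qc Pc algebra_simps)
  qed
  have const: "g a = g b" for a b
  proof (rule ccontr)
    assume "g a \<noteq> g b"
    define e where "e = g a - g b"
    have e: "norm e > 0" "e \<bullet> e > 0" using \<open>g a \<noteq> g b\<close> by (auto simp: e_def)
    have "continuous_on UNIV (\<lambda>t. g t \<bullet> e)" by (intro continuous_intros gc)
    then have cont: "isCont (\<lambda>t. g t \<bullet> e) x" for x by (simp add: continuous_on_eq_continuous_at)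
    have "e \<bullet> e / 3 > 0" using e by simp
    have *: "\<exists>d>0. \<forall>t. \<bar>t - x\<bar> < d \<longrightarrow> \<bar>g t \<bullet> e - g x \<bullet> e\<bar> < e \<bullet> e / 3" for x
      using cont[of x] \<open>e \<bullet> e / 3 > 0\<close> unfolding continuous_at_eps_delta dist_real_def by blast
    obtain d1 where d1: "d1 > 0" "\<And>t. \<bar>t - a\<bar> < d1 \<Longrightarrow> \<bar>g t \<bullet> e - g a \<bullet> e\<bar> < e \<bullet> e / 3" using *[of a] by blast
    obtain d2 where d2: "d2 > 0" "\<And>t. \<bar>t - b\<bar> < d2 \<Longrightarrow> \<bar>g t \<bullet> e - g b \<bullet> e\<bar> < e \<bullet> e / 3" using *[of b] by blast
    define h where "h = min d1 d2 / 2"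
    have h: "h > 0" "h < d1" "h < d2" using d1 d2 by (auto simp: h_def)
    have "h\<^sup>2 * (g a \<bullet> e - e \<bullet> e / 3) \<le> (LBINT t. hat a h t *\<^sub>R g t) \<bullet> e"
    proof (rule hat_average_inner_lower[OF h(1) gc])
      fix t assume "t \<in> {a-h..a+h}"
      then have "\<bar>t - a\<bar> < d1" using h by auto
      from d1(2)[OF this] show "g a \<bullet> e - e \<bullet> e / 3 \<le> g t \<bullet> e" by linarith
    qed
    moreover have "h\<^sup>2 * (- (g b \<bullet> e) - e \<bullet> e / 3) \<le> (LBINT t. hat b h t *\<^sub>R g t) \<bullet> (- e)"
    proof (rule hat_average_inner_lower[OF h(1) gc])
      fix t assume "t \<in> {b-h..b+h}"
      then have "\<bar>t - b\<bar> < d2" using h by auto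
      from d2(2)[OF this] show "- (g b \<bullet> e) - e \<bullet> e / 3 \<le> g t \<bullet> (- e)" by (simp, linarith)
    qed
    ultimately have "h\<^sup>2 * (g a \<bullet> e - e \<bullet> e / 3) + h\<^sup>2 * (- (g b \<bullet> e) - e \<bullet> e / 3) \<le> 0"
      using eq[OF h(1), of a b] by simp
    \<comment> \<open>By the choice of \<open>e\<close>,
      \<open>g a \<bullet> e - g b \<bullet> e = e \<bullet> e\<close>; the two tolerances consume
      two thirds of it and one third remains.\<close>
    then have "h\<^sup>2 * (e \<bullet> e / 3) \<le> 0"
      by (simp add: e_def algebra_simps)
    then show False using h e by (simp add: mult_le_0_iff)
  qed
  show ?thesis
    unfolding primitive_def
  proof (intro conjI allI impI p)
    fix a b :: real assume "a \<le> b"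
    have "q b - q a = P b - P a" using const[of a b] by (simp add: g_def algebra_simps)
    then show "q b - q a = (LBINT t:{a..b}. p t)"
      using primitiveD(3)[OF P \<open>a \<le> b\<close>] by simp
  qed
qed

text \<open>On a bounded interval the majorant \<open>1 + (norm (p x))\<^sup>2\<close> of
  \<open>norm (p x)\<close> is integrable.\<close>

lemma L2loc_set_integrable:
  assumes "L2loc_curve p"
  shows "set_integrable lborel {a..b} p"
proof -
  have pm [measurable]: "p \<in> borel_measurable borel" using assms by (simp add: L2loc_curve_def)
  have i: "integrable lborel (\<lambda>t. indicator {a..b} t *\<^sub>R (norm (p t))\<^sup>2)"
    using assms by (simp add: L2loc_curve_def set_integrable_def)
  have "integrable lborel (indicator {a..b} :: real \<Rightarrow> real)"
    by (auto simp: emeasure_lborel_Icc_eq)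
  then have "integrable lborel (\<lambda>t. indicator {a..b} t + indicator {a..b} t *\<^sub>R (norm (p t))\<^sup>2)"
    using i by (rule Bochner_Integration.integrable_add)
  then show ?thesis
    unfolding set_integrable_def
  proof (rule Bochner_Integration.integrable_bound)
    show "AE x in lborel. norm (indicat_real {a..b} x *\<^sub>R p x) \<le> norm (indicat_real {a..b} x + indicat_real {a..b} x *\<^sub>R (norm (p x))\<^sup>2)"
    proof (intro AE_I2)
      fix x
      have "2 * norm (p x) \<le> 1 + (norm (p x))\<^sup>2" using sum_squares_bound[of 1 "norm (p x)"] by simp
      then have "norm (p x) \<le> 1 + (norm (p x))\<^sup>2" using norm_ge_zero[of "p x"] by linarith
      then show "norm (indicat_real {a..b} x *\<^sub>R p x) \<le> norm (indicat_real {a..b} x + indicat_real {a..b} x *\<^sub>R (norm (p x))\<^sup>2)"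
        by (simp add: indicator_def)
    qed
  qed simp
qed

lemma weak_derivative_iff_primitive:
  fixes q :: "real \<Rightarrow> real ^ 'n"
  assumes "L2loc_curve p" "continuous_on UNIV q"
  shows "has_weak_derivative q p \<longleftrightarrow> primitive q p"
  using weak_derivative_imp_primitive[OF assms(2)] primitive_imp_weak_derivative
    L2loc_set_integrable[OF assms(1)] assms(1) by (auto simp: L2loc_curve_def)

text \<open>Makes the choice in \<open>weak_derivative\<close> usable: one known density guarantees
  that the chosen function meets its specification, and uniqueness of densities identifies the two
  almost everywhere.\<close>

lemma weak_derivative_AE:
  fixes q :: "real \<Rightarrow> real ^ 'n"
  assumes "primitive q p" "L2loc_curve p"
  shows "L2loc_curve (weak_derivative q)" "primitive q (weak_derivative q)"
    "AE t in lborel. weak_derivative q t = p t"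
proof -
  have "L2loc_curve p \<and> has_weak_derivative q p"
    using assms primitive_imp_weak_derivative by blast
  then have *: "L2loc_curve (weak_derivative q) \<and> has_weak_derivative q (weak_derivative q)"
    unfolding weak_derivative_def by (rule someI[where P = "\<lambda>p. L2loc_curve p \<and> has_weak_derivative q p"])
  then show "L2loc_curve (weak_derivative q)" by simp
  show "primitive q (weak_derivative q)"
    using * weak_derivative_iff_primitive primitive_continuous[OF assms(1)] by blast
  then show "AE t in lborel. weak_derivative q t = p t"
    using assms(1) by (rule primitive_unique)
qed

lemma L2loc_continuous: "continuous_on UNIV p \<Longrightarrow> L2loc_curve p"
  unfolding L2loc_curve_def
  by (intro conjI allI set_integrable_continuous continuous_intros)
    (auto intro: borel_measurable_continuous_onI)

lemma L2_imp_L2loc: "L2_curve p \<Longrightarrow> L2loc_curve p"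
  unfolding L2loc_curve_def L2_curve_def set_integrable_def
  by (auto intro!: integrable_mult_indicator simp del: real_scaleR_def)

lemma H1loc_iff:
  fixes q :: "real \<Rightarrow> real ^ 'n"
  shows "q \<in> H1loc \<longleftrightarrow> (\<exists>p. L2loc_curve p \<and> primitive q p)"
proof
  assume "q \<in> H1loc"
  then obtain p where "continuous_on UNIV q" "L2loc_curve p" "has_weak_derivative q p"
    by (auto simp: H1loc_def)
  then show "\<exists>p. L2loc_curve p \<and> primitive q p" by (auto simp: weak_derivative_iff_primitive)
next
  assume "\<exists>p. L2loc_curve p \<and> primitive q p"
  then obtain p where p: "L2loc_curve p" "primitive q p" by blast
  have "continuous_on UNIV q" by (rule primitive_continuous[OF p(2)])
  then show "q \<in> H1loc"
    unfolding H1loc_def using p L2loc_continuous weak_derivative_iff_primitive[OF p(1)] by auto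
qed

lemma H1locD:
  fixes q :: "real \<Rightarrow> real ^ 'n"
  assumes "q \<in> H1loc"
  shows "L2loc_curve (weak_derivative q)" "primitive q (weak_derivative q)" "continuous_on UNIV q"
  using assms weak_derivative_AE primitive_continuous unfolding H1loc_iff by blast+

text \<open>Lets the energy be computed with an explicit density, as needed for glued, shifted and
  perturbed curves.\<close>

lemma energy_primitive:
  assumes "primitive q p" "L2loc_curve p"
  shows "energy V q = (\<integral>\<^sup>+ t. ennreal (1/2 * (norm (p t))\<^sup>2 + V (q t)) \<partial>lborel)"
  unfolding energy_def
proof (rule nn_integral_cong_AE)
  show "AE t in lborel. ennreal (1/2 * (norm (weak_derivative q t))\<^sup>2 + V (q t)) = ennreal (1/2 * (norm (p t))\<^sup>2 + V (q t))"
    using weak_derivative_AE(3)[OF assms] by eventually_elim simp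
qed

section \<open>Energy bounds and limits at infinity\<close>

lemma finite_energy_integrable:
  assumes q: "q \<in> H1loc" and E: "energy V q < \<infinity>" and V: "continuous_on UNIV V" "\<And>u. V u \<ge> 0"
  shows "integrable lborel (\<lambda>t. (norm (weak_derivative q t))\<^sup>2)" "integrable lborel (\<lambda>t. V (q t))"
    "energy V q = ennreal (LBINT t. 1/2 * (norm (weak_derivative q t))\<^sup>2 + V (q t))"
proof -
  have [measurable]: "weak_derivative q \<in> borel_measurable borel"
    using H1locD(1)[OF q] by (simp add: L2loc_curve_def)
  have "continuous_on UNIV (\<lambda>t. V (q t))"
    using continuous_on_compose2[OF V(1) H1locD(3)[OF q]] by auto
  then have [measurable]: "(\<lambda>t. V (q t)) \<in> borel_measurable borel"
    by (rule borel_measurable_continuous_onI)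
  let ?f = "\<lambda>t. 1/2 * (norm (weak_derivative q t))\<^sup>2 + V (q t)"
  have nn: "?f t \<ge> 0" for t using V(2) by simp
  have i: "integrable lborel ?f"
    using E nn unfolding energy_def by (intro integrableI_nonneg) auto
  show "integrable lborel (\<lambda>t. (norm (weak_derivative q t))\<^sup>2)"
  proof (rule Bochner_Integration.integrable_bound)
    show "integrable lborel (\<lambda>t. 2 * ?f t)" using i by (rule integrable_mult_right)
    show "AE t in lborel. norm ((norm (weak_derivative q t))\<^sup>2) \<le> norm (2 * ?f t)"
      using V(2) by (auto intro!: AE_I2)
  qed simp
  show "integrable lborel (\<lambda>t. V (q t))"
  proof (rule Bochner_Integration.integrable_bound[OF i])
    show "AE t in lborel. norm (V (q t)) \<le> norm (?f t)"
      using V(2) by (auto intro!: AE_I2)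
  qed simp
  show "energy V q = ennreal (LBINT t. ?f t)"
    unfolding energy_def by (rule nn_integral_eq_integral[OF i]) (use nn in auto)
qed

lemma kinetic_le_energy:
  assumes q: "q \<in> H1loc" and E: "energy V q \<le> ennreal e" "e \<ge> 0" and V: "continuous_on UNIV V" "\<And>u. V u \<ge> 0"
  shows "(LBINT t. (norm (weak_derivative q t))\<^sup>2) \<le> 2 * e"  "(LBINT t. V (q t)) \<le> e"
    "integrable lborel (\<lambda>t. (norm (weak_derivative q t))\<^sup>2)" "integrable lborel (\<lambda>t. V (q t))"
proof -
  have "energy V q < \<infinity>" using E by (metis ennreal_less_top infinity_ennreal_def order_le_less_trans)
  note i = finite_energy_integrable[OF q this V]
  show "integrable lborel (\<lambda>t. (norm (weak_derivative q t))\<^sup>2)" "integrable lborel (\<lambda>t. V (q t))"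
    using i by auto
  have "(LBINT t. 1/2 * (norm (weak_derivative q t))\<^sup>2 + V (q t)) \<le> e"
    using E i(3) by (simp add: ennreal_le_iff)
  then have s: "1/2 * (LBINT t. (norm (weak_derivative q t))\<^sup>2) + (LBINT t. V (q t)) \<le> e"
    using i(1,2) by simp
  have "(LBINT t. (norm (weak_derivative q t))\<^sup>2) \<ge> 0" "(LBINT t. V (q t)) \<ge> 0"
    using V(2) by (auto intro!: Bochner_Integration.integral_nonneg)
  then show "(LBINT t. (norm (weak_derivative q t))\<^sup>2) \<le> 2 * e" "(LBINT t. V (q t)) \<le> e"
    using s by linarith+
qed

lemma set_integral_le_integral:
  fixes f :: "real \<Rightarrow> real"
  assumes "integrable lborel f" "\<And>t. f t \<ge> 0" "A \<in> sets borel"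
  shows "set_integrable lborel A f" "(LINT t:A|lborel. f t) \<le> (LBINT t. f t)"
proof -
  show "set_integrable lborel A f"
    unfolding set_integrable_def using assms by (intro integrable_mult_indicator) auto
  then show "(LINT t:A|lborel. f t) \<le> (LBINT t. f t)"
    unfolding set_lebesgue_integral_def set_integrable_def
    using assms by (intro integral_mono) (auto simp: indicator_def)
qed

text \<open>Cauchy-Schwarz on the interval, obtained by integrating the square of
  \<open>p x - w\<close> with \<open>w\<close> the mean velocity. For this \<open>w\<close> the
  cross term and the constant term combine to minus
  \<open>(norm (q t - q s))\<^sup>2 / (t - s)\<close>.\<close>

lemma primitive_holder:
  fixes q :: "real \<Rightarrow> 'a::euclidean_space"
  assumes q: "primitive q p" and p: "integrable lborel (\<lambda>t. (norm (p t))\<^sup>2)" and st: "s \<le> t"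
  shows "(norm (q t - q s))\<^sup>2 \<le> (t - s) * (LBINT t. (norm (p t))\<^sup>2)"
proof (cases "s = t")
  case False
  then have st': "t - s > 0" using st by simp
  define w where "w = (1 / (t - s)) *\<^sub>R (q t - q s)"
  have i1: "set_integrable lborel {s..t} (\<lambda>x. (norm (p x))\<^sup>2)"
    by (rule set_integral_le_integral(1)[OF p]) auto
  have i2: "set_integrable lborel {s..t} (\<lambda>x. p x \<bullet> w)"
    using set_integrable_continuous_inner[OF continuous_on_const primitiveD(2)[OF q], of s t w]
    by (simp add: inner_commute)
  have i3: "set_integrable lborel {s..t} (\<lambda>x. w \<bullet> w)"
    by (intro set_integrable_continuous continuous_intros)
  have "0 \<le> (LBINT x:{s..t}. (norm (p x))\<^sup>2 - 2 * (p x \<bullet> w) + w \<bullet> w)"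
    unfolding set_lebesgue_integral_def
  proof (intro Bochner_Integration.integral_nonneg)
    fix x
    have "(norm (p x))\<^sup>2 - 2 * (p x \<bullet> w) + w \<bullet> w = (norm (p x - w))\<^sup>2"
      by (simp add: power2_norm_eq_inner inner_diff_left inner_diff_right inner_commute)
    then show "0 \<le> indicator {s..t} x *\<^sub>R ((norm (p x))\<^sup>2 - 2 * (p x \<bullet> w) + w \<bullet> w)" by simp
  qed
  also have "\<dots> = (LBINT x:{s..t}. (norm (p x))\<^sup>2) - 2 * ((q t - q s) \<bullet> w) + (t - s) * (w \<bullet> w)"
  proof -
    have "(LBINT x:{s..t}. p x \<bullet> w) = (q t - q s) \<bullet> w"
      using set_integral_inner_left[OF primitiveD(2)[OF q], of s t w] primitiveD(3)[OF q st] by simp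
    moreover have "(LBINT x:{s..t}. w \<bullet> w) = (t - s) * (w \<bullet> w)"
      using st by (simp add: set_lebesgue_integral_def)
    moreover have "set_integrable lborel {s..t} (\<lambda>x. 2 * (p x \<bullet> w))" using i2 by simp
    ultimately show ?thesis
      using i1 i2 i3 by (simp add: set_integral_add set_integral_diff)
  qed
  also have "\<dots> = (LBINT x:{s..t}. (norm (p x))\<^sup>2) - (norm (q t - q s))\<^sup>2 / (t - s)"
  proof -
    define z where "z = q t - q s"
    have "2 * (z \<bullet> w) = 2 * (z \<bullet> z) / (t - s)" "(t - s) * (w \<bullet> w) = (z \<bullet> z) / (t - s)"
      using st' by (simp_all add: w_def z_def[symmetric])
    then show ?thesis by (simp add: z_def[symmetric] power2_norm_eq_inner)
  qed
  finally have "(norm (q t - q s))\<^sup>2 / (t - s) \<le> (LBINT x:{s..t}. (norm (p x))\<^sup>2)" by simp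
  also have "\<dots> \<le> (LBINT x. (norm (p x))\<^sup>2)"
    by (rule set_integral_le_integral(2)[OF p]) auto
  finally show ?thesis using st' by (simp add: field_simps)
qed simp

lemma primitive_holder_abs:
  fixes q :: "real \<Rightarrow> 'a::euclidean_space"
  assumes "primitive q p" "integrable lborel (\<lambda>t. (norm (p t))\<^sup>2)" "(LBINT t. (norm (p t))\<^sup>2) \<le> B"
  shows "norm (q t - q s) \<le> sqrt (B * \<bar>t - s\<bar>)"
proof -
  have *: "(norm (q t - q s))\<^sup>2 \<le> B * \<bar>t - s\<bar>" if "s \<le> t" for s t
  proof -
    have "(t - s) * (LBINT t. (norm (p t))\<^sup>2) \<le> (t - s) * B"
      using assms(3) that by (intro mult_left_mono) auto
    then show ?thesis using primitive_holder[OF assms(1,2) that] that by (simp add: mult.commute)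
  qed
  have "(norm (q t - q s))\<^sup>2 \<le> B * \<bar>t - s\<bar>"
    using *[of s t] *[of t s] by (cases "s \<le> t") (auto simp: norm_minus_commute abs_minus_commute)
  then show ?thesis by (rule real_le_rsqrt)
qed

lemma sqrt_modulus_uniformly_continuous:
  fixes q :: "real \<Rightarrow> 'a::real_normed_vector"
  assumes "\<And>s t. norm (q t - q s) \<le> sqrt (B * \<bar>t - s\<bar>)"
  shows "uniformly_continuous_on UNIV q"
  unfolding uniformly_continuous_on_def
proof (intro allI impI)
  fix e :: real assume e: "e > 0"
  \<comment> \<open>The denominator \<open>\<bar>B\<bar> + 1\<close> is positive for every real
    \<open>B\<close>, so no sign of \<open>B\<close> has to be assumed.\<close>
  define d where "d = e\<^sup>2 / (\<bar>B\<bar> + 1)"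
  have d: "d > 0" using e by (simp add: d_def)
  show "\<exists>d>0. \<forall>x\<in>UNIV. \<forall>x'\<in>UNIV. dist x' x < d \<longrightarrow> dist (q x') (q x) < e"
  proof (intro exI[of _ d] conjI d ballI impI)
    fix x x' :: real assume "dist x' x < d"
    then have x: "\<bar>x' - x\<bar> < d" by (simp add: dist_real_def)
    have "B * \<bar>x' - x\<bar> \<le> (\<bar>B\<bar> + 1) * \<bar>x' - x\<bar>" by (intro mult_right_mono) auto
    also have "\<dots> < (\<bar>B\<bar> + 1) * d" using x by (intro mult_strict_left_mono) auto
    also have "\<dots> = e\<^sup>2" by (simp add: d_def)
    finally have "sqrt (B * \<bar>x' - x\<bar>) < e" using e by (intro real_less_lsqrt) auto
    then show "dist (q x') (q x) < e" using assms[of x' x] by (simp add: dist_norm)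
  qed
qed

text \<open>A curve that stays outside the ball of radius \<open>R\<close> for the time
  \<open>e / \<beta> + 1\<close> pays at least \<open>e + \<beta>\<close>, more than its energy. So
  every window of this length contains a visit to the ball, and the square root modulus of
  continuity bounds the excursion in between. The bound depends on the energy level alone.\<close>

lemma energy_sup_bound:
  assumes q: "q \<in> H1loc" and E: "energy V q \<le> ennreal e" "e \<ge> 0"
    and V: "continuous_on UNIV V" "\<And>u. V u \<ge> 0" and b: "\<beta> > 0" "\<And>u. norm u \<ge> R \<Longrightarrow> V u \<ge> \<beta>"
  shows "norm (q t) \<le> R + sqrt (2 * e * (e / \<beta> + 1))"
proof -
  note k = kinetic_le_energy[OF q E V]
  define L where "L = e / \<beta> + 1"
  have L: "L > 0" using E b by (simp add: L_def add_nonneg_pos)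
  have "\<exists>s\<in>{t..t+L}. norm (q s) < R"
  proof (rule ccontr)
    assume "\<not> ?thesis"
    then have ge: "V (q s) \<ge> \<beta>" if "s \<in> {t..t+L}" for s using b(2) that by force
    have "\<beta> * L = (LBINT s:{t..t+L}. \<beta>)" using L by (simp add: set_lebesgue_integral_def)
    also have "\<dots> \<le> (LBINT s:{t..t+L}. V (q s))"
      using ge by (intro set_integral_mono set_integrable_continuous continuous_on_const
          set_integral_le_integral(1)[OF k(4)]) (auto simp: V)
    also have "\<dots> \<le> (LBINT s. V (q s))"
      by (rule set_integral_le_integral(2)[OF k(4)]) (auto simp: V)
    also have "\<dots> \<le> e" by (rule k)
    finally have "\<beta> * (e / \<beta> + 1) \<le> e" by (simp only: L_def)
    then have "e + \<beta> \<le> e" using b(1) by (simp add: distrib_left)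
    then show False using b(1) by simp
  qed
  then obtain s where s: "s \<in> {t..t+L}" "norm (q s) < R" by blast
  have "norm (q t - q s) \<le> sqrt (2 * e * \<bar>t - s\<bar>)"
    by (rule primitive_holder_abs[OF H1locD(2)[OF q] k(3,1)])
  also have "\<dots> \<le> sqrt (2 * e * L)" using s E by (intro real_sqrt_le_mono mult_left_mono) auto
  finally have "norm (q t) \<le> norm (q s) + sqrt (2 * e * L)"
    using norm_triangle_sub[of "q t" "q s"] by linarith
  then show ?thesis using s by (simp add: L_def)
qed

section \<open>The space H1 and its norm\<close>

lemma L2_curve_add:
  assumes "L2_curve v" "L2_curve w" shows "L2_curve (\<lambda>t. v t + w t)"
  unfolding L2_curve_def
proof
  have [measurable]: "v \<in> borel_measurable borel" "w \<in> borel_measurable borel"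
    using assms by (auto simp: L2_curve_def)
  show "(\<lambda>t. v t + w t) \<in> borel_measurable lborel" by measurable
  show "integrable lborel (\<lambda>t. (norm (v t + w t))\<^sup>2)"
  proof (rule Bochner_Integration.integrable_bound)
    show "integrable lborel (\<lambda>t. 2 * (norm (v t))\<^sup>2 + 2 * (norm (w t))\<^sup>2)"
      using assms by (auto simp: L2_curve_def)
    have "(norm (v t + w t))\<^sup>2 \<le> 2 * (norm (v t))\<^sup>2 + 2 * (norm (w t))\<^sup>2" for t
    proof -
      have "(norm (v t + w t))\<^sup>2 \<le> (norm (v t) + norm (w t))\<^sup>2"
        by (intro power_mono norm_triangle_ineq) auto
      then show ?thesis using sum_squares_bound[of "norm (v t)" "norm (w t)"]
        by (simp add: power2_sum)
    qed
    then show "AE t in lborel. norm ((norm (v t + w t))\<^sup>2) \<le> norm (2 * (norm (v t))\<^sup>2 + 2 * (norm (w t))\<^sup>2)"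
      by (auto intro!: AE_I2 order_trans[OF _ abs_ge_self])
  qed simp
qed

lemma L2_curve_scaleR: "L2_curve v \<Longrightarrow> L2_curve (\<lambda>t. c *\<^sub>R v t)"
  by (auto simp: L2_curve_def power_mult_distrib)

lemma L2_curve_minus: "L2_curve v \<Longrightarrow> L2_curve w \<Longrightarrow> L2_curve (\<lambda>t. v t - w t)"
  using L2_curve_add[of v "\<lambda>t. (-1) *\<^sub>R w t"] L2_curve_scaleR[of w "-1"] by simp

lemma H1I:
  assumes "L2_curve v" "L2_curve p" "primitive v p"
  shows "v \<in> H1"
  unfolding H1_def using assms primitive_continuous[OF assms(3)] primitive_imp_weak_derivative[OF assms(3)]
  by blast

lemma H1D:
  assumes "v \<in> H1"
  shows "L2_curve v" "L2_curve (weak_derivative v)" "primitive v (weak_derivative v)" "v \<in> H1loc"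
proof -
  obtain p where p: "continuous_on UNIV v" "L2_curve p" "has_weak_derivative v p" and "L2_curve v"
    using assms by (auto simp: H1_def)
  then show "L2_curve v" by simp
  have pp: "primitive v p"
    using weak_derivative_iff_primitive[OF L2_imp_L2loc[OF p(2)] p(1)] p(3) by simp
  note w = weak_derivative_AE[OF pp L2_imp_L2loc[OF p(2)]]
  show "primitive v (weak_derivative v)" by (rule w)
  show "v \<in> H1loc" unfolding H1loc_iff using pp p L2_imp_L2loc by blast
  have [measurable]: "weak_derivative v \<in> borel_measurable borel" "p \<in> borel_measurable borel"
    using w(1) p(2) by (auto simp: L2loc_curve_def L2_curve_def)
  have "integrable lborel (\<lambda>t. (norm (p t))\<^sup>2) = integrable lborel (\<lambda>t. (norm (weak_derivative v t))\<^sup>2)"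
    using w(3) by (intro integrable_cong_AE) auto
  then show "L2_curve (weak_derivative v)"
    using p(2) by (simp add: L2_curve_def)
qed

lemma H1_norm_primitive:
  assumes "primitive v p" "L2_curve p"
  shows "H1_norm v = sqrt ((LBINT t. (norm (v t))\<^sup>2) + (LBINT t. (norm (p t))\<^sup>2))"
proof -
  note w = weak_derivative_AE[OF assms(1) L2_imp_L2loc[OF assms(2)]]
  have [measurable]: "weak_derivative v \<in> borel_measurable borel" "p \<in> borel_measurable borel"
    using w(1) assms(2) by (auto simp: L2loc_curve_def L2_curve_def)
  have "(LBINT t. (norm (weak_derivative v t))\<^sup>2) = (LBINT t. (norm (p t))\<^sup>2)"
    using w(3) by (intro integral_cong_AE) auto
  then show ?thesis by (simp add: H1_norm_def)
qed

lemma H1_norm_nonneg: "H1_norm v \<ge> 0"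
  by (simp add: H1_norm_def)

lemma H1_add:
  assumes "v \<in> H1" "w \<in> H1" shows "(\<lambda>t. v t + w t) \<in> H1"
  by (rule H1I[OF L2_curve_add L2_curve_add primitive_add]) (use H1D assms in auto)

lemma H1_scaleR:
  assumes "v \<in> H1" shows "(\<lambda>t. c *\<^sub>R v t) \<in> H1"
  by (rule H1I[OF L2_curve_scaleR L2_curve_scaleR primitive_scaleR]) (use H1D assms in auto)

lemma H1_minus:
  assumes "v \<in> H1" "w \<in> H1" shows "(\<lambda>t. v t - w t) \<in> H1"
  by (rule H1I[OF L2_curve_minus L2_curve_minus primitive_diff]) (use H1D assms in auto)

lemma H1_norm_square:
  assumes "v \<in> H1"
  shows "(H1_norm v)\<^sup>2 = (LBINT t. (norm (v t))\<^sup>2) + (LBINT t. (norm (weak_derivative v t))\<^sup>2)"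
  by (simp add: H1_norm_def)

lemma H1_norm_scaleR:
  assumes "v \<in> H1" shows "H1_norm (\<lambda>t. c *\<^sub>R v t) = \<bar>c\<bar> * H1_norm v"
proof -
  have "H1_norm (\<lambda>t. c *\<^sub>R v t) = sqrt ((LBINT t. (norm (c *\<^sub>R v t))\<^sup>2) + (LBINT t. (norm (c *\<^sub>R weak_derivative v t))\<^sup>2))"
    by (rule H1_norm_primitive) (use H1D[OF assms] in \<open>auto intro: primitive_scaleR L2_curve_scaleR\<close>)
  also have "\<dots> = sqrt (c\<^sup>2 * ((LBINT t. (norm (v t))\<^sup>2) + (LBINT t. (norm (weak_derivative v t))\<^sup>2)))"
    by (simp add: power_mult_distrib distrib_left)
  finally show ?thesis by (simp add: real_sqrt_mult H1_norm_def)
qed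

text \<open>Stands in for the triangle inequality: it serves to show that distances along a path
  tend to 0, and for this the constant 2 is harmless.\<close>

lemma H1_norm_add_square:
  assumes "v \<in> H1" "w \<in> H1"
  shows "(H1_norm (\<lambda>t. v t + w t))\<^sup>2 \<le> 2 * (H1_norm v)\<^sup>2 + 2 * (H1_norm w)\<^sup>2"
proof -
  note v = H1D[OF assms(1)] and w = H1D[OF assms(2)]
  have le: "(LBINT t. (norm (f t + g t))\<^sup>2) \<le> 2 * (LBINT t. (norm (f t))\<^sup>2) + 2 * (LBINT t. (norm (g t))\<^sup>2)"
    if "L2_curve f" "L2_curve g" for f g :: "real \<Rightarrow> real ^ 'a"
  proof -
    have "(norm (f t + g t))\<^sup>2 \<le> 2 * (norm (f t))\<^sup>2 + 2 * (norm (g t))\<^sup>2" for t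
    proof -
      have "(norm (f t + g t))\<^sup>2 \<le> (norm (f t) + norm (g t))\<^sup>2"
        by (intro power_mono norm_triangle_ineq) auto
      then show ?thesis using sum_squares_bound[of "norm (f t)" "norm (g t)"]
        by (simp add: power2_sum)
    qed
    then have "(LBINT t. (norm (f t + g t))\<^sup>2) \<le> (LBINT t. 2 * (norm (f t))\<^sup>2 + 2 * (norm (g t))\<^sup>2)"
      using that L2_curve_add[OF that] by (intro integral_mono) (auto simp: L2_curve_def)
    also have "\<dots> = 2 * (LBINT t. (norm (f t))\<^sup>2) + 2 * (LBINT t. (norm (g t))\<^sup>2)"
      using that by (simp add: L2_curve_def)
    finally show ?thesis .
  qed
  have "H1_norm (\<lambda>t. v t + w t) = sqrt ((LBINT t. (norm (v t + w t))\<^sup>2) + (LBINT t. (norm (weak_derivative v t + weak_derivative w t))\<^sup>2))"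
    by (rule H1_norm_primitive) (use v w in \<open>auto intro: primitive_add L2_curve_add\<close>)
  then have "(H1_norm (\<lambda>t. v t + w t))\<^sup>2 = (LBINT t. (norm (v t + w t))\<^sup>2) + (LBINT t. (norm (weak_derivative v t + weak_derivative w t))\<^sup>2)"
    by simp
  also have "\<dots> \<le> 2 * (H1_norm v)\<^sup>2 + 2 * (H1_norm w)\<^sup>2"
    using le[OF v(1) w(1)] le[OF v(2) w(2)] by (simp add: H1_norm_square assms)
  finally show ?thesis .
qed

text \<open>Comparing \<open>v t\<close> with \<open>v s\<close> and averaging over \<open>s\<close>
  in the unit interval after \<open>t\<close> bounds the square of \<open>norm (v t)\<close> by
  twice the squared norm, rounded up to four times. Through this embedding continuity in H1 becomes
  uniform closeness of curves.\<close>

lemma H1_sup_bound: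
  assumes "v \<in> H1" shows "norm (v t) \<le> 2 * H1_norm v"
proof -
  note v = H1D[OF assms]
  let ?A = "LBINT t. (norm (v t))\<^sup>2" and ?B = "LBINT t. (norm (weak_derivative v t))\<^sup>2"
  have B0: "?B \<ge> 0" by (auto intro!: Bochner_Integration.integral_nonneg)
  have i: "integrable lborel (\<lambda>t. (norm (v t))\<^sup>2)" "integrable lborel (\<lambda>t. (norm (weak_derivative v t))\<^sup>2)"
    using v by (auto simp: L2_curve_def)
  have *: "(norm (v t))\<^sup>2 \<le> 2 * (norm (v s))\<^sup>2 + 2 * ?B" if "s \<in> {t..t+1}" for s
  proof -
    have "(norm (v s - v t))\<^sup>2 \<le> (s - t) * ?B" using primitive_holder[OF v(3) i(2), of t s] that by auto
    also have "\<dots> \<le> ?B" using that B0 by (intro mult_left_le_one_le) auto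
    finally have 1: "(norm (v t - v s))\<^sup>2 \<le> ?B" by (simp add: norm_minus_commute)
    have "(norm (v t))\<^sup>2 \<le> (norm (v s) + norm (v t - v s))\<^sup>2"
      using norm_triangle_sub[of "v t" "v s"] by (intro power_mono) auto
    then show ?thesis using sum_squares_bound[of "norm (v s)" "norm (v t - v s)"] 1
      by (simp add: power2_sum)
  qed
  have i1: "set_integrable lborel {t..t+1} (\<lambda>s. (norm (v s))\<^sup>2)"
    by (rule set_integral_le_integral(1)[OF i(1)]) auto
  have i2: "set_integrable lborel {t..t+1} (\<lambda>s. 2 * ?B)"
    by (intro set_integrable_continuous continuous_on_const)
  have "(norm (v t))\<^sup>2 = (LBINT s:{t..t+1}. (norm (v t))\<^sup>2)"
    by (simp add: set_lebesgue_integral_def)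
  also have "\<dots> \<le> (LBINT s:{t..t+1}. 2 * (norm (v s))\<^sup>2 + 2 * ?B)"
    using * by (intro set_integral_mono set_integral_add(1)[OF set_integrable_mult_right[OF i1] i2]
        set_integrable_continuous continuous_on_const)
  also have "\<dots> = 2 * (LBINT s:{t..t+1}. (norm (v s))\<^sup>2) + 2 * ?B"
    using i1 i2 by (subst set_integral_add) (auto simp: set_lebesgue_integral_def)
  also have "\<dots> \<le> 2 * ?A + 2 * ?B"
    using set_integral_le_integral(2)[OF i(1), of "{t..t+1}"] by auto
  also have "\<dots> = 2 * (H1_norm v)\<^sup>2" by (simp add: H1_norm_square assms)
  also have "\<dots> \<le> (2 * H1_norm v)\<^sup>2" by (simp add: power_mult_distrib)
  finally show ?thesis by (rule power2_le_imp_le) (simp add: H1_norm_nonneg)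
qed

section \<open>Limits at infinity\<close>

text \<open>A value of at least \<open>r\<close> at time \<open>t\<close> persists, by uniform
  continuity, as a value of at least \<open>r / 2\<close> on an interval of fixed length. The set
  where \<open>f\<close> is at least \<open>r / 2\<close> has finite measure, so its part in a far
  tail is too small to contain such an interval.\<close>

lemma superlevel_finite_tendsto_0:
  fixes f :: "real \<Rightarrow> real"
  assumes uc: "uniformly_continuous_on UNIV f" and nn: "\<And>t. f t \<ge> 0"
    and fin: "\<And>r. r > 0 \<Longrightarrow> emeasure lborel {t. f t \<ge> r} < \<infinity>"
  shows "(f \<longlongrightarrow> 0) at_top"
proof (rule tendstoI)
  fix r :: real assume r: "r > 0"
  have fm [measurable]: "f \<in> borel_measurable borel"
    using uc by (intro borel_measurable_continuous_onI uniformly_continuous_imp_continuous)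
  obtain d where d: "d > 0" "\<And>s t. \<bar>s - t\<bar> < d \<Longrightarrow> \<bar>f s - f t\<bar> < r / 2"
    using uc r unfolding uniformly_continuous_on_def dist_real_def
    by (metis UNIV_I half_gt_zero)
  let ?A = "\<lambda>n. {t. f t \<ge> r / 2} \<inter> {real n..}"
  have "(\<lambda>n. emeasure lborel (?A n)) \<longlonglongrightarrow> emeasure lborel (\<Inter>n. ?A n)"
  proof (rule Lim_emeasure_decseq)
    show "range ?A \<subseteq> sets lborel" by auto
    show "decseq ?A" by (auto simp: decseq_def)
    show "emeasure lborel (?A i) \<noteq> \<infinity>" for i
    proof -
      have "emeasure lborel (?A i) \<le> emeasure lborel {t. f t \<ge> r / 2}" by (intro emeasure_mono) auto
      then show ?thesis using fin[of "r/2"] r by auto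
    qed
  qed
  moreover have "(\<Inter>n. ?A n) = {}"
  proof -
    have "\<exists>n. \<not> real n \<le> x" for x using reals_Archimedean2[of x] by (auto simp: not_le)
    then show ?thesis by auto
  qed
  ultimately have "(\<lambda>n. emeasure lborel (?A n)) \<longlonglongrightarrow> 0" by simp
  moreover have "ennreal (d/2) > 0" using d by simp
  ultimately have "eventually (\<lambda>n. emeasure lborel (?A n) < ennreal (d/2)) sequentially"
    by (rule order_tendstoD)
  then obtain n where n: "emeasure lborel (?A n) < ennreal (d/2)" by (auto simp: eventually_sequentially)
  have "dist (f t) 0 < r" if "t \<ge> real n" for t
  proof (rule ccontr)
    assume "\<not> dist (f t) 0 < r"
    then have ft: "f t \<ge> r" using nn[of t] by (simp add: dist_real_def)
    have "{t..t + d/2} \<subseteq> ?A n"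
    proof
      fix s assume s: "s \<in> {t..t + d/2}"
      then have "\<bar>s - t\<bar> < d" using d(1) by auto
      then have "\<bar>f s - f t\<bar> < r / 2" by (rule d)
      then have "f s \<ge> r / 2" using ft unfolding abs_real_def by (simp split: if_splits)
      then show "s \<in> ?A n" using s that by auto
    qed
    then have "emeasure lborel {t..t + d/2} \<le> emeasure lborel (?A n)" by (intro emeasure_mono) auto
    then show False using n d(1) by simp
  qed
  then show "eventually (\<lambda>t. dist (f t) 0 < r) at_top"
    unfolding eventually_at_top_linorder by blast
qed

text \<open>Markov's inequality.\<close>

lemma integrable_superlevel_finite:
  fixes g :: "real \<Rightarrow> real"
  assumes g: "integrable lborel g" "\<And>t. g t \<ge> 0" and r: "r > 0"
  shows "emeasure lborel {t. g t \<ge> r} < \<infinity>"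
proof -
  have gm [measurable]: "g \<in> borel_measurable borel" using borel_measurable_integrable[OF g(1)] by simp
  have "ennreal r * emeasure lborel {t. g t \<ge> r} = (\<integral>\<^sup>+t. ennreal r * indicator {t. g t \<ge> r} t \<partial>lborel)"
    by (subst nn_integral_cmult_indicator) auto
  also have "\<dots> \<le> (\<integral>\<^sup>+t. ennreal (g t) \<partial>lborel)"
    by (intro nn_integral_mono) (auto simp: indicator_def intro: ennreal_leI)
  also have "\<dots> < \<infinity>" using g by (simp add: nn_integral_eq_integral)
  finally have *: "ennreal r * emeasure lborel {t. g t \<ge> r} < \<infinity>" .
  then show ?thesis
    using r by (auto simp: ennreal_mult_less_top)
qed

lemma superlevel_finite_tendsto_0_bot:
  fixes f :: "real \<Rightarrow> real"
  assumes uc: "uniformly_continuous_on UNIV f" and nn: "\<And>t. f t \<ge> 0"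
    and fin: "\<And>r. r > 0 \<Longrightarrow> emeasure lborel {t. f t \<ge> r} < \<infinity>"
  shows "(f \<longlongrightarrow> 0) at_bot"
proof -
  have fm [measurable]: "f \<in> borel_measurable borel"
    using uc by (intro borel_measurable_continuous_onI uniformly_continuous_imp_continuous)
  have "((\<lambda>t. f (- t)) \<longlongrightarrow> 0) at_top"
  proof (rule superlevel_finite_tendsto_0)
    show "uniformly_continuous_on UNIV (\<lambda>t. f (- t))"
      using uc unfolding uniformly_continuous_on_def by (metis UNIV_I dist_minus)
    show "emeasure lborel {t. f (- t) \<ge> r} < \<infinity>" if "r > 0" for r
    proof -
      have "emeasure lborel {t. f t \<ge> r} = emeasure (distr lborel borel uminus) {t. f t \<ge> r}"
        by (simp add: lborel_distr_uminus)
      also have "\<dots> = emeasure lborel {t. f (- t) \<ge> r}"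
        by (subst emeasure_distr) (auto simp: vimage_def)
      finally show ?thesis using fin[OF that] by simp
    qed
  qed (rule nn)
  then show ?thesis by (simp add: filterlim_at_bot_mirror)
qed

lemma H1_tendsto_0:
  assumes "v \<in> H1"
  shows "(v \<longlongrightarrow> 0) at_top" "(v \<longlongrightarrow> 0) at_bot"
proof -
  note v = H1D[OF assms]
  have i: "integrable lborel (\<lambda>t. (norm (v t))\<^sup>2)" "integrable lborel (\<lambda>t. (norm (weak_derivative v t))\<^sup>2)"
    using v by (auto simp: L2_curve_def)
  have "uniformly_continuous_on UNIV v"
    by (rule sqrt_modulus_uniformly_continuous[OF primitive_holder_abs[OF v(3) i(2) order_refl]])
  then have "uniformly_continuous_on UNIV (\<lambda>t. norm (v t))"
    by (rule uniformly_continuous_on_norm)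
  moreover have "emeasure lborel {t. norm (v t) \<ge> r} < \<infinity>" if "r > 0" for r
  proof -
    have "{t. norm (v t) \<ge> r} = {t. (norm (v t))\<^sup>2 \<ge> r\<^sup>2}"
      using that by (auto simp: power2_le_iff_abs_le abs_le_square_iff[symmetric])
    then show ?thesis using integrable_superlevel_finite[OF i(1), of "r\<^sup>2"] that by simp
  qed
  ultimately have "((\<lambda>t. norm (v t)) \<longlongrightarrow> 0) at_top" "((\<lambda>t. norm (v t)) \<longlongrightarrow> 0) at_bot"
    by (intro superlevel_finite_tendsto_0 superlevel_finite_tendsto_0_bot norm_ge_zero; blast)+
  then show "(v \<longlongrightarrow> 0) at_top" "(v \<longlongrightarrow> 0) at_bot" by (auto intro: tendsto_norm_zero_cancel)
qed

text \<open>Small potential along a bounded curve means closeness to the finite set of wells. Which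
  well is approached cannot change along a tail, because balls around different wells are disjoint
  and the tail is connected.\<close>

lemma wells_limit:
  fixes q :: "real \<Rightarrow> 'a::euclidean_space"
  assumes qc: "continuous_on UNIV q" and bd: "\<And>t. norm (q t) \<le> R"
    and V: "continuous_on UNIV V" "\<And>u. V u \<ge> (0::real)" "\<And>u. V u = 0 \<longleftrightarrow> u \<in> \<Sigma>" and fin: "finite \<Sigma>"
    and lim: "((\<lambda>t. V (q t)) \<longlongrightarrow> 0) at_top"
  shows "\<exists>\<sigma>\<in>\<Sigma>. (q \<longlongrightarrow> \<sigma>) at_top"
proof -
  have near: "\<exists>T. \<forall>t\<ge>T. \<exists>\<sigma>\<in>\<Sigma>. dist (q t) \<sigma> < \<epsilon>" if \<epsilon>: "\<epsilon> > 0" for \<epsilon>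
  proof -
    \<comment> \<open>The part of the ball away from the wells is compact, so the potential has a
      positive minimum \<open>\<eta>\<close> there; once \<open>V (q t) < \<eta>\<close> the curve
      has left this set.\<close>
    define C where "C = cball 0 R - (\<Union>\<sigma>\<in>\<Sigma>. ball \<sigma> \<epsilon>)"
    have C: "compact C" unfolding C_def by (intro compact_diff compact_cball open_UN ballI open_ball)
    have "\<exists>\<eta>>0. \<forall>u\<in>C. V u \<ge> \<eta>"
    proof (cases "C = {}")
      case False
      obtain u where u: "u \<in> C" "\<And>w. w \<in> C \<Longrightarrow> V u \<le> V w"
        using continuous_attains_inf[OF C False continuous_on_subset[OF V(1)]] by blast
      have "u \<notin> \<Sigma>" using u(1) \<epsilon> by (auto simp: C_def)
      then have "V u > 0" using V(2)[of u] V(3)[of u] by linarith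
      then show ?thesis using u(2) by blast
    qed (auto intro: exI[of _ 1])
    then obtain \<eta> where \<eta>: "\<eta> > 0" "\<And>u. u \<in> C \<Longrightarrow> V u \<ge> \<eta>" by blast
    have "eventually (\<lambda>t. V (q t) < \<eta>) at_top" by (rule order_tendstoD(2)[OF lim \<eta>(1)])
    then obtain T where T: "\<And>t. t \<ge> T \<Longrightarrow> V (q t) < \<eta>" unfolding eventually_at_top_linorder by blast
    have "\<exists>\<sigma>\<in>\<Sigma>. dist (q t) \<sigma> < \<epsilon>" if "t \<ge> T" for t
    proof -
      have "q t \<notin> C" using \<eta>(2)[of "q t"] T[OF that] by fastforce
      then show ?thesis using bd[of t] by (auto simp: C_def dist_commute)
    qed
    then show ?thesis by blast
  qed
  \<comment> \<open>The inserted 1 keeps the minimum defined and positive when there is only one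
    well.\<close>
  define D where "D = insert 1 ((\<lambda>(x, y). dist x y) ` {(x, y). x \<in> \<Sigma> \<and> y \<in> \<Sigma> \<and> x \<noteq> y})"
  have "finite {(x, y). x \<in> \<Sigma> \<and> y \<in> \<Sigma> \<and> x \<noteq> y}"
    by (rule finite_subset[of _ "\<Sigma> \<times> \<Sigma>"]) (use fin in auto)
  then have "finite D" by (simp add: D_def)
  define d where "d = Min D"
  have d: "d > 0" unfolding d_def by (subst Min_gr_iff) (use \<open>finite D\<close> in \<open>auto simp: D_def\<close>)
  have sep: "d \<le> dist x y" if "x \<in> \<Sigma>" "y \<in> \<Sigma>" "x \<noteq> y" for x y
    unfolding d_def by (rule Min_le[OF \<open>finite D\<close>]) (use that in \<open>auto simp: D_def\<close>)
  obtain T where T: "\<And>t. t \<ge> T \<Longrightarrow> \<exists>\<sigma>\<in>\<Sigma>. dist (q t) \<sigma> < d / 2" using near[of "d/2"] d by auto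
  obtain \<sigma> where \<sigma>: "\<sigma> \<in> \<Sigma>" "dist (q T) \<sigma> < d / 2" using T[of T] by auto
  have in_ball: "q t \<in> ball \<sigma> (d/2)" if "t \<ge> T" for t
  proof (rule ccontr)
    assume nt: "q t \<notin> ball \<sigma> (d/2)"
    let ?B = "\<Union>\<tau>\<in>\<Sigma>-{\<sigma>}. ball \<tau> (d/2)"
    have conn: "connected (q ` {T..})"
      by (intro connected_continuous_image continuous_on_subset[OF qc]) auto
    have cover: "q ` {T..} \<subseteq> ball \<sigma> (d/2) \<union> ?B"
      using T by (fastforce simp: dist_commute)
    have disj: "ball \<sigma> (d/2) \<inter> ?B \<inter> q ` {T..} = {}"
    proof -
      have False if "\<tau> \<in> \<Sigma>" "\<tau> \<noteq> \<sigma>" "dist \<sigma> x < d/2" "dist \<tau> x < d/2" for x \<tau>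
        using sep[of \<sigma> \<tau>] that \<sigma> dist_triangle2[of \<sigma> \<tau> x] by auto
      then show ?thesis unfolding mem_ball[symmetric] by blast
    qed
    have ob: "open ?B" by (intro open_UN ballI open_ball)
    have "ball \<sigma> (d/2) \<inter> q ` {T..} = {} \<or> ?B \<inter> q ` {T..} = {}"
      by (rule connectedD[OF conn open_ball ob disj cover])
    moreover have "q T \<in> ball \<sigma> (d/2) \<inter> q ` {T..}" using \<sigma> by (auto simp: dist_commute)
    moreover have "q t \<in> ?B \<inter> q ` {T..}"
    proof -
      have "q t \<in> q ` {T..}" using that by simp
      then show ?thesis using nt cover by blast
    qed
    ultimately show False by blast
  qed
  have "(q \<longlongrightarrow> \<sigma>) at_top"
  proof (rule tendstoI)
    fix e :: real assume "e > 0"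
    then obtain S where S: "\<And>t. t \<ge> S \<Longrightarrow> \<exists>\<sigma>\<in>\<Sigma>. dist (q t) \<sigma> < min e (d/2)"
      using near[of "min e (d/2)"] d by auto
    have "dist (q t) \<sigma> < e" if t: "t \<ge> max S T" for t
    proof -
      obtain \<tau> where \<tau>: "\<tau> \<in> \<Sigma>" "dist (q t) \<tau> < e" "dist (q t) \<tau> < d/2" using S[of t] t by auto
      have "dist \<sigma> (q t) < d/2" using in_ball[of t] t by auto
      then have "dist \<sigma> \<tau> < d" using \<tau>(3) dist_triangle[of \<sigma> \<tau> "q t"] by linarith
      then have "\<sigma> = \<tau>" using sep[of \<sigma> \<tau>] \<sigma> \<tau> by fastforce
      then show ?thesis using \<tau> by simp
    qed
    then show "eventually (\<lambda>t. dist (q t) \<sigma> < e) at_top"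
      unfolding eventually_at_top_linorder by blast
  qed
  then show ?thesis using \<sigma> by blast
qed

lemma finite_energy_limits:
  assumes q: "q \<in> H1loc" and E: "energy V q \<le> ennreal e" "e \<ge> 0" and bd: "\<And>t. norm (q t) \<le> R"
    and V: "continuous_on UNIV V" "\<And>u. V u \<ge> 0" "\<And>u. V u = 0 \<longleftrightarrow> u \<in> \<Sigma>" and fin: "finite \<Sigma>"
  shows "\<exists>\<sigma>\<in>\<Sigma>. (q \<longlongrightarrow> \<sigma>) at_top" "\<exists>\<sigma>\<in>\<Sigma>. (q \<longlongrightarrow> \<sigma>) at_bot"
proof -
  note k = kinetic_le_energy[OF q E V(1,2)]
  have "uniformly_continuous_on UNIV q"
    by (rule sqrt_modulus_uniformly_continuous[OF primitive_holder_abs[OF H1locD(2)[OF q] k(3,1)]])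
  moreover have "uniformly_continuous_on (q ` UNIV) V"
  proof -
    have "uniformly_continuous_on (cball 0 R) V"
      by (intro compact_uniformly_continuous continuous_on_subset[OF V(1)]) auto
    moreover have "q ` UNIV \<subseteq> cball 0 R" using bd by auto
    ultimately show ?thesis unfolding uniformly_continuous_on_def by (meson subsetD)
  qed
  ultimately have uc: "uniformly_continuous_on UNIV (\<lambda>t. V (q t))"
    by (rule uniformly_continuous_on_compose)
  have fin': "emeasure lborel {t. V (q t) \<ge> r} < \<infinity>" if "r > 0" for r
    by (rule integrable_superlevel_finite[OF k(4) _ that]) (rule V)
  have t: "((\<lambda>t. V (q t)) \<longlongrightarrow> 0) at_top" "((\<lambda>t. V (q t)) \<longlongrightarrow> 0) at_bot"
    using superlevel_finite_tendsto_0[OF uc V(2) fin'] superlevel_finite_tendsto_0_bot[OF uc V(2) fin'] by blast+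
  show "\<exists>\<sigma>\<in>\<Sigma>. (q \<longlongrightarrow> \<sigma>) at_top"
    by (rule wells_limit[OF H1locD(3)[OF q] bd V fin t(1)])
  have "\<exists>\<sigma>\<in>\<Sigma>. ((\<lambda>t. q (- t)) \<longlongrightarrow> \<sigma>) at_top"
  proof (rule wells_limit[OF _ bd V fin])
    show "continuous_on UNIV (\<lambda>t. q (- t))"
      by (rule continuous_on_compose2[OF H1locD(3)[OF q]]) (auto intro: continuous_intros)
    show "((\<lambda>t. V (q (- t))) \<longlongrightarrow> 0) at_top" using t(2) by (simp add: filterlim_at_bot_mirror)
  qed
  then show "\<exists>\<sigma>\<in>\<Sigma>. (q \<longlongrightarrow> \<sigma>) at_bot" by (simp add: filterlim_at_bot_mirror)
qed

section \<open>Cutting and expanding the energy\<close>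

lemma L2loc_shift:
  assumes "L2loc_curve p" shows "L2loc_curve (\<lambda>t. p (t + c))"
  unfolding L2loc_curve_def
proof (intro conjI allI)
  have [measurable]: "p \<in> borel_measurable borel" using assms by (simp add: L2loc_curve_def)
  show "(\<lambda>t. p (t + c)) \<in> borel_measurable lborel" by measurable
  show "set_integrable lborel {a..b} (\<lambda>t. (norm (p (t + c)))\<^sup>2)" for a b
  proof -
    have eq: "(\<lambda>t. indicator {a+c..b+c} (c + 1 * t) *\<^sub>R (norm (p (c + 1 * t)))\<^sup>2) = (\<lambda>t. indicator {a..b} t *\<^sub>R (norm (p (t + c)))\<^sup>2)"
      by (auto simp: indicator_def algebra_simps)
    show ?thesis
      using lborel_integrable_real_affine[of "\<lambda>t. indicator {a+c..b+c} t *\<^sub>R (norm (p t))\<^sup>2" 1 c, unfolded eq] assms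
      by (simp add: L2loc_curve_def set_integrable_def)
  qed
qed

lemma L2loc_reflect:
  assumes "L2loc_curve p" shows "L2loc_curve (\<lambda>t. - p (- t))"
  unfolding L2loc_curve_def
proof (intro conjI allI)
  have [measurable]: "p \<in> borel_measurable borel" using assms by (simp add: L2loc_curve_def)
  show "(\<lambda>t. - p (- t)) \<in> borel_measurable lborel" by measurable
  show "set_integrable lborel {a..b} (\<lambda>t. (norm (- p (- t)))\<^sup>2)" for a b
  proof -
    have eq: "(\<lambda>t. indicator {-b..-a} (0 + (-1) * t) *\<^sub>R (norm (p (0 + (-1) * t)))\<^sup>2) = (\<lambda>t. indicator {a..b} t *\<^sub>R (norm (- p (- t)))\<^sup>2)"
      by (auto simp: indicator_def algebra_simps)
    show ?thesis
      using lborel_integrable_real_affine[of "\<lambda>t. indicator {-b..-a} t *\<^sub>R (norm (p t))\<^sup>2" "-1" 0, unfolded eq] assms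
      by (simp add: L2loc_curve_def set_integrable_def)
  qed
qed

lemma energy_density_measurable:
  assumes "L2loc_curve p" "continuous_on UNIV q" "continuous_on UNIV V"
  shows "(\<lambda>t. ennreal (1/2 * (norm (p t))\<^sup>2 + V (q t))) \<in> borel_measurable borel"
proof -
  have [measurable]: "p \<in> borel_measurable borel" using assms by (simp add: L2loc_curve_def)
  have "continuous_on UNIV (\<lambda>t. V (q t))"
    using continuous_on_compose2[OF assms(3,2)] by auto
  then have [measurable]: "(\<lambda>t. V (q t)) \<in> borel_measurable borel"
    by (rule borel_measurable_continuous_onI)
  show ?thesis by measurable
qed

lemma H1loc_shift:
  assumes q: "q \<in> H1loc" and V: "continuous_on UNIV V"
  shows "(\<lambda>t. q (t + c)) \<in> H1loc" "energy V (\<lambda>t. q (t + c)) = energy V q"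
proof -
  note p = L2loc_shift[OF H1locD(1)[OF q], of c] primitive_shift[OF H1locD(2)[OF q], of c]
  show "(\<lambda>t. q (t + c)) \<in> H1loc" unfolding H1loc_iff using p by blast
  have "energy V (\<lambda>t. q (t + c)) = (\<integral>\<^sup>+ t. ennreal (1/2 * (norm (weak_derivative q (t + c)))\<^sup>2 + V (q (t + c))) \<partial>lborel)"
    by (rule energy_primitive[OF p(2,1)])
  also have "\<dots> = energy V q"
    using nn_integral_real_affine[OF energy_density_measurable[OF H1locD(1)[OF q] H1locD(3)[OF q] V], of 1 c]
    by (simp add: energy_def add.commute)
  finally show "energy V (\<lambda>t. q (t + c)) = energy V q" .
qed

lemma H1loc_reflect:
  assumes q: "q \<in> H1loc" and V: "continuous_on UNIV V"
  shows "(\<lambda>t. q (- t)) \<in> H1loc" "energy V (\<lambda>t. q (- t)) = energy V q"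
proof -
  note p = L2loc_reflect[OF H1locD(1)[OF q]] primitive_reflect[OF H1locD(2)[OF q]]
  show "(\<lambda>t. q (- t)) \<in> H1loc" unfolding H1loc_iff using p by blast
  have "energy V (\<lambda>t. q (- t)) = (\<integral>\<^sup>+ t. ennreal (1/2 * (norm (- weak_derivative q (- t)))\<^sup>2 + V (q (- t))) \<partial>lborel)"
    by (rule energy_primitive[OF p(2,1)])
  also have "\<dots> = energy V q"
    using nn_integral_real_affine[OF energy_density_measurable[OF H1locD(1)[OF q] H1locD(3)[OF q] V], of "-1" 0]
    by (simp add: energy_def)
  finally show "energy V (\<lambda>t. q (- t)) = energy V q" .
qed

lemma connecting_shift:
  assumes "q \<in> connecting V a b" "continuous_on UNIV V"
  shows "(\<lambda>t. q (t + c)) \<in> connecting V a b"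
proof -
  have q: "q \<in> H1loc" "energy V q < \<infinity>" "(q \<longlongrightarrow> a) at_bot" "(q \<longlongrightarrow> b) at_top"
    using assms by (auto simp: connecting_def)
  have "filterlim (\<lambda>t. t + c) at_bot at_bot"
    unfolding filterlim_at_bot eventually_at_bot_linorder by (intro allI, rule_tac x = "Z - c" in exI) auto
  then have "((\<lambda>t. q (t + c)) \<longlongrightarrow> a) at_bot" by (rule filterlim_compose[OF q(3)])
  moreover have "filterlim (\<lambda>t. t + c) at_top at_top"
    unfolding filterlim_at_top eventually_at_top_linorder by (intro allI, rule_tac x = "Z - c" in exI) auto
  then have "((\<lambda>t. q (t + c)) \<longlongrightarrow> b) at_top" by (rule filterlim_compose[OF q(4)])
  ultimately show ?thesis using H1loc_shift[OF q(1) assms(2)] q(2) by (simp add: connecting_def)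
qed

lemma connecting_reflect:
  assumes "q \<in> connecting V a b" "continuous_on UNIV V"
  shows "(\<lambda>t. q (- t)) \<in> connecting V b a"
  using assms H1loc_reflect[of q V] unfolding connecting_def
  by (simp add: filterlim_at_bot_mirror)

text \<open>Time reversal. It turns the right half of a cut curve, which runs from the cut to
  \<open>b\<close>, into a left half, so that one cutting estimate serves both halves.\<close>

lemma min_energy_commute_le:
  assumes "continuous_on UNIV V"
  shows "min_energy V a b \<le> min_energy V b a"
  unfolding min_energy_def
proof (rule INF_greatest)
  fix q assume q: "q \<in> connecting V b a"
  then have "energy V (\<lambda>t. q (- t)) = energy V q"
    using H1loc_reflect(2)[OF _ assms] by (simp add: connecting_def)
  then show "(INF q\<in>connecting V a b. energy V q) \<le> energy V q"
    using INF_lower[OF connecting_reflect[OF q assms], of "energy V"] by simp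
qed

text \<open>Truncation by indicators transfers closure properties from
  \<open>L2_curve\<close>.\<close>

lemma L2loc_iff_L2: "L2loc_curve p \<longleftrightarrow> p \<in> borel_measurable lborel \<and> (\<forall>a b. L2_curve (\<lambda>t. indicator {a..b} t *\<^sub>R p t))"
proof -
  have *: "(\<lambda>t. (norm (indicator {a..b} t *\<^sub>R p t))\<^sup>2) = (\<lambda>t. indicator {a..b} t *\<^sub>R (norm (p t))\<^sup>2)" for a b :: real
    by (auto simp: indicator_def)
  show ?thesis
    unfolding L2loc_curve_def L2_curve_def set_integrable_def * by auto
qed

lemma L2loc_add:
  assumes "L2loc_curve p" "L2loc_curve g" shows "L2loc_curve (\<lambda>t. p t + g t)"
  unfolding L2loc_iff_L2 scaleR_add_right
proof (intro conjI allI L2_curve_add)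
  have [measurable]: "p \<in> borel_measurable borel" "g \<in> borel_measurable borel"
    using assms by (simp_all add: L2loc_curve_def)
  show "(\<lambda>t. p t + g t) \<in> borel_measurable lborel" by measurable
qed (use assms in \<open>auto simp: L2loc_iff_L2\<close>)

lemma L2loc_glue:
  assumes "L2loc_curve p" "L2loc_curve g" shows "L2loc_curve (\<lambda>t. if t \<le> T then p t else g t)"
  unfolding L2loc_curve_def
proof (intro conjI allI)
  have [measurable]: "p \<in> borel_measurable borel" "g \<in> borel_measurable borel"
    using assms by (simp_all add: L2loc_curve_def)
  show m: "(\<lambda>t. if t \<le> T then p t else g t) \<in> borel_measurable lborel" by measurable
  show "set_integrable lborel {a..b} (\<lambda>t. (norm (if t \<le> T then p t else g t))\<^sup>2)" for a b
    unfolding set_integrable_def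
  proof (rule Bochner_Integration.integrable_bound)
    show "integrable lborel (\<lambda>t. indicator {a..b} t *\<^sub>R (norm (p t))\<^sup>2 + indicator {a..b} t *\<^sub>R (norm (g t))\<^sup>2)"
      using assms by (intro Bochner_Integration.integrable_add) (auto simp: L2loc_curve_def set_integrable_def)
    show "AE t in lborel. norm (indicat_real {a..b} t *\<^sub>R (norm (if t \<le> T then p t else g t))\<^sup>2)
       \<le> norm (indicat_real {a..b} t *\<^sub>R (norm (p t))\<^sup>2 + indicat_real {a..b} t *\<^sub>R (norm (g t))\<^sup>2)"
      by (auto intro!: AE_I2 simp: indicator_def)
  qed measurable
qed

section \<open>The interpolating profile and the cost of a cut\<close>

definition psi' :: "real ^ 'n \<Rightarrow> real ^ 'n \<Rightarrow> real \<Rightarrow> real ^ 'n" where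
  "psi' a b t = (if t \<le> -1 then 0 else if t \<le> 1 then (1/2) *\<^sub>R (b - a) else 0)"

lemma primitive_psi: "primitive (psi a b) (psi' a b)"
proof -
  have "((\<lambda>t. ((t + 1) / 2) *\<^sub>R b + ((1 - t) / 2) *\<^sub>R a) has_vector_derivative (1/2) *\<^sub>R (b - a)) (at t)" for t
    by (auto intro!: derivative_eq_intros simp: algebra_simps)
  then have "primitive (\<lambda>t. ((t + 1) / 2) *\<^sub>R b + ((1 - t) / 2) *\<^sub>R a) (\<lambda>t. (1/2) *\<^sub>R (b - a))"
    by (rule primitive_C1) (rule continuous_on_const)
  from primitive_glue[OF primitive_const primitive_glue[OF this primitive_const, of 1 b], of a "-1"]
  show ?thesis by (simp add: psi_def[abs_def] psi'_def[abs_def])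
qed

lemma L2loc_psi': "L2loc_curve (psi' a b)"
  unfolding psi'_def[abs_def] by (intro L2loc_glue L2loc_continuous continuous_on_const)

lemma psi_tendsto: "(psi a b \<longlongrightarrow> a) at_bot" "(psi a b \<longlongrightarrow> b) at_top"
proof -
  have "eventually (\<lambda>t. psi a b t = a) at_bot"
    unfolding eventually_at_bot_linorder by (rule exI[of _ "-1"]) (simp add: psi_def)
  then show "(psi a b \<longlongrightarrow> a) at_bot" by (rule tendsto_eventually)
  have "eventually (\<lambda>t. psi a b t = b) at_top"
    unfolding eventually_at_top_linorder by (rule exI[of _ "2"]) (simp add: psi_def)
  then show "(psi a b \<longlongrightarrow> b) at_top" by (rule tendsto_eventually)
qed

text \<open>Finiteness of the energy enters as an assumption; along the paths considered later it
  comes from an upper bound for \<open>J\<close>.\<close>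

lemma J_finite_connecting:
  assumes "v \<in> H1" "J V a b v < \<infinity>"
  shows "(\<lambda>t. v t + psi a b t) \<in> connecting V a b"
proof -
  note v = H1D[OF assms(1)]
  have "(\<lambda>t. v t + psi a b t) \<in> H1loc"
    unfolding H1loc_iff
    using primitive_add[OF v(3) primitive_psi[of a b]] L2loc_add[OF L2_imp_L2loc[OF v(2)] L2loc_psi'[of a b]] by blast
  moreover have "((\<lambda>t. v t + psi a b t) \<longlongrightarrow> 0 + a) at_bot" "((\<lambda>t. v t + psi a b t) \<longlongrightarrow> 0 + b) at_top"
    by (intro tendsto_add H1_tendsto_0 psi_tendsto assms)+
  ultimately show ?thesis using assms(2) by (simp add: connecting_def J_def)
qed

text \<open>The competitor follows \<open>q\<close> up to time \<open>T\<close>, then runs along the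
  straight segment to \<open>\<sigma>\<close> during two units of time, and rests there, where the
  potential is 0. Its excess over the left half of the energy is small once \<open>q T\<close> is
  close to the well.\<close>

lemma min_energy_cut:
  fixes V :: "real ^ 'n \<Rightarrow> real"
  assumes q: "primitive q p" "L2loc_curve p" "(q \<longlongrightarrow> a) at_bot" "energy V q < \<infinity>"
    and V: "continuous_on UNIV V" "\<And>u. V u \<ge> 0" "V \<sigma> = 0"
    and S: "\<And>u. u \<in> closed_segment (q T) \<sigma> \<Longrightarrow> V u \<le> S"
  shows "min_energy V a \<sigma> \<le> (\<integral>\<^sup>+t\<in>{..T}. ennreal (1/2 * (norm (p t))\<^sup>2 + V (q t)) \<partial>lborel)
      + ennreal ((norm (\<sigma> - q T))\<^sup>2 / 4 + 2 * S)"
proof -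
  let ?x = "q T"
  \<comment> \<open>The shift by \<open>- T - 1\<close> moves the ramp of \<open>psi\<close> from
    the interval between -1 and 1 to the one between \<open>T\<close> and
    \<open>T + 2\<close>.\<close>
  define f where "f t = (if t \<le> T then q t else psi ?x \<sigma> (t + (- T - 1)))" for t
  define g where "g t = (if t \<le> T then p t else psi' ?x \<sigma> (t + (- T - 1)))" for t
  have fg: "primitive f g"
    unfolding f_def[abs_def] g_def[abs_def]
    by (rule primitive_glue[OF q(1) primitive_shift[OF primitive_psi]]) (simp add: psi_def)
  have gL: "L2loc_curve g"
    unfolding g_def[abs_def] by (rule L2loc_glue[OF q(2) L2loc_shift[OF L2loc_psi']])
  \<comment> \<open>A bound for the energy density on the segment: the speed is
    \<open>norm (\<sigma> - ?x) / 2\<close>, whose half square gives the denominator 8. It is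
    multiplied by the travel time 2 at the end.\<close>
  define c where "c = (norm (\<sigma> - ?x))\<^sup>2 / 8 + S"
  have S0: "S \<ge> 0" using V(2)[of \<sigma>] S[of \<sigma>] V(3) by auto
  then have c0: "c \<ge> 0" by (simp add: c_def)
  let ?d = "\<lambda>t. ennreal (1/2 * (norm (p t))\<^sup>2 + V (q t))"
  have dm: "?d \<in> borel_measurable borel"
    by (rule energy_density_measurable[OF q(2) primitive_continuous[OF q(1)] V(1)])
  have "energy V f = (\<integral>\<^sup>+t. ennreal (1/2 * (norm (g t))\<^sup>2 + V (f t)) \<partial>lborel)"
    by (rule energy_primitive[OF fg gL])
  also have "\<dots> \<le> (\<integral>\<^sup>+t. ?d t * indicator {..T} t + ennreal c * indicator {T..T+2} t \<partial>lborel)"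
  proof (rule nn_integral_mono)
    fix t
    show "ennreal (1/2 * (norm (g t))\<^sup>2 + V (f t)) \<le> ?d t * indicator {..T} t + ennreal c * indicator {T..T+2} t"
    proof -
      consider "t \<le> T" | "T < t" "t \<le> T + 2" | "t > T + 2" by linarith
      then show ?thesis
      proof cases
        case 1
        then show ?thesis by (simp add: f_def g_def)
      next
        case 2
        have ft: "f t = (1 - (t - T) / 2) *\<^sub>R ?x + ((t - T) / 2) *\<^sub>R \<sigma>"
          using 2 by (simp add: f_def psi_def) (simp add: algebra_simps diff_divide_distrib add_divide_distrib)
        have "f t \<in> closed_segment ?x \<sigma>"
          unfolding ft closed_segment_def using 2 by auto
        then have "V (f t) \<le> S" by (rule S)
        moreover have "1/2 * (norm (g t))\<^sup>2 = (norm (\<sigma> - ?x))\<^sup>2 / 8"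
          using 2 by (simp add: g_def psi'_def power_divide)
        ultimately have "1/2 * (norm (g t))\<^sup>2 + V (f t) \<le> c" by (simp add: c_def)
        then show ?thesis using 2 by (simp add: ennreal_leI)
      next
        case 3
        then show ?thesis by (simp add: f_def g_def psi_def psi'_def V(3))
      qed
    qed
  qed
  also have "\<dots> = (\<integral>\<^sup>+t\<in>{..T}. ?d t \<partial>lborel) + ennreal c * emeasure lborel {T..T+2}"
    using dm by (subst nn_integral_add) (auto simp: nn_integral_cmult_indicator)
  also have "ennreal c * emeasure lborel {T..T+2} = ennreal ((norm (\<sigma> - ?x))\<^sup>2 / 4 + 2 * S)"
    using c0 by (simp add: ennreal_mult[symmetric] c_def algebra_simps flip: ennreal_numeral)
  finally have E: "energy V f \<le> (\<integral>\<^sup>+t\<in>{..T}. ?d t \<partial>lborel) + ennreal ((norm (\<sigma> - ?x))\<^sup>2 / 4 + 2 * S)" .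
  have "(\<integral>\<^sup>+t\<in>{..T}. ?d t \<partial>lborel) \<le> energy V q"
    unfolding energy_primitive[OF q(1,2)] by (intro nn_integral_mono) (auto simp: indicator_def)
  then have "(\<integral>\<^sup>+t\<in>{..T}. ?d t \<partial>lborel) < \<infinity>" using q(4) by (rule order_le_less_trans)
  then have fin: "energy V f < \<infinity>"
    by (intro order_le_less_trans[OF E]) (simp add: ennreal_add_less_top)
  have "(f \<longlongrightarrow> a) at_bot"
  proof (rule Lim_transform_eventually[OF q(3)])
    show "eventually (\<lambda>t. q t = f t) at_bot"
      unfolding eventually_at_bot_linorder by (rule exI[of _ T]) (simp add: f_def)
  qed
  moreover have "(f \<longlongrightarrow> \<sigma>) at_top"
  proof (rule tendsto_eventually)
    show "eventually (\<lambda>t. f t = \<sigma>) at_top"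
      unfolding eventually_at_top_linorder by (rule exI[of _ "T + 3"]) (simp add: f_def psi_def)
  qed
  moreover have "f \<in> H1loc" unfolding H1loc_iff using fg gL by blast
  ultimately have "f \<in> connecting V a \<sigma>" using fin by (simp add: connecting_def)
  then have "min_energy V a \<sigma> \<le> energy V f" unfolding min_energy_def by (rule INF_lower)
  then show ?thesis using E by (rule order_trans)
qed

text \<open>Both halves of \<open>q\<close>, the right one reversed in time, are closed up at
  \<open>\<sigma>\<close>. The halves of the energy add up since the cut time is null, and the
  connection is paid twice, which doubles the error term of a single cut.\<close>

lemma min_energy_split:
  fixes V :: "real ^ 'n \<Rightarrow> real"
  assumes q: "q \<in> connecting V a b"
    and V: "continuous_on UNIV V" "\<And>u. V u \<ge> 0" "V \<sigma> = 0"
    and S: "\<And>u. u \<in> closed_segment (q T) \<sigma> \<Longrightarrow> V u \<le> S"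
  shows "min_energy V a \<sigma> + min_energy V \<sigma> b \<le> energy V q + ennreal ((norm (\<sigma> - q T))\<^sup>2 / 2 + 4 * S)"
proof -
  have qH: "q \<in> H1loc" and lim: "(q \<longlongrightarrow> a) at_bot" "(q \<longlongrightarrow> b) at_top" and E: "energy V q < \<infinity>"
    using q by (auto simp: connecting_def)
  let ?p = "weak_derivative q"
  note p = H1locD[OF qH]
  let ?d = "\<lambda>t. ennreal (1/2 * (norm (?p t))\<^sup>2 + V (q t))"
  let ?k = "(norm (\<sigma> - q T))\<^sup>2 / 4 + 2 * S"
  have dm [measurable]: "?d \<in> borel_measurable borel"
    by (rule energy_density_measurable[OF p(1,3) V(1)])
  have S0: "S \<ge> 0" using V(2)[of \<sigma>] S[of \<sigma>] V(3) by auto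
  have 1: "min_energy V a \<sigma> \<le> (\<integral>\<^sup>+t\<in>{..T}. ?d t \<partial>lborel) + ennreal ?k"
    by (rule min_energy_cut[OF p(2,1) lim(1) E V S])
  have "min_energy V \<sigma> b \<le> min_energy V b \<sigma>" by (rule min_energy_commute_le[OF V(1)])
  also have "\<dots> \<le> (\<integral>\<^sup>+t\<in>{..-T}. ennreal (1/2 * (norm (- ?p (- t)))\<^sup>2 + V (q (- t))) \<partial>lborel) + ennreal ?k"
    using min_energy_cut[OF primitive_reflect[OF p(2)] L2loc_reflect[OF p(1)], of b V \<sigma> "-T" S] S V
      lim(2) E H1loc_reflect(2)[OF qH V(1)] by (simp add: filterlim_at_bot_mirror)
  also have "(\<integral>\<^sup>+t\<in>{..-T}. ennreal (1/2 * (norm (- ?p (- t)))\<^sup>2 + V (q (- t))) \<partial>lborel) = (\<integral>\<^sup>+t\<in>{T..}. ?d t \<partial>lborel)"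
  proof -
    have "(\<lambda>t. ?d t * indicator {T..} t) \<in> borel_measurable borel" by measurable
    from nn_integral_real_affine[OF this, of "-1" 0]
    show ?thesis by (auto intro!: nn_integral_cong simp: indicator_def)
  qed
  finally have 2: "min_energy V \<sigma> b \<le> (\<integral>\<^sup>+t\<in>{T..}. ?d t \<partial>lborel) + ennreal ?k" .
  have "(\<integral>\<^sup>+t\<in>{..T}. ?d t \<partial>lborel) + (\<integral>\<^sup>+t\<in>{T..}. ?d t \<partial>lborel) = (\<integral>\<^sup>+t. ?d t * indicator {..T} t + ?d t * indicator {T..} t \<partial>lborel)"
    by (rule nn_integral_add[symmetric]) measurable
  also have "\<dots> = (\<integral>\<^sup>+t. ?d t \<partial>lborel)"
  proof (rule nn_integral_cong_AE)
    have "AE t in lborel. t \<noteq> T" by (rule AE_lborel_singleton)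
    then show "AE t in lborel. ?d t * indicator {..T} t + ?d t * indicator {T..} t = ?d t"
      by eventually_elim (auto simp: indicator_def)
  qed
  finally have 3: "(\<integral>\<^sup>+t\<in>{..T}. ?d t \<partial>lborel) + (\<integral>\<^sup>+t\<in>{T..}. ?d t \<partial>lborel) = energy V q"
    by (simp add: energy_def)
  have 4: "ennreal ?k + ennreal ?k = ennreal ((norm (\<sigma> - q T))\<^sup>2 / 2 + 4 * S)"
    using S0 by (subst ennreal_plus[symmetric]) auto
  show ?thesis
    using add_mono[OF 1 2] unfolding 3[symmetric] 4[symmetric] by (simp add: ac_simps)
qed

section \<open>Taylor expansion of the potential and first variation along tents\<close>

text \<open>\<open>grad\<close> is a definite description, so it has to be evaluated: the vector
  \<open>D\<close> representing the Frechet derivative by inner products exists by expansion in the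
  basis and is unique because the derivative is.\<close>

lemma C2_function_grad:
  assumes "C2_function V"
  shows "(V has_derivative (\<lambda>h. grad V u \<bullet> h)) (at u)"
    "continuous_on UNIV V" "continuous_on UNIV (grad V)"
proof -
  have V: "V differentiable (at x)" "grad V differentiable (at x)" for x
    using assms by (auto simp: C2_function_def differentiable_on_def)
  show "continuous_on UNIV V" "continuous_on UNIV (grad V)"
    using assms by (auto simp: C2_function_def intro: differentiable_imp_continuous_on)
  obtain f' where f': "(V has_derivative f') (at u)" using V(1) by (auto simp: differentiable_def)
  define D where "D = (\<Sum>b\<in>Basis. f' b *\<^sub>R b)"
  have lin: "linear f'" using f' by (rule has_derivative_linear)
  have "f' h = h \<bullet> D" for h
  proof -
    have "f' h = f' (\<Sum>b\<in>Basis. (h \<bullet> b) *\<^sub>R b)" by (simp add: euclidean_representation)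
    also have "\<dots> = (\<Sum>b\<in>Basis. (h \<bullet> b) * f' b)" by (simp add: linear_sum[OF lin] linear_cmul[OF lin])
    finally show ?thesis by (simp add: D_def inner_sum_right mult.commute)
  qed
  then have "f' = (\<lambda>h. h \<bullet> D)" by (rule ext)
  then have D: "GDERIV V u :> D" using f' by (simp add: gderiv_def)
  have "grad V u = D"
    unfolding grad_def
  proof (rule the_equality)
    show "GDERIV V u :> D" by (rule D)
    fix D' assume D': "GDERIV V u :> D'"
    have "(\<lambda>h. h \<bullet> D') = (\<lambda>h. h \<bullet> D)"
      using D D' unfolding gderiv_def by (rule has_derivative_unique[rotated])
    then have "h \<bullet> D' = h \<bullet> D" for h by meson
    then show "D' = D" using vector_eq_ldot by blast
  qed
  then show "(V has_derivative (\<lambda>h. grad V u \<bullet> h)) (at u)"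
    using D by (simp add: gderiv_def inner_commute)
qed

lemma C2_function_grad_lipschitz:
  fixes V :: "real ^ 'n \<Rightarrow> real"
  assumes "C2_function V"
  obtains C where "C \<ge> 0" "\<And>x y. norm x \<le> R \<Longrightarrow> norm y \<le> R \<Longrightarrow> norm (grad V y - grad V x) \<le> C * norm (y - x)"
proof -
  have V: "(grad V has_derivative (\<lambda>h. hessian V x *v h)) (at x)" for x
  proof -
    have "grad V differentiable (at x)" using assms by (auto simp: C2_function_def differentiable_on_def)
    then have d: "(grad V has_derivative frechet_derivative (grad V) (at x)) (at x)"
      by (simp add: frechet_derivative_works)
    then have "(\<lambda>h. hessian V x *v h) = frechet_derivative (grad V) (at x)"
      unfolding hessian_def using has_derivative_linear[OF d]
      by (intro ext matrix_works) (simp add: linear_matrix_vector_mul_eq)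
    then show ?thesis using d by simp
  qed
  have "compact (hessian V ` cball 0 R)"
    using assms by (intro compact_continuous_image) (auto simp: C2_function_def intro: continuous_on_subset)
  then have "bounded (hessian V ` cball 0 R)" by (rule compact_imp_bounded)
  then obtain B where B: "\<And>x. x \<in> cball 0 R \<Longrightarrow> norm (hessian V x) \<le> B" unfolding bounded_iff by blast
  \<comment> \<open>The operator norm of a matrix is at most the number of its entries times a bound
    for them.\<close>
  define C where "C = real CARD('n) * real CARD('n) * \<bar>B\<bar>"
  have on: "onorm (\<lambda>h. hessian V x *v h) \<le> C" if "x \<in> cball 0 R" for x
  proof -
    have "\<bar>hessian V x $ i $ j\<bar> \<le> \<bar>B\<bar>" for i j
    proof -
      have "\<bar>hessian V x $ i $ j\<bar> \<le> norm (hessian V x $ i)" by (rule component_le_norm_cart)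
      also have "\<dots> \<le> norm (hessian V x)" by (rule Finite_Cartesian_Product.norm_nth_le)
      finally show ?thesis using B[OF that] by linarith
    qed
    then show ?thesis unfolding C_def by (rule onorm_le_matrix_component)
  qed
  show ?thesis
  proof (rule that[of C])
    show "C \<ge> 0" by (simp add: C_def)
    fix x y :: "real ^ 'n" assume "norm x \<le> R" "norm y \<le> R"
    then show "norm (grad V y - grad V x) \<le> C * norm (y - x)"
      using on V by (intro differentiable_bound[of "cball 0 R" "grad V" "\<lambda>x h. hessian V x *v h"])
        (auto intro: has_derivative_at_withinI)
  qed
qed

text \<open>The mean value theorem along the segment, followed by the Lipschitz bound at an
  intermediate point of unknown position; hence the constant \<open>C\<close> in place of
  \<open>C / 2\<close>.\<close>

lemma C2_function_taylor:
  fixes V :: "real ^ 'n \<Rightarrow> real"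
  assumes V: "C2_function V" and C: "C \<ge> 0" "\<And>x y. norm x \<le> R \<Longrightarrow> norm y \<le> R \<Longrightarrow> norm (grad V y - grad V x) \<le> C * norm (y - x)"
    and xy: "norm x \<le> R" "norm y \<le> R"
  shows "V y \<le> V x + grad V x \<bullet> (y - x) + C * (norm (y - x))\<^sup>2"
proof -
  let ?l = "\<lambda>s. x + s *\<^sub>R (y - x)"
  have der: "((\<lambda>s. V (?l s)) has_real_derivative grad V (?l s) \<bullet> (y - x)) (at s)" for s
  proof -
    have "(?l has_derivative (\<lambda>h. h *\<^sub>R (y - x))) (at s)" by (auto intro!: derivative_eq_intros)
    from diff_chain_at[OF this C2_function_grad(1)[OF V]]
    show ?thesis by (simp add: has_field_derivative_def o_def mult_commute_abs)
  qed
  obtain s where s: "0 < s" "s < 1" "V (?l 1) - V (?l 0) = (1 - 0) * (grad V (?l s) \<bullet> (y - x))"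
    using MVT2[of 0 1 "\<lambda>s. V (?l s)" "\<lambda>s. grad V (?l s) \<bullet> (y - x)"] der by auto
  have "?l s = (1 - s) *\<^sub>R x + s *\<^sub>R y" by (simp add: algebra_simps)
  then have "?l s \<in> closed_segment x y" using s unfolding closed_segment_def by auto
  moreover have "closed_segment x y \<subseteq> cball 0 R" by (rule closed_segment_subset) (use xy in auto)
  ultimately have n: "norm (?l s) \<le> R" by auto
  have "V y - V x - grad V x \<bullet> (y - x) = (grad V (?l s) - grad V x) \<bullet> (y - x)"
    using s(3) by (simp add: inner_diff_left)
  also have "\<dots> \<le> norm (grad V (?l s) - grad V x) * norm (y - x)" by (rule norm_cauchy_schwarz)
  also have "\<dots> \<le> (C * norm (?l s - x)) * norm (y - x)" by (intro mult_right_mono C n xy) auto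
  also have "\<dots> = C * s * (norm (y - x))\<^sup>2" using s by (simp add: power2_eq_square)
  also have "\<dots> \<le> C * (norm (y - x))\<^sup>2" using s C(1) by (intro mult_right_mono mult_left_le) auto
  finally show ?thesis by simp
qed

definition second_diff :: "real \<Rightarrow> real \<Rightarrow> (real \<Rightarrow> 'a::real_vector) \<Rightarrow> 'a" where
  "second_diff a h q = q (a + h) - 2 *\<^sub>R q a + q (a - h)"

text \<open>The first variation of the energy in vector form: its derivative at \<open>q\<close> in
  the direction \<open>hat a h t *\<^sub>R e\<close> is \<open>residual V a h q \<bullet> e\<close>.
  Since \<open>hat'\<close> is 1 on the left half of the window and -1 on the right half, the
  kinetic part integrates to minus a second difference and the derivative of \<open>q\<close>
  disappears.\<close>

definition residual :: "(real ^ 'n \<Rightarrow> real) \<Rightarrow> real \<Rightarrow> real \<Rightarrow> (real \<Rightarrow> real ^ 'n) \<Rightarrow> real ^ 'n" where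
  "residual V a h q = (LBINT t:{a-h..a+h}. hat a h t *\<^sub>R grad V (q t)) - second_diff a h q"

lemma hat'_pairing:
  fixes q :: "real \<Rightarrow> 'a::euclidean_space"
  assumes q: "primitive q p" and h: "h > 0"
  shows "integrable lborel (\<lambda>t. hat' a h t * (p t \<bullet> e))"
    "(LBINT t. hat' a h t * (p t \<bullet> e)) = - (second_diff a h q \<bullet> e)"
proof -
  have Q: "primitive (\<lambda>t. q t \<bullet> e) (\<lambda>t. p t \<bullet> e)"
    by (rule primitive_bounded_linear[OF q bounded_linear_inner_left])
  let ?f = "\<lambda>t. indicator {a-h..a} t *\<^sub>R (p t \<bullet> e) - indicator {a..a+h} t *\<^sub>R (p t \<bullet> e)"
  have [measurable]: "p \<in> borel_measurable borel" using primitiveD(1)[OF q] .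
  have [measurable]: "hat' a h \<in> borel_measurable borel" unfolding hat'_def[abs_def] by measurable
  have i: "integrable lborel (\<lambda>t. indicator {b..c} t *\<^sub>R (p t \<bullet> e))" for b c
    using primitiveD(2)[OF Q] by (simp add: set_integrable_def)
  have ae: "AE t in lborel. hat' a h t * (p t \<bullet> e) = ?f t"
  proof -
    have "AE t in lborel. t \<noteq> a" "AE t in lborel. t \<noteq> a + h" by (rule AE_lborel_singleton)+
    then show ?thesis
    proof eventually_elim
      case (elim t)
      then show ?case using h by (auto simp: hat'_eq indicator_def)
    qed
  qed
  have if': "integrable lborel ?f" by (intro Bochner_Integration.integrable_diff i)
  then show "integrable lborel (\<lambda>t. hat' a h t * (p t \<bullet> e))"
    using ae by (subst integrable_cong_AE[of _ _ ?f]) auto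
  have "(LBINT t. hat' a h t * (p t \<bullet> e)) = (LBINT t. ?f t)"
    using ae by (intro integral_cong_AE) auto
  also have "\<dots> = (q a \<bullet> e - q (a - h) \<bullet> e) - (q (a + h) \<bullet> e - q a \<bullet> e)"
    using primitiveD(3)[OF Q, of "a-h" a] primitiveD(3)[OF Q, of a "a+h"] h
    by (subst Bochner_Integration.integral_diff[OF i i]) (simp add: set_lebesgue_integral_def)
  finally show "(LBINT t. hat' a h t * (p t \<bullet> e)) = - (second_diff a h q \<bullet> e)"
    by (simp add: second_diff_def inner_add_left inner_diff_left)
qed

lemma hat_pairing:
  fixes g :: "real \<Rightarrow> 'a::euclidean_space"
  assumes g: "continuous_on UNIV g" and h: "h > 0"
  shows "integrable lborel (\<lambda>t. hat a h t * (g t \<bullet> e))"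
    "(LBINT t. hat a h t * (g t \<bullet> e)) = (LBINT t:{a-h..a+h}. hat a h t *\<^sub>R g t) \<bullet> e"
proof -
  have i: "set_integrable lborel {a-h..a+h} (\<lambda>t. hat a h t *\<^sub>R g t)"
    by (intro set_integrable_continuous_scaleR set_integrable_continuous continuous_hat g)
  have "(LBINT t. hat a h t * (g t \<bullet> e)) = (LBINT t:{a-h..a+h}. hat a h t * (g t \<bullet> e))"
    by (rule lborel_integral_Icc) (subst hat_outside[OF h], simp_all)
  also have "\<dots> = (LBINT t:{a-h..a+h}. hat a h t *\<^sub>R g t) \<bullet> e"
    by (simp add: set_integral_inner_left[OF i])
  finally show "(LBINT t. hat a h t * (g t \<bullet> e)) = (LBINT t:{a-h..a+h}. hat a h t *\<^sub>R g t) \<bullet> e" .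
  have "set_integrable lborel {a-h..a+h} (\<lambda>t. hat a h t * (g t \<bullet> e))"
    by (intro set_integrable_continuous continuous_intros g)
  moreover have "(\<lambda>t. indicator {a-h..a+h} t *\<^sub>R (hat a h t * (g t \<bullet> e))) = (\<lambda>t. hat a h t * (g t \<bullet> e))"
  proof
    fix t show "indicator {a-h..a+h} t *\<^sub>R (hat a h t * (g t \<bullet> e)) = hat a h t * (g t \<bullet> e)"
      by (cases "t \<in> {a-h..a+h}") (simp, subst (1 2) hat_outside[OF h], simp_all)
  qed
  ultimately show "integrable lborel (\<lambda>t. hat a h t * (g t \<bullet> e))"
    by (simp add: set_integrable_def)
qed

text \<open>Jensen's inequality for weights of total at most 1, via Cauchy-Schwarz with each weight
  split into two square roots. It makes the quadratic remainder below linear in the total weight and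
  independent of the number of tents.\<close>

lemma sum_weighted_norm_square_le:
  fixes x :: "'i \<Rightarrow> 'a::real_normed_vector"
  assumes "finite I" "\<And>i. i \<in> I \<Longrightarrow> w i \<ge> 0" "(\<Sum>i\<in>I. w i) \<le> 1"
    "\<And>i. i \<in> I \<Longrightarrow> (norm (x i))\<^sup>2 \<le> b i"
  shows "(norm (\<Sum>i\<in>I. w i *\<^sub>R x i))\<^sup>2 \<le> (\<Sum>i\<in>I. w i * b i)"
proof -
  have "norm (\<Sum>i\<in>I. w i *\<^sub>R x i) \<le> (\<Sum>i\<in>I. w i * norm (x i))"
    by (rule order_trans[OF norm_sum]) (use assms in \<open>auto intro!: sum_mono\<close>)
  then have "(norm (\<Sum>i\<in>I. w i *\<^sub>R x i))\<^sup>2 \<le> (\<Sum>i\<in>I. w i * norm (x i))\<^sup>2"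
    by (intro power_mono) auto
  also have "\<dots> = (\<Sum>i\<in>I. sqrt (w i) * (sqrt (w i) * norm (x i)))\<^sup>2"
    using assms(2) by (auto intro!: arg_cong[where f = "\<lambda>z. z\<^sup>2"] sum.cong simp flip: mult.assoc)
  also have "\<dots> \<le> (\<Sum>i\<in>I. (sqrt (w i))\<^sup>2) * (\<Sum>i\<in>I. (sqrt (w i) * norm (x i))\<^sup>2)"
    by (rule Cauchy_Schwarz_ineq_sum)
  also have "\<dots> = (\<Sum>i\<in>I. w i) * (\<Sum>i\<in>I. w i * (norm (x i))\<^sup>2)"
    using assms(2) by (simp add: power_mult_distrib)
  also have "\<dots> \<le> (\<Sum>i\<in>I. w i * (norm (x i))\<^sup>2)"
    using assms(2,3) by (intro mult_left_le_one_le sum_nonneg) auto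
  also have "\<dots> \<le> (\<Sum>i\<in>I. w i * b i)"
    using assms(2,4) by (intro sum_mono mult_left_mono) auto
  finally show ?thesis .
qed

text \<open>The quadratic remainder is controlled uniformly on energy sublevels, so a single step of
  fixed size along a descent direction replaces the gradient flow.\<close>

lemma energy_hat_expansion:
  fixes V :: "real ^ 'n \<Rightarrow> real" and I :: "'i set"
  assumes V: "C2_function V" "\<And>u. V u \<ge> 0"
    and C: "C \<ge> 0" "\<And>x y. norm x \<le> R + 1 \<Longrightarrow> norm y \<le> R + 1 \<Longrightarrow> norm (grad V y - grad V x) \<le> C * norm (y - x)"
    and q: "q \<in> H1loc" "energy V q = ennreal E" "E \<ge> 0" "\<And>t. norm (q t) \<le> R"
    and I: "finite I" "\<And>i. i \<in> I \<Longrightarrow> w i \<ge> 0" "(\<Sum>i\<in>I. w i) \<le> 1"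
    and hats: "\<And>i. i \<in> I \<Longrightarrow> 0 < h i \<and> h i \<le> 1 \<and> norm (e i) = 1"
    and l: "0 \<le> l" "l \<le> 1"
  shows "energy V (\<lambda>t. q t + l *\<^sub>R (\<Sum>i\<in>I. w i *\<^sub>R hat (a i) (h i) t *\<^sub>R e i))
    \<le> ennreal (E + l * (\<Sum>i\<in>I. w i * (residual V (a i) (h i) q \<bullet> e i)) + l\<^sup>2 * (1 + 2 * C) * (\<Sum>i\<in>I. w i))"
proof -
  let ?p = "weak_derivative q"
  define \<phi> where "\<phi> t = (\<Sum>i\<in>I. w i *\<^sub>R hat (a i) (h i) t *\<^sub>R e i)" for t
  define \<phi>' where "\<phi>' t = (\<Sum>i\<in>I. w i *\<^sub>R hat' (a i) (h i) t *\<^sub>R e i)" for t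
  note p = H1locD[OF q(1)] and Vc = C2_function_grad(2)[OF V(1)]
  have E: "energy V q < \<infinity>" using q(2) by simp
  note fe = finite_energy_integrable[OF q(1) E Vc V(2)]
  have Eeq: "(LBINT t. 1/2 * (norm (?p t))\<^sup>2 + V (q t)) = E"
  proof -
    have "(LBINT t. 1/2 * (norm (?p t))\<^sup>2 + V (q t)) \<ge> 0"
      using V(2) by (intro Bochner_Integration.integral_nonneg) simp
    then show ?thesis using fe(3) q(2,3) ennreal_inj by metis
  qed
  have \<phi>prim: "primitive \<phi> \<phi>'"
    unfolding \<phi>_def[abs_def] \<phi>'_def[abs_def]
    by (intro primitive_sum I primitive_scaleR primitive_bounded_linear[OF primitive_hat bounded_linear_scaleR_left])
  have hat2: "(norm (hat (a i) (h i) t *\<^sub>R e i))\<^sup>2 \<le> indicator {a i - h i..a i + h i} t"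
    "(norm (hat' (a i) (h i) t *\<^sub>R e i))\<^sup>2 \<le> indicator {a i - h i..a i + h i} t" if "i \<in> I" for i t
  proof -
    have hi: "0 < h i" "h i \<le> 1" "norm (e i) = 1" using hats[OF that] by auto
    have "hat (a i) (h i) t \<le> 1" "hat (a i) (h i) t \<ge> 0"
      using hat_le[OF hi(1), of "a i" t] hat_nonneg[OF hi(1), of "a i" t] hi(2) by linarith+
    then have "(hat (a i) (h i) t)\<^sup>2 \<le> 1" by (simp add: power_le_one)
    moreover have "t \<notin> {a i - h i..a i + h i} \<Longrightarrow> hat (a i) (h i) t = 0" by (rule hat_outside[OF hi(1)])
    ultimately show "(norm (hat (a i) (h i) t *\<^sub>R e i))\<^sup>2 \<le> indicator {a i - h i..a i + h i} t"
      using hi(3) by (cases "t \<in> {a i - h i..a i + h i}") (auto simp del: atLeastAtMost_iff)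
    show "(norm (hat' (a i) (h i) t *\<^sub>R e i))\<^sup>2 \<le> indicator {a i - h i..a i + h i} t"
      using hi by (auto simp: hat'_eq indicator_def)
  qed
  \<comment> \<open>A common majorant of the squares of the perturbation and of its density: a tent
    of height at most 1 and slope at most 1 is dominated by the indicator of its window. Each window
    has length at most 2, so the integral is at most twice the total weight.\<close>
  let ?W = "\<lambda>t. (\<Sum>i\<in>I. w i * indicator {a i - h i..a i + h i} t) :: real"
  have \<phi>2: "(norm (\<phi> t))\<^sup>2 \<le> ?W t" "(norm (\<phi>' t))\<^sup>2 \<le> ?W t" for t
    unfolding \<phi>_def \<phi>'_def by (intro sum_weighted_norm_square_le I hat2; assumption)+
  have W1: "?W t \<le> 1" for t
  proof -
    have "?W t \<le> (\<Sum>i\<in>I. w i)" using I(2) by (intro sum_mono) (auto simp: indicator_def)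
    then show ?thesis using I(3) by simp
  qed
  \<comment> \<open>Keeps the perturbed curve in the ball of radius \<open>R + 1\<close>, where the
    Lipschitz constant \<open>C\<close> is valid.\<close>
  have \<phi>1: "norm (\<phi> t) \<le> 1" for t
    using \<phi>2(1)[of t] W1[of t] by (intro power2_le_imp_le[of "norm (\<phi> t)" 1]) auto
  let ?L = "\<lambda>t. \<Sum>i\<in>I. w i * (hat' (a i) (h i) t * (?p t \<bullet> e i) + hat (a i) (h i) t * (grad V (q t) \<bullet> e i))"
  \<comment> \<open>An integrable pointwise majorant of the new energy density. In the quadratic
    coefficient \<open>1/2\<close> comes from the kinetic square and \<open>C\<close> from the
    Taylor estimate; the bound 2 for the windows turns \<open>1/2 + C\<close> into
    \<open>1 + 2 * C\<close>.\<close>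
  let ?F = "\<lambda>t. (1/2 * (norm (?p t))\<^sup>2 + V (q t)) + l * ?L t + (l\<^sup>2 * (1/2 + C)) * ?W t"
  have gq: "continuous_on UNIV (\<lambda>t. grad V (q t))"
    using continuous_on_compose2[OF C2_function_grad(3)[OF V(1)] p(3)] by auto
  have iL: "integrable lborel (\<lambda>t. hat' (a i) (h i) t * (?p t \<bullet> e i) + hat (a i) (h i) t * (grad V (q t) \<bullet> e i))" 
    "(LBINT t. hat' (a i) (h i) t * (?p t \<bullet> e i) + hat (a i) (h i) t * (grad V (q t) \<bullet> e i)) = residual V (a i) (h i) q \<bullet> e i"
    if "i \<in> I" for i
  proof -
    have hi: "0 < h i" using hats[OF that] by auto
    note 1 = hat'_pairing[OF p(2) hi, of "a i" "e i"] and 2 = hat_pairing[OF gq hi, of "a i" "e i"]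
    show "integrable lborel (\<lambda>t. hat' (a i) (h i) t * (?p t \<bullet> e i) + hat (a i) (h i) t * (grad V (q t) \<bullet> e i))"
      by (intro Bochner_Integration.integrable_add 1 2)
    show "(LBINT t. hat' (a i) (h i) t * (?p t \<bullet> e i) + hat (a i) (h i) t * (grad V (q t) \<bullet> e i)) = residual V (a i) (h i) q \<bullet> e i"
      by (subst Bochner_Integration.integral_add[OF 1(1) 2(1)])
        (simp add: 1(2) 2(2) residual_def inner_diff_left)
  qed
  have iL': "integrable lborel ?L" by (intro Bochner_Integration.integrable_sum integrable_mult_right iL)
  have iW: "integrable lborel ?W"
    by (intro Bochner_Integration.integrable_sum integrable_mult_right) (auto simp: emeasure_lborel_Icc_eq)
  have ie: "integrable lborel (\<lambda>t. 1/2 * (norm (?p t))\<^sup>2 + V (q t))"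
    using fe by (intro Bochner_Integration.integrable_add) simp_all
  have iF: "integrable lborel ?F"
    by (intro Bochner_Integration.integrable_add ie integrable_mult_right iL' iW)
  have LW: "(LBINT t. ?W t) \<le> 2 * (\<Sum>i\<in>I. w i)"
  proof -
    have "(LBINT t. ?W t) = (\<Sum>i\<in>I. w i * (2 * h i))"
    proof (subst Bochner_Integration.integral_sum)
      show "integrable lborel (\<lambda>t. w i * indicator {a i - h i..a i + h i} t)" if "i \<in> I" for i
        by (intro integrable_mult_right) (auto simp: emeasure_lborel_Icc_eq)
      show "(\<Sum>i\<in>I. LBINT t. w i * indicator {a i - h i..a i + h i} t) = (\<Sum>i\<in>I. w i * (2 * h i))"
        using hats by (intro sum.cong) (auto simp: measure_def less_imp_le)
    qed
    also have "\<dots> \<le> (\<Sum>i\<in>I. w i * 2)" using hats I(2) by (intro sum_mono mult_left_mono) auto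
    finally show ?thesis unfolding sum_distrib_left by (simp only: mult.commute)
  qed
  have LL: "(LBINT t. ?L t) = (\<Sum>i\<in>I. w i * (residual V (a i) (h i) q \<bullet> e i))"
    by (subst Bochner_Integration.integral_sum) (use iL in \<open>auto intro!: sum.cong integrable_mult_right simp del: distrib_left_numeral\<close>)
  have "(LBINT t. ?F t) = E + l * (LBINT t. ?L t) + (l\<^sup>2 * (1/2 + C)) * (LBINT t. ?W t)"
    using ie iL' iW by (simp only: Bochner_Integration.integral_add Bochner_Integration.integrable_add
        integrable_mult_right integral_mult_right_zero Eeq)
  also have "\<dots> \<le> E + l * (LBINT t. ?L t) + (l\<^sup>2 * (1/2 + C)) * (2 * (\<Sum>i\<in>I. w i))"
    using LW C(1) by (intro add_left_mono mult_left_mono) auto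
  finally have IF: "(LBINT t. ?F t) \<le> E + l * (\<Sum>i\<in>I. w i * (residual V (a i) (h i) q \<bullet> e i)) + l\<^sup>2 * (1 + 2 * C) * (\<Sum>i\<in>I. w i)"
    unfolding LL by (simp add: algebra_simps)
  have pt: "1/2 * (norm (?p t + l *\<^sub>R \<phi>' t))\<^sup>2 + V (q t + l *\<^sub>R \<phi> t) \<le> ?F t" for t
  proof -
    have n: "norm (l *\<^sub>R \<phi> t) \<le> 1" using \<phi>1[of t] l by (auto intro: mult_le_one)
    have "V (q t + l *\<^sub>R \<phi> t) \<le> V (q t) + grad V (q t) \<bullet> (q t + l *\<^sub>R \<phi> t - q t) + C * (norm (q t + l *\<^sub>R \<phi> t - q t))\<^sup>2"
    proof (rule C2_function_taylor[OF V(1) C])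
      show "norm (q t) \<le> R + 1" using q(4)[of t] by simp
      show "norm (q t + l *\<^sub>R \<phi> t) \<le> R + 1"
        using q(4)[of t] n norm_triangle_ineq[of "q t" "l *\<^sub>R \<phi> t"] by linarith
    qed
    also have "\<dots> = V (q t) + l * (grad V (q t) \<bullet> \<phi> t) + l\<^sup>2 * (C * (norm (\<phi> t))\<^sup>2)"
      by (simp add: power_mult_distrib)
    also have "\<dots> \<le> V (q t) + l * (grad V (q t) \<bullet> \<phi> t) + l\<^sup>2 * (C * ?W t)"
      using \<phi>2(1)[of t] C(1) by (intro add_left_mono mult_left_mono) auto
    finally have 1: "V (q t + l *\<^sub>R \<phi> t) \<le> V (q t) + l * (grad V (q t) \<bullet> \<phi> t) + l\<^sup>2 * (C * ?W t)" .
    have "(norm (?p t + l *\<^sub>R \<phi>' t))\<^sup>2 = (norm (?p t))\<^sup>2 + 2 * l * (?p t \<bullet> \<phi>' t) + l\<^sup>2 * (norm (\<phi>' t))\<^sup>2"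
      unfolding power2_norm_eq_inner
      by (simp add: inner_add_left inner_add_right inner_commute power2_eq_square algebra_simps)
    also have "\<dots> \<le> (norm (?p t))\<^sup>2 + 2 * l * (?p t \<bullet> \<phi>' t) + l\<^sup>2 * ?W t"
      using \<phi>2(2)[of t] by (intro add_left_mono mult_left_mono) auto
    finally have 2: "1/2 * (norm (?p t + l *\<^sub>R \<phi>' t))\<^sup>2 \<le> 1/2 * (norm (?p t))\<^sup>2 + l * (?p t \<bullet> \<phi>' t) + l\<^sup>2 * (1/2 * ?W t)"
      by (simp add: algebra_simps)
    have 3: "?p t \<bullet> \<phi>' t + grad V (q t) \<bullet> \<phi> t = ?L t"
      unfolding \<phi>_def \<phi>'_def by (simp add: inner_sum_right sum.distrib algebra_simps)
    have "?F t = 1/2 * (norm (?p t))\<^sup>2 + V (q t) + l * (?p t \<bullet> \<phi>' t + grad V (q t) \<bullet> \<phi> t) + (l\<^sup>2 * (1/2 + C)) * ?W t"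
      unfolding 3 by simp
    also have "\<dots> = (1/2 * (norm (?p t))\<^sup>2 + l * (?p t \<bullet> \<phi>' t) + l\<^sup>2 * (1/2 * ?W t)) + (V (q t) + l * (grad V (q t) \<bullet> \<phi> t) + l\<^sup>2 * (C * ?W t))"
      by (simp add: algebra_simps)
    finally show ?thesis using 1 2 by linarith
  qed
  have prim: "primitive (\<lambda>t. q t + l *\<^sub>R \<phi> t) (\<lambda>t. ?p t + l *\<^sub>R \<phi>' t)"
    by (intro primitive_add primitive_scaleR \<phi>prim p)
  have [measurable]: "\<phi>' \<in> borel_measurable borel" using primitiveD(1)[OF \<phi>prim] .
  have "L2_curve \<phi>'"
    unfolding L2_curve_def
  proof
    show "integrable lborel (\<lambda>t. (norm (\<phi>' t))\<^sup>2)"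
    proof (rule Bochner_Integration.integrable_bound[OF iW])
      show "AE t in lborel. norm ((norm (\<phi>' t))\<^sup>2) \<le> norm (?W t)"
        using \<phi>2(2) by (intro AE_I2) (auto intro: order_trans[OF _ abs_ge_self])
    qed simp
  qed simp
  then have L2: "L2loc_curve (\<lambda>t. ?p t + l *\<^sub>R \<phi>' t)"
    by (intro L2loc_add p L2_imp_L2loc L2_curve_scaleR)
  have "energy V (\<lambda>t. q t + l *\<^sub>R \<phi> t) = (\<integral>\<^sup>+t. ennreal (1/2 * (norm (?p t + l *\<^sub>R \<phi>' t))\<^sup>2 + V (q t + l *\<^sub>R \<phi> t)) \<partial>lborel)"
    by (rule energy_primitive[OF prim L2])
  also have "\<dots> \<le> (\<integral>\<^sup>+t. ennreal (?F t) \<partial>lborel)"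
    using pt by (intro nn_integral_mono ennreal_leI) auto
  also have "\<dots> = ennreal (LBINT t. ?F t)"
  proof (rule nn_integral_eq_integral[OF iF])
    have "0 \<le> ?F t" for t
      by (rule order_trans[OF _ pt]) (use V(2) in auto)
    then show "AE t in lborel. 0 \<le> ?F t" by (rule AE_I2)
  qed
  also have "\<dots> \<le> ennreal (E + l * (\<Sum>i\<in>I. w i * (residual V (a i) (h i) q \<bullet> e i)) + l\<^sup>2 * (1 + 2 * C) * (\<Sum>i\<in>I. w i))"
    by (rule ennreal_leI[OF IF])
  finally show ?thesis unfolding \<phi>_def .
qed

section \<open>Limits of almost critical curves\<close>

lemma primitive_has_vector_derivative:
  fixes f :: "real \<Rightarrow> 'a::euclidean_space"
  assumes P: "primitive P f" and f: "continuous_on UNIV f"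
  shows "(P has_vector_derivative f t) (at t)"
proof -
  have "((\<lambda>s. integral {t-1..s} f) has_vector_derivative f t) (at t within {t-1..t+1})"
    by (rule integral_has_vector_derivative) (auto intro: continuous_on_subset[OF f])
  then have "((\<lambda>s. integral {t-1..s} f) has_vector_derivative f t) (at t)"
    by (subst (asm) at_within_interior) auto
  then have "((\<lambda>s. P (t-1) + integral {t-1..s} f) has_vector_derivative f t) (at t)"
    using has_vector_derivative_add[OF has_vector_derivative_const] by fastforce
  then show ?thesis
  proof (rule has_vector_derivative_transform_within_open[where S = "{t-1<..<t+1}"])
    fix s assume "s \<in> {t-1<..<t+1}"
    then show "P (t-1) + integral {t-1..s} f = P s"
      using primitiveD(3)[OF P, of "t-1" s] set_borel_integral_eq_integral(2)[OF primitiveD(2)[OF P, of "t-1" s]]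
      by (simp add: algebra_simps)
  qed auto
qed

lemma has_vector_derivative_translate:
  assumes "(f has_vector_derivative D) (at (c + h))"
  shows "((\<lambda>h. f (c + h)) has_vector_derivative D) (at h)"
proof -
  have "((\<lambda>h. c + h) has_vector_derivative 1) (at h)" by (auto intro!: derivative_eq_intros)
  from vector_diff_chain_at[OF this assms] show ?thesis by (simp add: o_def)
qed

lemma has_vector_derivative_reflect:
  assumes "(f has_vector_derivative D) (at (c - h))"
  shows "((\<lambda>h. f (c - h)) has_vector_derivative - D) (at h)"
proof -
  have "((\<lambda>h. c - h) has_vector_derivative - 1) (at h)" by (auto intro!: derivative_eq_intros)
  from vector_diff_chain_at[OF this assms] show ?thesis by (simp add: o_def)
qed

lemma continuous_primitive:
  fixes f :: "real \<Rightarrow> 'a::euclidean_space"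
  assumes f: "continuous_on UNIV f"
  obtains P where "primitive P f" "\<And>t. (P has_vector_derivative f t) (at t)"
proof -
  obtain P where "primitive P f"
    by (rule primitive_exists[of f])
      (use borel_measurable_continuous_onI[OF f] set_integrable_continuous[OF f] in auto)
  with that primitive_has_vector_derivative[OF this f] show ?thesis by blast
qed

text \<open>Averaging the midpoint identity over the step shows that such a function is differentiable.\<close>

lemma midpoint_affine:
  fixes g :: "real \<Rightarrow> 'a::euclidean_space"
  assumes g: "continuous_on UNIV g" and mid: "\<And>a h. 0 < h \<Longrightarrow> h \<le> 1 \<Longrightarrow> second_diff a h g = 0"
  obtains k where "\<And>t. (g has_vector_derivative k) (at t)"
proof -
  obtain G where G: "\<And>t. (G has_vector_derivative g t) (at t)" using continuous_primitive[OF g] by blast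
  have mid': "g (a + h) + g (a - h) = 2 *\<^sub>R g a" if "0 \<le> h" "h \<le> 1" for a h
    using mid[of h a] that by (cases "h = 0") (auto simp: second_diff_def algebra_simps scaleR_2)
  have Gp: "((\<lambda>h. G (a + h)) has_vector_derivative g (a + h)) (at h)" for a h
    by (rule has_vector_derivative_translate[OF G])
  have Gm: "((\<lambda>h. G (a - h)) has_vector_derivative - g (a - h)) (at h)" for a h
    by (rule has_vector_derivative_reflect[OF G])
  have av: "g a = (1/2) *\<^sub>R (G (a + 1) - G (a - 1))" for a
  proof -
    have "((\<lambda>h. G (a + h) - G (a - h) - (2 * h) *\<^sub>R g a) has_vector_derivative g (a + h) - - g (a - h) - 2 *\<^sub>R g a) (at h)" for h
      by (intro has_vector_derivative_diff Gp Gm) (auto intro!: derivative_eq_intros)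
    then have "((\<lambda>h. g (a + h) - - g (a - h) - 2 *\<^sub>R g a) has_integral
        (G (a + 1) - G (a - 1) - (2 * 1) *\<^sub>R g a) - (G (a + 0) - G (a - 0) - (2 * 0) *\<^sub>R g a)) {0..1}"
      by (intro fundamental_theorem_of_calculus) (auto intro: has_vector_derivative_at_within)
    moreover have "((\<lambda>h. g (a + h) - - g (a - h) - 2 *\<^sub>R g a) has_integral 0) {0..1}"
      by (rule has_integral_is_0) (use mid'[of _ a] in auto)
    ultimately have "(G (a + 1) - G (a - 1) - (2 * 1) *\<^sub>R g a) - (G (a + 0) - G (a - 0) - (2 * 0) *\<^sub>R g a) = 0"
      by (rule has_integral_unique)
    then have "2 *\<^sub>R g a = G (a + 1) - G (a - 1)" by simp
    then have "(1/2) *\<^sub>R 2 *\<^sub>R g a = (1/2) *\<^sub>R (G (a + 1) - G (a - 1))" by simp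
    then show ?thesis by simp
  qed
  define g1 where "g1 a = (1/2) *\<^sub>R (g (a + 1) - g (a - 1))" for a
  have Gs: "((\<lambda>a. G (a + c)) has_vector_derivative g (a + c)) (at a)" for a c
    using Gp[of c a] by (simp add: add.commute)
  have g1: "(g has_vector_derivative g1 t) (at t)" for t
  proof -
    have "((\<lambda>a. (1/2) *\<^sub>R (G (a + 1) - G (a + (- 1)))) has_vector_derivative (1/2) *\<^sub>R (g (t + 1) - g (t + (- 1)))) (at t)"
      by (rule bounded_linear.has_vector_derivative[OF bounded_linear_scaleR_right
            has_vector_derivative_diff[OF Gs Gs]])
    moreover have "(\<lambda>a. (1/2) *\<^sub>R (G (a + 1) - G (a + (- 1)))) = g" using av by auto
    ultimately show ?thesis by (simp add: g1_def)
  qed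
  have gp: "((\<lambda>h. g (a + h)) has_vector_derivative g1 (a + h)) (at h)" for a h
    by (rule has_vector_derivative_translate[OF g1])
  have gm: "((\<lambda>h. g (a - h)) has_vector_derivative - g1 (a - h)) (at h)" for a h
    by (rule has_vector_derivative_reflect[OF g1])
  \<comment> \<open>Differentiating the midpoint identity in the step shows that \<open>g1\<close>
    takes equal values at points symmetric about \<open>a\<close>. Any two points at distance less
    than 1 are symmetric about their midpoint, so \<open>g1\<close> is locally constant.\<close>
  have sym: "g1 (a + h) = g1 (a - h)" if "0 < h" "h < 1" for a h
  proof -
    have "((\<lambda>h. g (a + h) + g (a - h)) has_vector_derivative g1 (a + h) + - g1 (a - h)) (at h)"
      by (intro has_vector_derivative_add gp gm)
    moreover have "((\<lambda>h. g (a + h) + g (a - h)) has_vector_derivative 0) (at h)"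
    proof (rule has_vector_derivative_transform_within_open[where S = "{0<..<1}" and f = "\<lambda>h. 2 *\<^sub>R g a"])
      show "((\<lambda>h. 2 *\<^sub>R g a) has_vector_derivative 0) (at h)" by (rule has_vector_derivative_const)
      show "\<And>x. x \<in> {0<..<1} \<Longrightarrow> 2 *\<^sub>R g a = g (a + x) + g (a - x)" using mid'[of _ a] by auto
    qed (use that in auto)
    ultimately have "g1 (a + h) + - g1 (a - h) = 0" by (rule vector_derivative_unique_at)
    then show ?thesis by simp
  qed
  have loc: "g1 x = g1 y" if "x < y" "y < x + 1" for x y
    using sym[of "(y - x) / 2" "(x + y) / 2"] that by (simp add: field_simps)
  have der0: "(g1 has_vector_derivative 0) (at x)" for x
  proof (rule has_vector_derivative_transform_within_open[where S = "{x-1<..<x+1}" and f = "\<lambda>_. g1 x"])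
    fix y assume "y \<in> {x-1<..<x+1}"
    then have y: "y < x + 1" "x < y + 1" by auto
    show "g1 x = g1 y"
    proof (rule linorder_cases[of x y])
      show "g1 x = g1 y" if "x < y" by (rule loc[OF that y(1)])
      show "g1 x = g1 y" if "y < x" by (rule loc[OF that y(2), symmetric])
    qed simp
  qed auto
  have "\<exists>k. \<forall>x. g1 x = k"
    by (rule has_vector_derivative_zero_constant[OF convex_UNIV der0]) blast
  then obtain k where "\<And>x. g1 x = k" by blast
  then show ?thesis using that[of k] g1 by simp
qed

text \<open>Regularity of weak solutions. A second antiderivative \<open>w\<close> of
  \<open>f\<close> satisfies the same tent identity by integration by parts, so all second
  differences of \<open>u - w\<close> with step at most 1 vanish and \<open>u - w\<close> is affine.
  Thus \<open>u\<close> inherits two derivatives from \<open>w\<close>.\<close>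

lemma second_difference_C2:
  fixes u f :: "real \<Rightarrow> 'a::euclidean_space"
  assumes u: "continuous_on UNIV u" and f: "continuous_on UNIV f"
    and eq: "\<And>a h. 0 < h \<Longrightarrow> h \<le> 1 \<Longrightarrow> (LBINT t:{a-h..a+h}. hat a h t *\<^sub>R f t) = second_diff a h u"
  obtains u1 where "\<And>t. (u has_vector_derivative u1 t) (at t)" "\<And>t. (u1 has_vector_derivative f t) (at t)"
proof -
  obtain w1 where w1: "primitive w1 f" "\<And>t. (w1 has_vector_derivative f t) (at t)"
    using continuous_primitive[OF f] by blast
  obtain w where w: "primitive w w1" "\<And>t. (w has_vector_derivative w1 t) (at t)"
    using continuous_primitive[OF primitive_continuous[OF w1(1)]] by blast
  have wc: "continuous_on UNIV w" by (rule primitive_continuous[OF w(1)])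
  have weq: "(LBINT t:{a-h..a+h}. hat a h t *\<^sub>R f t) = second_diff a h w" if h: "0 < h" for a h
  proof -
    have i: "set_integrable lborel {a-h..a+h} (\<lambda>t. hat a h t *\<^sub>R f t)"
      by (intro set_integrable_continuous_scaleR set_integrable_continuous continuous_hat f)
    have "(LBINT t:{a-h..a+h}. hat a h t *\<^sub>R f t) \<bullet> e = second_diff a h w \<bullet> e" for e
    proof -
      have "primitive (\<lambda>t. hat a h t *\<^sub>R e) (\<lambda>t. hat' a h t *\<^sub>R e)"
        by (rule primitive_bounded_linear[OF primitive_hat bounded_linear_scaleR_left])
      from primitive_by_parts[OF w1(1) this, of "a-h" "a+h"]
      have "(LBINT t:{a-h..a+h}. hat' a h t * (e \<bullet> w1 t)) + (LBINT t:{a-h..a+h}. hat a h t * (e \<bullet> f t)) = 0"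
        using h by (simp add: hat_eq)
      moreover have "(LBINT t:{a-h..a+h}. hat' a h t * (e \<bullet> w1 t)) = - (second_diff a h w \<bullet> e)"
        unfolding hat'_pairing(2)[OF w(1) h, of a e, symmetric]
        by (subst lborel_integral_Icc[symmetric]) (use h in \<open>auto simp: hat'_eq inner_commute\<close>)
      ultimately show ?thesis
        unfolding set_integral_inner_left[OF i] by (simp add: inner_commute)
    qed
    then show ?thesis by (rule vector_eq_rdot[THEN iffD1, OF allI])
  qed
  obtain k where k: "\<And>t. ((\<lambda>t. u t - w t) has_vector_derivative k) (at t)"
  proof (rule midpoint_affine)
    fix k assume "\<And>t. ((\<lambda>t. u t - w t) has_vector_derivative k) (at t)"
    then show thesis by (rule that)
  next
    show "continuous_on UNIV (\<lambda>t. u t - w t)" by (intro continuous_intros u wc)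
    show "second_diff a h (\<lambda>t. u t - w t) = 0" if "0 < h" "h \<le> 1" for a h
      using eq[OF that, of a] weq[OF that(1), of a] by (simp add: second_diff_def algebra_simps)
  qed
  show ?thesis
  proof (rule that[of "\<lambda>t. k + w1 t"])
    show "(u has_vector_derivative k + w1 t) (at t)" for t
      using has_vector_derivative_add[OF k w(2)] by simp
    show "((\<lambda>t. k + w1 t) has_vector_derivative f t) (at t)" for t
      using has_vector_derivative_add[OF has_vector_derivative_const w1(2)] by simp
  qed
qed

section \<open>Local compactness and lower semicontinuity\<close>

text \<open>Ascoli's argument in pointwise form: a diagonal subsequence converges on the rationals,
  and the common modulus carries the Cauchy property from a nearby rational to every time.\<close>

lemma equicontinuous_subsequence:
  fixes q :: "nat \<Rightarrow> real \<Rightarrow> 'a::euclidean_space"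
  assumes bd: "\<And>n t. norm (q n t) \<le> R" and mod: "\<And>n s t. norm (q n t - q n s) \<le> sqrt (B * \<bar>t - s\<bar>)"
  obtains r u where "strict_mono (r :: nat \<Rightarrow> nat)" "\<And>t. (\<lambda>n. q (r n) t) \<longlonglongrightarrow> u t"
    "continuous_on UNIV u" "\<And>t. norm (u t) \<le> R"
proof -
  obtain r where r: "strict_mono (r :: nat \<Rightarrow> nat)" "\<And>x. x \<in> \<rat> \<Longrightarrow> \<exists>l. (\<lambda>n. q (r n) x) \<longlonglongrightarrow> l"
    using function_convergent_subsequence[of "\<rat> :: real set" q R] countable_rat bd by blast
  have "\<exists>l. (\<lambda>n. q (r n) t) \<longlonglongrightarrow> l" for t
  proof -
    have "Cauchy (\<lambda>n. q (r n) t)"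
    proof (rule metric_CauchyI)
      fix e :: real assume e: "e > 0"
      define d where "d = (e/3)\<^sup>2 / (\<bar>B\<bar> + 1)"
      have d: "d > 0" using e by (simp add: d_def)
      obtain x where x: "x \<in> \<rat>" "t < x" "x < t + d" using Rats_dense_in_real[of t "t + d"] d by auto
      have close: "norm (q n t - q n x) < e / 3" for n
      proof -
        have "B * \<bar>t - x\<bar> \<le> (\<bar>B\<bar> + 1) * \<bar>t - x\<bar>" by (intro mult_right_mono) auto
        also have "\<dots> < (\<bar>B\<bar> + 1) * d" using x by (intro mult_strict_left_mono) auto
        also have "\<dots> = (e/3)\<^sup>2" by (simp add: d_def)
        finally have "sqrt (B * \<bar>t - x\<bar>) < e / 3" using e by (intro real_less_lsqrt) auto
        then show ?thesis using mod[of n t x] by simp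
      qed
      have "Cauchy (\<lambda>n. q (r n) x)" using r(2)[OF x(1)] convergent_Cauchy by (auto simp: convergent_def)
      then obtain M where M: "\<And>m n. m \<ge> M \<Longrightarrow> n \<ge> M \<Longrightarrow> dist (q (r m) x) (q (r n) x) < e / 3"
        using e by (metis Cauchy_def divide_pos_pos zero_less_numeral)
      have "dist (q (r m) t) (q (r n) t) < e" if "m \<ge> M" "n \<ge> M" for m n
      proof -
        have "dist (q (r m) t) (q (r n) t) \<le> dist (q (r m) t) (q (r m) x) + dist (q (r m) x) (q (r n) x) + dist (q (r n) x) (q (r n) t)"
          by (meson add_mono dist_triangle order_refl order_trans)
        then show ?thesis using M[OF that] close[of "r m"] close[of "r n"] by (simp add: dist_norm norm_minus_commute)
      qed
      then show "\<exists>M. \<forall>m\<ge>M. \<forall>n\<ge>M. dist (q (r m) t) (q (r n) t) < e" by blast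
    qed
    then show ?thesis by (simp add: Cauchy_convergent_iff convergent_def)
  qed
  then obtain u where u: "\<And>t. (\<lambda>n. q (r n) t) \<longlonglongrightarrow> u t" by metis
  have "norm (u t - u s) \<le> sqrt (B * \<bar>t - s\<bar>)" for s t
    by (rule LIMSEQ_le_const2[OF tendsto_norm[OF tendsto_diff[OF u u]]]) (use mod in auto)
  then have "continuous_on UNIV u"
    by (intro uniformly_continuous_imp_continuous sqrt_modulus_uniformly_continuous)
  moreover have "norm (u t) \<le> R" for t
    by (rule LIMSEQ_le_const2[OF tendsto_norm[OF u]]) (use bd in auto)
  ultimately show ?thesis using that r(1) u by blast
qed

lemma set_integral_tendsto_bounded:
  fixes s :: "nat \<Rightarrow> real \<Rightarrow> 'a::euclidean_space"
  assumes s: "\<And>n. continuous_on UNIV (s n)" and f: "continuous_on UNIV f"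
    and lim: "\<And>t. (\<lambda>n. s n t) \<longlonglongrightarrow> f t" and bd: "\<And>n t. t \<in> {a..b} \<Longrightarrow> norm (s n t) \<le> B"
  shows "(\<lambda>n. LBINT t:{a..b}. s n t) \<longlonglongrightarrow> (LBINT t:{a..b}. f t)"
  unfolding set_lebesgue_integral_def
proof (rule integral_dominated_convergence)
  have [measurable]: "s n \<in> borel_measurable borel" "f \<in> borel_measurable borel" for n
    using s f by (auto intro: borel_measurable_continuous_onI)
  show "(\<lambda>t. indicat_real {a..b} t *\<^sub>R f t) \<in> borel_measurable lborel" by measurable
  show "(\<lambda>t. indicat_real {a..b} t *\<^sub>R s n t) \<in> borel_measurable lborel" for n by measurable
  show "integrable lborel (\<lambda>t. \<bar>B\<bar> * indicator {a..b} t)"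
    by (intro integrable_mult_right) (auto simp: emeasure_lborel_Icc_eq)
  show "AE t in lborel. (\<lambda>n. indicat_real {a..b} t *\<^sub>R s n t) \<longlonglongrightarrow> indicat_real {a..b} t *\<^sub>R f t"
    by (intro AE_I2 tendsto_intros lim)
  show "AE t in lborel. norm (indicat_real {a..b} t *\<^sub>R s n t) \<le> \<bar>B\<bar> * indicator {a..b} t" for n
    using bd[of _ n] by (intro AE_I2) (fastforce simp: indicator_def)
qed

text \<open>The derivatives of \<open>q n\<close> need not converge in any sense known here. The
  kinetic term is therefore bounded below by its linearization at the limit velocity,
  \<open>u1 t \<bullet> ?p n t - 1/2 * (u1 t \<bullet> u1 t)\<close>, and integration by parts moves
  the derivative onto the smooth \<open>u1\<close>. What is left converges under pointwise
  convergence; bounded windows then exhaust the line.\<close>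

lemma energy_lower_semicontinuous:
  fixes V :: "real ^ 'n \<Rightarrow> real" and q :: "nat \<Rightarrow> real \<Rightarrow> real ^ 'n"
  assumes V: "continuous_on UNIV V" "\<And>u. V u \<ge> 0"
    and q: "\<And>n. q n \<in> H1loc" "\<And>n. energy V (q n) \<le> ennreal (c + d n)" "\<And>n. c + d n \<ge> 0" "d \<longlonglongrightarrow> 0"
    and bd: "\<And>n t. norm (q n t) \<le> R" and lim: "\<And>t. (\<lambda>n. q n t) \<longlonglongrightarrow> u t"
    and u: "\<And>t. (u has_vector_derivative u1 t) (at t)" "\<And>t. (u1 has_vector_derivative f t) (at t)"
      "continuous_on UNIV f"
  shows "energy V u \<le> ennreal c"
proof -
  have prim: "primitive u1 f" by (rule primitive_C1[OF u(2,3)])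
  have u1c: "continuous_on UNIV u1" by (rule primitive_continuous[OF prim])
  have prim': "primitive u u1" by (rule primitive_C1[OF u(1) u1c])
  have uc: "continuous_on UNIV u" by (rule primitive_continuous[OF prim'])
  have Vu: "continuous_on UNIV (\<lambda>t. V (u t))" using continuous_on_compose2[OF V(1) uc] by auto
  have Vq: "continuous_on UNIV (\<lambda>t. V (q n t))" for n using continuous_on_compose2[OF V(1) H1locD(3)[OF q(1)]] by auto
  let ?p = "\<lambda>n. weak_derivative (q n)"
  have win: "(LBINT t:{-T..T}. 1/2 * (norm (u1 t))\<^sup>2 + V (u t)) \<le> c" if T: "T \<ge> 0" for T
  proof -
    have TT: "-T \<le> T" using T by simp
    have ik: "set_integrable lborel {-T..T} (\<lambda>t. u1 t \<bullet> u1 t)" "set_integrable lborel {-T..T} (\<lambda>t. V (u t))"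
      "set_integrable lborel {-T..T} (\<lambda>t. V (q n t))" for n
      by (intro set_integrable_continuous continuous_intros u1c Vu Vq)+
    have lower: "(u1 T \<bullet> q n T - u1 (-T) \<bullet> q n (-T) - (LBINT t:{-T..T}. f t \<bullet> q n t))
        - 1/2 * (LBINT t:{-T..T}. u1 t \<bullet> u1 t) + (LBINT t:{-T..T}. V (q n t)) \<le> c + d n" for n
    proof -
      note k = kinetic_le_energy[OF q(1)[of n] q(2,3)[of n] V]
      have ip: "set_integrable lborel {-T..T} (\<lambda>t. u1 t \<bullet> ?p n t)"
        by (rule set_integrable_continuous_inner[OF u1c primitiveD(2)[OF H1locD(2)[OF q(1)]]])
      have ie: "integrable lborel (\<lambda>t. 1/2 * (norm (?p n t))\<^sup>2 + V (q n t))"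
        using k by (intro Bochner_Integration.integrable_add) simp_all
      have "(LBINT t:{-T..T}. u1 t \<bullet> ?p n t) = u1 T \<bullet> q n T - u1 (-T) \<bullet> q n (-T) - (LBINT t:{-T..T}. f t \<bullet> q n t)"
        using primitive_by_parts[OF H1locD(2)[OF q(1)] prim TT, of n] by simp
      then have "(u1 T \<bullet> q n T - u1 (-T) \<bullet> q n (-T) - (LBINT t:{-T..T}. f t \<bullet> q n t))
        - 1/2 * (LBINT t:{-T..T}. u1 t \<bullet> u1 t) + (LBINT t:{-T..T}. V (q n t))
        = (LBINT t:{-T..T}. u1 t \<bullet> ?p n t - 1/2 * (u1 t \<bullet> u1 t) + V (q n t))"
        using ip ik by (subst set_integral_add, simp, simp, subst set_integral_diff) auto
      also have "\<dots> \<le> (LBINT t:{-T..T}. 1/2 * (norm (?p n t))\<^sup>2 + V (q n t))"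
      proof (rule set_integral_mono)
        show "set_integrable lborel {-T..T} (\<lambda>t. u1 t \<bullet> ?p n t - 1/2 * (u1 t \<bullet> u1 t) + V (q n t))"
          using ip ik by (intro set_integral_add set_integral_diff) auto
        show "set_integrable lborel {-T..T} (\<lambda>t. 1/2 * (norm (?p n t))\<^sup>2 + V (q n t))"
          by (rule set_integral_le_integral(1)[OF ie]) (use V in auto)
        fix t
        have "0 \<le> (norm (?p n t - u1 t))\<^sup>2" by simp
        then show "u1 t \<bullet> ?p n t - 1/2 * (u1 t \<bullet> u1 t) + V (q n t) \<le> 1/2 * (norm (?p n t))\<^sup>2 + V (q n t)"
          unfolding power2_norm_eq_inner by (simp add: inner_diff_left inner_diff_right inner_commute)
      qed
      also have "\<dots> \<le> (LBINT t. 1/2 * (norm (?p n t))\<^sup>2 + V (q n t))"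
        by (rule set_integral_le_integral(2)[OF ie]) (use V in auto)
      also have "\<dots> \<le> c + d n"
      proof -
        have "energy V (q n) < \<infinity>" using q(2)[of n] by (metis ennreal_less_top infinity_ennreal_def order_le_less_trans)
        from finite_energy_integrable(3)[OF q(1) this V] show ?thesis
          using q(2,3)[of n] by (simp add: ennreal_le_iff)
      qed
      finally show ?thesis .
    qed
    have l1: "(\<lambda>n. LBINT t:{-T..T}. f t \<bullet> q n t) \<longlonglongrightarrow> (LBINT t:{-T..T}. f t \<bullet> u t)"
    proof -
      have "bounded (f ` {-T..T})"
        using u(3) by (intro compact_imp_bounded compact_continuous_image) (auto intro: continuous_on_subset)
      then obtain B where B: "\<And>t. t \<in> {-T..T} \<Longrightarrow> norm (f t) \<le> B" unfolding bounded_iff by (metis imageI)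
      show ?thesis
      proof (rule set_integral_tendsto_bounded)
        show "continuous_on UNIV (\<lambda>t. f t \<bullet> q n t)" "continuous_on UNIV (\<lambda>t. f t \<bullet> u t)" for n
          by (intro continuous_intros u uc H1locD(3)[OF q(1)])+
        show "(\<lambda>n. f t \<bullet> q n t) \<longlonglongrightarrow> f t \<bullet> u t" for t by (intro tendsto_intros lim)
        show "norm (f t \<bullet> q n t) \<le> B * R" if "t \<in> {-T..T}" for n t
        proof -
          have "norm (f t \<bullet> q n t) \<le> norm (f t) * norm (q n t)" using Cauchy_Schwarz_ineq2 by simp
          also have "\<dots> \<le> B * R"
            using B[OF that] bd[of n t] by (intro mult_mono order_trans[OF norm_ge_zero B[OF that]]) auto
          finally show ?thesis .
        qed
      qed
    qed
    have l2: "(\<lambda>n. LBINT t:{-T..T}. V (q n t)) \<longlonglongrightarrow> (LBINT t:{-T..T}. V (u t))"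
    proof -
      have "bounded (V ` cball 0 R)"
        using V(1) by (intro compact_imp_bounded compact_continuous_image) (auto intro: continuous_on_subset)
      then obtain B where B: "\<And>t. t \<in> cball 0 R \<Longrightarrow> norm (V t) \<le> B" unfolding bounded_iff by (metis imageI)
      show ?thesis
      proof (rule set_integral_tendsto_bounded[OF Vq Vu])
        have "isCont V x" for x using V(1) by (simp add: continuous_on_eq_continuous_at)
        then show "(\<lambda>n. V (q n t)) \<longlonglongrightarrow> V (u t)" for t
          by (rule isCont_tendsto_compose) (rule lim)
        show "norm (V (q n t)) \<le> B" for n t using B[of "q n t"] bd[of n t] by simp
      qed
    qed
    have "(\<lambda>n. (u1 T \<bullet> q n T - u1 (-T) \<bullet> q n (-T) - (LBINT t:{-T..T}. f t \<bullet> q n t))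
        - 1/2 * (LBINT t:{-T..T}. u1 t \<bullet> u1 t) + (LBINT t:{-T..T}. V (q n t)))
       \<longlonglongrightarrow> (u1 T \<bullet> u T - u1 (-T) \<bullet> u (-T) - (LBINT t:{-T..T}. f t \<bullet> u t))
        - 1/2 * (LBINT t:{-T..T}. u1 t \<bullet> u1 t) + (LBINT t:{-T..T}. V (u t))"
      by (intro tendsto_intros l1 l2 lim)
    moreover have "(\<lambda>n. c + d n) \<longlonglongrightarrow> c + 0" by (intro tendsto_intros q)
    ultimately have le: "(u1 T \<bullet> u T - u1 (-T) \<bullet> u (-T) - (LBINT t:{-T..T}. f t \<bullet> u t))
        - 1/2 * (LBINT t:{-T..T}. u1 t \<bullet> u1 t) + (LBINT t:{-T..T}. V (u t)) \<le> c + 0"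
      by (rule LIMSEQ_le) (use lower in auto)
    \<comment> \<open>The same integration by parts for \<open>u\<close> itself returns the limit of
      the linear terms to the kinetic integral, so the linearization loses nothing in the
      limit.\<close>
    have "(LBINT t:{-T..T}. u1 t \<bullet> u1 t) = u1 T \<bullet> u T - u1 (-T) \<bullet> u (-T) - (LBINT t:{-T..T}. f t \<bullet> u t)"
      using primitive_by_parts[OF prim' prim TT] by simp
    then have "1/2 * (LBINT t:{-T..T}. u1 t \<bullet> u1 t) + (LBINT t:{-T..T}. V (u t)) \<le> c"
      using le by linarith
    then show ?thesis
      unfolding power2_norm_eq_inner using ik by (subst set_integral_add) auto
  qed
  let ?e = "\<lambda>t. 1/2 * (norm (u1 t))\<^sup>2 + V (u t)"
  have ec: "continuous_on UNIV ?e" by (intro continuous_intros u1c Vu)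
  have e0: "?e t \<ge> 0" for t using V by simp
  have em [measurable]: "?e \<in> borel_measurable borel" by (rule borel_measurable_continuous_onI[OF ec])
  have "energy V u = (\<integral>\<^sup>+t. ennreal (?e t) \<partial>lborel)"
    by (rule energy_primitive[OF prim' L2loc_continuous[OF u1c]])
  also have "\<dots> = (\<integral>\<^sup>+t. (SUP n. ennreal (?e t) * indicator {- real n..real n} t) \<partial>lborel)"
  proof (rule nn_integral_cong)
    fix t
    obtain n where "\<bar>t\<bar> \<le> real n" using real_arch_simple by blast
    then have n: "ennreal (?e t) * indicator {- real n..real n} t = ennreal (?e t)" by (auto simp: indicator_def)
    show "ennreal (?e t) = (SUP n. ennreal (?e t) * indicator {- real n..real n} t)"
    proof (rule antisym)
      show "ennreal (?e t) \<le> (SUP n. ennreal (?e t) * indicator {- real n..real n} t)"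
        by (rule SUP_upper2[of n]) (use n in simp_all)
      show "(SUP n. ennreal (?e t) * indicator {- real n..real n} t) \<le> ennreal (?e t)"
        by (rule SUP_least) (auto simp: indicator_def)
    qed
  qed
  also have "\<dots> = (SUP n. \<integral>\<^sup>+t. ennreal (?e t) * indicator {- real n..real n} t \<partial>lborel)"
  proof (rule nn_integral_monotone_convergence_SUP)
    show "incseq (\<lambda>n t. ennreal (?e t) * indicator {- real n..real n} t)"
      by (auto simp: incseq_def le_fun_def indicator_def)
  qed measurable
  also have "\<dots> \<le> ennreal c"
  proof (rule SUP_least)
    fix n :: nat
    have i: "integrable lborel (\<lambda>t. indicator {- real n..real n} t *\<^sub>R ?e t)"
      using set_integrable_continuous[OF ec] by (simp add: set_integrable_def)
    have "(\<integral>\<^sup>+t. ennreal (?e t) * indicator {- real n..real n} t \<partial>lborel) = (\<integral>\<^sup>+t. ennreal (indicator {- real n..real n} t *\<^sub>R ?e t) \<partial>lborel)"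
      by (intro nn_integral_cong) (auto simp: indicator_def)
    also have "\<dots> = ennreal (LBINT t:{- real n..real n}. ?e t)"
      unfolding set_lebesgue_integral_def by (rule nn_integral_eq_integral[OF i]) (use e0 in \<open>auto simp: indicator_def\<close>)
    also have "\<dots> \<le> ennreal c" by (rule ennreal_leI[OF win]) simp
    finally show "(\<integral>\<^sup>+t. ennreal (?e t) * indicator {- real n..real n} t \<partial>lborel) \<le> ennreal c" .
  qed
  finally show ?thesis .
qed

section \<open>Critical curves and stability of the residual\<close>

definition critical_curve :: "(real ^ 'n \<Rightarrow> real) \<Rightarrow> (real \<Rightarrow> real ^ 'n) \<Rightarrow> bool" where
  "critical_curve V u \<longleftrightarrow> (\<exists>u1. (\<forall>t. (u has_vector_derivative u1 t) (at t)) \<and>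
     (\<forall>t. (u1 has_vector_derivative grad V (u t)) (at t)))"

lemma critical_curveD:
  fixes V :: "real ^ 'n \<Rightarrow> real"
  assumes u: "critical_curve V u" and V: "C2_function V"
  shows "C2_curve u" "u \<in> H1loc"
    "vector_derivative (\<lambda>s. vector_derivative u (at s)) (at t) = grad V (u t)"
proof -
  obtain u1 where u1: "\<And>t. (u has_vector_derivative u1 t) (at t)"
    "\<And>t. (u1 has_vector_derivative grad V (u t)) (at t)"
    using u unfolding critical_curve_def by blast
  have uc: "continuous_on UNIV u" "continuous_on UNIV u1"
    using u1 by (auto intro!: continuous_at_imp_continuous_on has_vector_derivative_continuous)
  have gc: "continuous_on UNIV (\<lambda>t. grad V (u t))"
    using continuous_on_compose2[OF C2_function_grad(3)[OF V] uc(1)] by auto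
  have vd: "(\<lambda>s. vector_derivative u (at s)) = u1"
    using u1(1) by (intro ext vector_derivative_at)
  show "vector_derivative (\<lambda>s. vector_derivative u (at s)) (at t) = grad V (u t)"
    unfolding vd by (rule vector_derivative_at[OF u1(2)])
  show "C2_curve u"
    unfolding C2_curve_def vd C1_differentiable_on_def
    by (rule conjI; intro exI conjI ballI) (rule u1 uc gc)+
  show "u \<in> H1loc"
    unfolding H1loc_iff using primitive_C1[OF u1(1) uc(2)] L2loc_continuous[OF uc(2)] by blast
qed

lemma critical_curve_reflect:
  assumes "critical_curve V u"
  shows "critical_curve V (\<lambda>t. u (- t))"
proof -
  obtain u1 where u1: "\<And>t. (u has_vector_derivative u1 t) (at t)"
    "\<And>t. (u1 has_vector_derivative grad V (u t)) (at t)"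
    using assms unfolding critical_curve_def by blast
  have "((\<lambda>t. u (- t)) has_vector_derivative - u1 (- t)) (at t)" for t
    using has_vector_derivative_reflect[of u "u1 (- t)" 0 t] u1(1) by simp
  moreover have "((\<lambda>t. - u1 (- t)) has_vector_derivative grad V (u (- t))) (at t)" for t
    using has_vector_derivative_minus[OF has_vector_derivative_reflect[of u1 "grad V (u (- t))" 0 t]] u1(2) by simp
  ultimately show ?thesis unfolding critical_curve_def by (intro exI[of _ "\<lambda>t. - u1 (- t)"]) auto
qed

lemma residual_shift:
  fixes V :: "real ^ 'n \<Rightarrow> real"
  shows "residual V a h (\<lambda>t. q (t + c)) = residual V (a + c) h q"
proof -
  have eq: "indicator {a+c-h..a+c+h} (c + 1 * t) *\<^sub>R (hat (a + c) h (c + 1 * t) *\<^sub>R grad V (q (c + 1 * t)))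
      = indicator {a-h..a+h} t *\<^sub>R (hat a h t *\<^sub>R grad V (q (t + c)))" for t
    by (auto simp: indicator_def hat_def algebra_simps)
  have "(LBINT t:{a-h..a+h}. hat a h t *\<^sub>R grad V (q (t + c)))
      = (LBINT t:{a+c-h..a+c+h}. hat (a + c) h t *\<^sub>R grad V (q t))"
    using lborel_integral_real_affine[of 1 "\<lambda>t. indicator {a+c-h..a+c+h} t *\<^sub>R (hat (a + c) h t *\<^sub>R grad V (q t))" c]
    unfolding eq set_lebesgue_integral_def by simp
  then show ?thesis by (simp add: residual_def second_diff_def algebra_simps)
qed

text \<open>The residual is Lipschitz in the uniform distance, with a constant independent of
  position and width: 4 is the sum of the weights 1, 2, 1 of the second difference, and
  \<open>C\<close> is multiplied by the tent mass \<open>h\<^sup>2\<close>, at most 1. One descent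
  direction therefore serves a whole neighbourhood of curves.\<close>

lemma residual_diff_le:
  fixes V :: "real ^ 'n \<Rightarrow> real"
  assumes V: "C2_function V"
    and C: "C \<ge> 0" "\<And>x y. norm x \<le> R \<Longrightarrow> norm y \<le> R \<Longrightarrow> norm (grad V y - grad V x) \<le> C * norm (y - x)"
    and q: "continuous_on UNIV q" "\<And>t. norm (q t) \<le> R" and f: "continuous_on UNIV f" "\<And>t. norm (f t) \<le> R"
    and close: "\<And>t. norm (f t - q t) \<le> \<eta>" and h: "0 < h" "h \<le> 1"
  shows "norm (residual V a h f - residual V a h q) \<le> (4 + C) * \<eta>"
proof -
  have \<eta>: "\<eta> \<ge> 0" using close[of 0] norm_ge_zero order_trans by blast
  have gc: "continuous_on UNIV (\<lambda>t. grad V (q t))" "continuous_on UNIV (\<lambda>t. grad V (f t))"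
    using continuous_on_compose2[OF C2_function_grad(3)[OF V]] q(1) f(1) by auto
  have i: "set_integrable lborel {a-h..a+h} (\<lambda>t. hat a h t *\<^sub>R grad V (q t))"
    "set_integrable lborel {a-h..a+h} (\<lambda>t. hat a h t *\<^sub>R grad V (f t))"
    by (intro set_integrable_continuous continuous_intros gc)+
  have eq: "residual V a h f - residual V a h q = (LBINT t:{a-h..a+h}. hat a h t *\<^sub>R grad V (f t) - hat a h t *\<^sub>R grad V (q t))
      - (second_diff a h f - second_diff a h q)"
    unfolding residual_def set_integral_diff(2)[OF i(2,1)] by simp
  have 1: "norm (LBINT t:{a-h..a+h}. hat a h t *\<^sub>R grad V (f t) - hat a h t *\<^sub>R grad V (q t)) \<le> C * \<eta>"
  proof -
    have "norm (LBINT t:{a-h..a+h}. hat a h t *\<^sub>R grad V (f t) - hat a h t *\<^sub>R grad V (q t))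
        \<le> (LBINT t:{a-h..a+h}. norm (hat a h t *\<^sub>R grad V (f t) - hat a h t *\<^sub>R grad V (q t)))"
      by (rule set_integral_norm_bound[OF set_integral_diff(1)[OF i(2,1)]])
    also have "\<dots> \<le> (LBINT t:{a-h..a+h}. hat a h t * (C * \<eta>))"
    proof (rule set_integral_mono)
      show "set_integrable lborel {a-h..a+h} (\<lambda>t. norm (hat a h t *\<^sub>R grad V (f t) - hat a h t *\<^sub>R grad V (q t)))"
        "set_integrable lborel {a-h..a+h} (\<lambda>t. hat a h t * (C * \<eta>))"
        by (intro set_integrable_continuous continuous_intros gc)+
      fix t
      have "norm (hat a h t *\<^sub>R grad V (f t) - hat a h t *\<^sub>R grad V (q t)) = hat a h t * norm (grad V (f t) - grad V (q t))"
        using hat_nonneg[OF h(1), of a t] by (simp flip: scaleR_diff_right)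
      also have "\<dots> \<le> hat a h t * (C * \<eta>)"
        using hat_nonneg[OF h(1), of a t] C(1)
        by (intro mult_left_mono order_trans[OF C(2)[OF q(2) f(2)]] close)
      finally show "norm (hat a h t *\<^sub>R grad V (f t) - hat a h t *\<^sub>R grad V (q t)) \<le> hat a h t * (C * \<eta>)" .
    qed
    also have "\<dots> = h\<^sup>2 * (C * \<eta>)" using hat_integral(2)[OF h(1), of a] by simp
    also have "\<dots> \<le> C * \<eta>" using h C(1) \<eta> by (intro mult_left_le_one_le) (auto simp: power_le_one)
    finally show ?thesis .
  qed
  have "second_diff a h f - second_diff a h q = (f (a+h) - q (a+h)) - 2 *\<^sub>R (f a - q a) + (f (a-h) - q (a-h))"
    by (simp add: second_diff_def algebra_simps)
  also have "norm \<dots> \<le> norm (f (a+h) - q (a+h)) + 2 * norm (f a - q a) + norm (f (a-h) - q (a-h))"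
    by (rule order_trans[OF norm_triangle_ineq add_right_mono[OF order_trans[OF norm_triangle_ineq4]]]) simp
  also have "\<dots> \<le> 4 * \<eta>" using close[of "a+h"] close[of a] close[of "a-h"] by linarith
  finally have 2: "norm (second_diff a h f - second_diff a h q) \<le> 4 * \<eta>" .
  show ?thesis
    unfolding eq using norm_triangle_ineq4[of "LBINT t:{a-h..a+h}. hat a h t *\<^sub>R grad V (f t) - hat a h t *\<^sub>R grad V (q t)"
        "second_diff a h f - second_diff a h q"] 1 2
    by (simp add: distrib_right)
qed

text \<open>Only local convergence is needed: splitting of the sequence at infinity is harmless, since the
  local limit already carries the point in \<open>K\<close>, and a limit well other than \<open>a\<close>, \<open>b\<close> would cost
  at least \<open>m_star\<close>.\<close>

lemma almost_critical_limit:
  fixes V :: "real ^ 'n \<Rightarrow> real"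
  assumes V: "C2_function V" "\<And>u. V u \<ge> 0" "\<And>u. V u = 0 \<longleftrightarrow> u \<in> \<Sigma>" and fin: "finite \<Sigma>"
    and b: "\<beta> > 0" "\<And>u. norm u \<ge> R0 \<Longrightarrow> V u \<ge> \<beta>"
    and q: "\<And>n. q n \<in> connecting V a b" "\<And>n. energy V (q n) \<le> ennreal (c + 1 / real (Suc n))" "c \<ge> 0"
    and res: "\<And>n x h. 0 < h \<Longrightarrow> h \<le> 1 \<Longrightarrow> norm (residual V x h (q n)) \<le> 1 / real (Suc n)"
    and K: "closed K" "\<And>n. y n \<in> K" "\<And>n. dist (q n 0) (y n) \<le> 1 / real (Suc n)"
    and m: "ennreal c < m_star V \<Sigma> a b"
  shows "\<exists>u. critical_curve V u \<and> energy V u \<le> ennreal c \<and> u 0 \<in> K \<and>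
    (\<exists>\<sigma>\<in>{a, b}. (u \<longlongrightarrow> \<sigma>) at_bot) \<and> (\<exists>\<sigma>\<in>{a, b}. (u \<longlongrightarrow> \<sigma>) at_top)"
proof -
  have Vc: "continuous_on UNIV V" and gc: "continuous_on UNIV (grad V)"
    using C2_function_grad[OF V(1)] by auto
  have qH: "q n \<in> H1loc" for n using q(1)[of n] by (simp add: connecting_def)
  \<comment> \<open>As \<open>1 / real (Suc n) \<le> 1\<close>, the single level
    \<open>c + 1\<close> bounds all energies and gives a common sup bound and a common modulus of
    continuity.\<close>
  have E: "energy V (q n) \<le> ennreal (c + 1)" for n
    by (rule order_trans[OF q(2)]) (intro ennreal_leI add_left_mono, simp)
  have c1: "c + 1 \<ge> 0" using q(3) by simp
  define R where "R = R0 + sqrt (2 * (c + 1) * ((c + 1) / \<beta> + 1))"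
  have bd: "norm (q n t) \<le> R" for n t
    unfolding R_def by (rule energy_sup_bound[OF qH E c1 Vc V(2) b])
  have mod: "norm (q n t - q n s) \<le> sqrt ((2 * (c + 1)) * \<bar>t - s\<bar>)" for n s t
  proof -
    note k = kinetic_le_energy[OF qH E c1 Vc V(2)]
    show ?thesis by (rule primitive_holder_abs[OF H1locD(2)[OF qH] k(3,1)])
  qed
  obtain r u where r: "strict_mono (r :: nat \<Rightarrow> nat)" and lim: "\<And>t. (\<lambda>n. q (r n) t) \<longlonglongrightarrow> u t"
    and uc: "continuous_on UNIV u" and ubd: "\<And>t. norm (u t) \<le> R"
    by (rule equicontinuous_subsequence[OF bd mod]) (rule that)
  have inv0: "(\<lambda>n. 1 / real (Suc (r n))) \<longlonglongrightarrow> 0"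
    using LIMSEQ_subseq_LIMSEQ[OF LIMSEQ_Suc[OF lim_1_over_n] r] by (simp add: o_def)
  define f where "f t = grad V (u t)" for t
  have fc: "continuous_on UNIV f"
    unfolding f_def using continuous_on_compose2[OF gc uc] by auto
  have gqc: "continuous_on UNIV (\<lambda>t. grad V (q n t))" for n
    using continuous_on_compose2[OF gc H1locD(3)[OF qH]] by auto
  have "bounded (grad V ` cball 0 R)"
    using gc by (intro compact_imp_bounded compact_continuous_image) (auto intro: continuous_on_subset)
  then obtain G where G: "\<And>x. x \<in> cball 0 R \<Longrightarrow> norm (grad V x) \<le> G" unfolding bounded_iff by (metis imageI)
  have eq: "(LBINT t:{x-h..x+h}. hat x h t *\<^sub>R f t) = second_diff x h u" if h: "0 < h" "h \<le> 1" for x h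
  proof -
    have "(\<lambda>n. LBINT t:{x-h..x+h}. hat x h t *\<^sub>R grad V (q (r n) t)) \<longlonglongrightarrow> (LBINT t:{x-h..x+h}. hat x h t *\<^sub>R f t)"
    proof (rule set_integral_tendsto_bounded)
      show "continuous_on UNIV (\<lambda>t. hat x h t *\<^sub>R grad V (q (r n) t))" "continuous_on UNIV (\<lambda>t. hat x h t *\<^sub>R f t)" for n
        by (intro continuous_intros fc gqc)+
      have "isCont (grad V) x" for x using gc by (simp add: continuous_on_eq_continuous_at)
      then show "(\<lambda>n. hat x h t *\<^sub>R grad V (q (r n) t)) \<longlonglongrightarrow> hat x h t *\<^sub>R f t" for t
        unfolding f_def by (intro tendsto_scaleR tendsto_const isCont_tendsto_compose[OF _ lim])
      show "norm (hat x h t *\<^sub>R grad V (q (r n) t)) \<le> G" for n t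
      proof -
        have g: "norm (grad V (q (r n) t)) \<le> G" using G bd by simp
        have "\<bar>hat x h t\<bar> \<le> 1" using hat_nonneg[OF h(1), of x t] hat_le[OF h(1), of x t] h by simp
        then have "norm (hat x h t *\<^sub>R grad V (q (r n) t)) \<le> 1 * norm (grad V (q (r n) t))"
          unfolding norm_scaleR by (intro mult_right_mono) auto
        then show ?thesis using g by simp
      qed
    qed
    moreover have "(\<lambda>n. second_diff x h (q (r n))) \<longlonglongrightarrow> second_diff x h u"
      unfolding second_diff_def by (intro tendsto_intros lim)
    ultimately have "(\<lambda>n. residual V x h (q (r n))) \<longlonglongrightarrow> (LBINT t:{x-h..x+h}. hat x h t *\<^sub>R f t) - second_diff x h u"
      unfolding residual_def by (rule tendsto_diff)
    moreover have "(\<lambda>n. residual V x h (q (r n))) \<longlonglongrightarrow> 0"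
    proof (rule tendsto_norm_zero_cancel, rule tendsto_sandwich[OF _ _ tendsto_const inv0])
      show "\<forall>\<^sub>F n in sequentially. 0 \<le> norm (residual V x h (q (r n)))" by simp
      show "\<forall>\<^sub>F n in sequentially. norm (residual V x h (q (r n))) \<le> 1 / real (Suc (r n))"
        using res[OF h] by simp
    qed
    ultimately have "(LBINT t:{x-h..x+h}. hat x h t *\<^sub>R f t) - second_diff x h u = 0"
      by (rule LIMSEQ_unique)
    then show ?thesis by simp
  qed
  obtain u1 where u1: "\<And>t. (u has_vector_derivative u1 t) (at t)" "\<And>t. (u1 has_vector_derivative f t) (at t)"
  proof (rule second_difference_C2[OF uc fc eq])
    fix u1 assume "\<And>t. (u has_vector_derivative u1 t) (at t)" "\<And>t. (u1 has_vector_derivative f t) (at t)"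
    then show thesis by (rule that)
  qed
  have crit: "critical_curve V u" using u1 unfolding critical_curve_def f_def by blast
  have uH: "u \<in> H1loc" by (rule critical_curveD(2)[OF crit V(1)])
  have uE: "energy V u \<le> ennreal c"
  proof (rule energy_lower_semicontinuous[OF Vc V(2) qH _ _ inv0 bd lim u1 fc])
    show "energy V (q (r n)) \<le> ennreal (c + 1 / real (Suc (r n)))" for n by (rule q(2))
    show "0 \<le> c + 1 / real (Suc (r n))" for n using q(3) by (simp add: add_nonneg_nonneg)
  qed
  \<comment> \<open>The nearby points of \<open>K\<close> share the limit of
    \<open>q (r n) 0\<close>, so closedness of \<open>K\<close> yields the contact.\<close>
  have "(\<lambda>n. y (r n)) \<longlonglongrightarrow> u 0"
  proof -
    have "(\<lambda>n. q (r n) 0 - y (r n)) \<longlonglongrightarrow> 0"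
    proof (rule tendsto_norm_zero_cancel, rule tendsto_sandwich[OF _ _ tendsto_const inv0])
      show "\<forall>\<^sub>F n in sequentially. 0 \<le> norm (q (r n) 0 - y (r n))" by simp
      show "\<forall>\<^sub>F n in sequentially. norm (q (r n) 0 - y (r n)) \<le> 1 / real (Suc (r n))"
        using K(3) by (simp add: dist_norm)
    qed
    from tendsto_diff[OF lim[of 0] this] show ?thesis by simp
  qed
  then have u0: "u 0 \<in> K" using closed_sequentially[OF K(1), of "\<lambda>n. y (r n)"] K(2) by auto
  \<comment> \<open>It is enough that \<open>u\<close> comes arbitrarily close to the well at some
    time. Convergence at that time brings a curve of the sequence close as well, and this curve,
    unlike \<open>u\<close>, is known to connect \<open>a\<close> to \<open>b\<close> and can be cut
    there.\<close>
  have other: "\<sigma> \<in> {a, b}" if \<sigma>: "\<sigma> \<in> \<Sigma>" and near: "\<And>d. d > 0 \<Longrightarrow> \<exists>t. dist (u t) \<sigma> < d" for \<sigma>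
  proof (rule ccontr)
    assume "\<sigma> \<notin> {a, b}"
    then have ms: "m_star V \<Sigma> a b \<le> min_energy V a \<sigma> + min_energy V \<sigma> b"
      unfolding m_star_def using \<sigma> by (intro INF_lower) auto
    have "m_star V \<Sigma> a b \<le> ennreal c"
    proof (rule ennreal_le_epsilon)
      fix e :: real assume e: "e > 0"
      \<comment> \<open>Six parts in total: one for the excess energy of the approximating curve and
        five for the cost of the cut.\<close>
      define \<eta> where "\<eta> = e / 6"
      have \<eta>: "\<eta> > 0" using e by (simp add: \<eta>_def)
      have "isCont V \<sigma>" using Vc by (simp add: continuous_on_eq_continuous_at)
      moreover have V\<sigma>: "V \<sigma> = 0" using V(3) \<sigma> by simp
      ultimately obtain d where d: "d > 0" "\<And>x. dist x \<sigma> < d \<Longrightarrow> \<bar>V x\<bar> < \<eta>"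
        using \<eta> unfolding continuous_at_eps_delta dist_real_def by fastforce
      \<comment> \<open>\<open>d\<close> makes the potential small on the connecting segment, 1
        bounds the squared distance by the distance, and \<open>\<eta>\<close> bounds the distance
        itself.\<close>
      define \<rho> where "\<rho> = min d (min 1 \<eta>)"
      have \<rho>: "\<rho> > 0" "\<rho> \<le> d" "\<rho> \<le> 1" "\<rho> \<le> \<eta>" using d \<eta> by (auto simp: \<rho>_def)
      obtain t where t: "dist (u t) \<sigma> < \<rho>" using near[OF \<rho>(1)] by blast
      have "(\<lambda>n. dist (q (r n) t) \<sigma>) \<longlonglongrightarrow> dist (u t) \<sigma>" by (intro tendsto_intros lim)
      then have "\<forall>\<^sub>F n in sequentially. dist (q (r n) t) \<sigma> < \<rho>" using t by (rule order_tendstoD)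
      moreover have "\<forall>\<^sub>F n in sequentially. 1 / real (Suc (r n)) < \<eta>" using inv0 \<eta> by (rule order_tendstoD)
      ultimately have "\<forall>\<^sub>F n in sequentially. dist (q (r n) t) \<sigma> < \<rho> \<and> 1 / real (Suc (r n)) < \<eta>"
        by (rule eventually_conj)
      then obtain n where n: "dist (q (r n) t) \<sigma> < \<rho>" "1 / real (Suc (r n)) < \<eta>"
        by (auto simp: eventually_sequentially)
      have S: "V x \<le> \<eta>" if "x \<in> closed_segment (q (r n) t) \<sigma>" for x
      proof -
        have "closed_segment (q (r n) t) \<sigma> \<subseteq> ball \<sigma> \<rho>"
          using n(1) \<rho>(1) by (intro closed_segment_subset) (auto simp: dist_commute)
        then have "dist x \<sigma> < d" using that \<rho>(2) by (auto simp: dist_commute)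
        then show ?thesis using d(2)[of x] by linarith
      qed
      have "m_star V \<Sigma> a b \<le> energy V (q (r n)) + ennreal ((norm (\<sigma> - q (r n) t))\<^sup>2 / 2 + 4 * \<eta>)"
        by (rule order_trans[OF ms min_energy_split[OF q(1) Vc V(2) V\<sigma> S]])
      also have "\<dots> \<le> ennreal (c + \<eta>) + ennreal (5 * \<eta>)"
      proof (rule add_mono)
        show "energy V (q (r n)) \<le> ennreal (c + \<eta>)"
          by (rule order_trans[OF q(2)]) (use n(2) in \<open>intro ennreal_leI; linarith\<close>)
        have nn: "norm (\<sigma> - q (r n) t) \<le> \<rho>" using n(1) by (simp add: dist_norm norm_minus_commute)
        have "(norm (\<sigma> - q (r n) t))\<^sup>2 \<le> norm (\<sigma> - q (r n) t) * 1"
          unfolding power2_eq_square using nn \<rho>(3) by (intro mult_left_mono) auto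
        then have "(norm (\<sigma> - q (r n) t))\<^sup>2 / 2 + 4 * \<eta> \<le> 5 * \<eta>" using nn \<rho>(4) \<eta> by linarith
        then show "ennreal ((norm (\<sigma> - q (r n) t))\<^sup>2 / 2 + 4 * \<eta>) \<le> ennreal (5 * \<eta>)" by (rule ennreal_leI)
      qed
      also have "\<dots> = ennreal c + ennreal e"
        using \<eta> q(3) e by (simp add: \<eta>_def flip: ennreal_plus)
      finally show "m_star V \<Sigma> a b \<le> ennreal c + ennreal e" .
    qed
    then show False using m by simp
  qed
  obtain \<sigma> \<tau> where \<sigma>: "\<sigma> \<in> \<Sigma>" "(u \<longlongrightarrow> \<sigma>) at_top" and \<tau>: "\<tau> \<in> \<Sigma>" "(u \<longlongrightarrow> \<tau>) at_bot"
    using finite_energy_limits[OF uH uE q(3) ubd Vc V(2,3) fin] by blast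
  have "\<sigma> \<in> {a, b}"
  proof (rule other[OF \<sigma>(1)])
    fix d :: real assume "d > 0"
    then have "\<forall>\<^sub>F t in at_top. dist (u t) \<sigma> < d" using \<sigma>(2) by (intro tendstoD)
    then show "\<exists>t. dist (u t) \<sigma> < d" by (meson eventually_at_top_linorder order_refl)
  qed
  moreover have "\<tau> \<in> {a, b}"
  proof (rule other[OF \<tau>(1)])
    fix d :: real assume "d > 0"
    then have "\<forall>\<^sub>F t in at_bot. dist (u t) \<tau> < d" using \<tau>(2) by (intro tendstoD)
    then show "\<exists>t. dist (u t) \<tau> < d" by (meson eventually_at_bot_linorder order_refl)
  qed
  ultimately show ?thesis using crit uE u0 \<sigma> \<tau> by blast
qed

section \<open>Uniform descent near the closed set\<close>

text \<open>One number \<open>\<delta>\<close> measures the excess of energy, the distance from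
  \<open>K\<close> and the slope. Failure for every \<open>1 / real (Suc n)\<close> then produces a
  single sequence in which all three tend to 0.\<close>

lemma uniform_descent:
  fixes V :: "real ^ 'n \<Rightarrow> real"
  assumes V: "C2_function V" "\<And>u. V u \<ge> 0" "\<And>u. V u = 0 \<longleftrightarrow> u \<in> \<Sigma>" and fin: "finite \<Sigma>"
    and b: "\<beta> > 0" "\<And>u. norm u \<ge> R0 \<Longrightarrow> V u \<ge> \<beta>"
    and c: "c \<ge> 0" "ennreal c < m_star V \<Sigma> a b" and K: "closed K"
    and none: "\<not> (\<exists>u. critical_curve V u \<and> energy V u \<le> ennreal c \<and> u 0 \<in> K \<and>
      (\<exists>\<sigma>\<in>{a, b}. (u \<longlongrightarrow> \<sigma>) at_bot) \<and> (\<exists>\<sigma>\<in>{a, b}. (u \<longlongrightarrow> \<sigma>) at_top))"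
  obtains \<delta> where "\<delta> > 0" "\<delta> \<le> 1"
    "\<And>q t y. q \<in> connecting V a b \<Longrightarrow> energy V q \<le> ennreal (c + \<delta>) \<Longrightarrow> y \<in> K \<Longrightarrow> dist (q t) y \<le> \<delta> \<Longrightarrow>
      \<exists>x h e. 0 < h \<and> h \<le> 1 \<and> norm e = 1 \<and> residual V x h q \<bullet> e \<le> - \<delta>"
proof -
  have Vc: "continuous_on UNIV V" using C2_function_grad[OF V(1)] by auto
  have "\<exists>n. \<forall>q t y. q \<in> connecting V a b \<longrightarrow> energy V q \<le> ennreal (c + 1 / real (Suc n)) \<longrightarrow> y \<in> K \<longrightarrow>
      dist (q t) y \<le> 1 / real (Suc n) \<longrightarrow>
      (\<exists>x h e. 0 < h \<and> h \<le> 1 \<and> norm e = 1 \<and> residual V x h q \<bullet> e \<le> - (1 / real (Suc n)))"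
  proof (rule ccontr)
    assume "\<not> ?thesis"
    then have "\<forall>n. \<exists>q t y. q \<in> connecting V a b \<and> energy V q \<le> ennreal (c + 1 / real (Suc n)) \<and> y \<in> K \<and>
      dist (q t) y \<le> 1 / real (Suc n) \<and>
      \<not> (\<exists>x h e. 0 < h \<and> h \<le> 1 \<and> norm e = 1 \<and> residual V x h q \<bullet> e \<le> - (1 / real (Suc n)))"
      by blast
    then obtain q t y where q: "\<And>n. q n \<in> connecting V a b" "\<And>n. energy V (q n) \<le> ennreal (c + 1 / real (Suc n))"
      "\<And>n. y n \<in> K" "\<And>n. dist (q n (t n)) (y n) \<le> 1 / real (Suc n)"
      and res: "\<And>n x h e. 0 < h \<Longrightarrow> h \<le> 1 \<Longrightarrow> norm e = 1 \<Longrightarrow> \<not> residual V x h (q n) \<bullet> e \<le> - (1 / real (Suc n))"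
      by metis
    have "norm (residual V x h (q n)) \<le> 1 / real (Suc n)" if h: "0 < h" "h \<le> 1" for n x h
    proof (cases "residual V x h (q n) = 0")
      case False
      let ?w = "residual V x h (q n)"
      \<comment> \<open>The direction of steepest descent; testing with it turns the absence of a
        descent direction into a bound for the norm of the residual.\<close>
      define e where "e = - ((1 / norm ?w) *\<^sub>R ?w)"
      have "norm e = 1" using False by (simp add: e_def)
      then have "\<not> ?w \<bullet> e \<le> - (1 / real (Suc n))" by (rule res[OF h])
      moreover have "?w \<bullet> e = - norm ?w"
        using False by (simp add: e_def dot_square_norm power2_eq_square)
      ultimately show ?thesis by linarith
    qed simp
    then have "\<exists>u. critical_curve V u \<and> energy V u \<le> ennreal c \<and> u 0 \<in> K \<and>
        (\<exists>\<sigma>\<in>{a, b}. (u \<longlongrightarrow> \<sigma>) at_bot) \<and> (\<exists>\<sigma>\<in>{a, b}. (u \<longlongrightarrow> \<sigma>) at_top)"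
    proof (intro almost_critical_limit[OF V fin b, where q = "\<lambda>n s. q n (s + t n)" and y = y and c = c])
      show "(\<lambda>s. q n (s + t n)) \<in> connecting V a b" for n by (rule connecting_shift[OF q(1) Vc])
      have "q n \<in> H1loc" for n using q(1)[of n] by (simp add: connecting_def)
      then show "energy V (\<lambda>s. q n (s + t n)) \<le> ennreal (c + 1 / real (Suc n))" for n
        using H1loc_shift(2)[OF _ Vc] q(2) by metis
      show "dist (q n (0 + t n)) (y n) \<le> 1 / real (Suc n)" for n using q(4) by simp
    qed (use c K q(3) in \<open>auto simp: residual_shift\<close>)
    then show False using none by blast
  qed
  then obtain n where "\<forall>q t y. q \<in> connecting V a b \<longrightarrow> energy V q \<le> ennreal (c + 1 / real (Suc n)) \<longrightarrow> y \<in> K \<longrightarrow>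
      dist (q t) y \<le> 1 / real (Suc n) \<longrightarrow>
      (\<exists>x h e. 0 < h \<and> h \<le> 1 \<and> norm e = 1 \<and> residual V x h q \<bullet> e \<le> - (1 / real (Suc n)))"
    by blast
  then show ?thesis by (intro that[of "1 / real (Suc n)"]) auto
qed

section \<open>The mountain pass deformation\<close>

lemma hat_H1:
  assumes "h > 0"
  shows "(\<lambda>t. hat a h t *\<^sub>R e) \<in> H1"
proof (rule H1I)
  show "primitive (\<lambda>t. hat a h t *\<^sub>R e) (\<lambda>t. hat' a h t *\<^sub>R e)"
    by (rule primitive_bounded_linear[OF primitive_hat bounded_linear_scaleR_left])
  have L2: "L2_curve f" if m: "f \<in> borel_measurable borel"
    and b: "\<And>t. (norm (f t))\<^sup>2 \<le> c * indicator {a-h..a+h} t" for f :: "real \<Rightarrow> real ^ 'b" and c :: real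
    unfolding L2_curve_def
  proof
    have [measurable]: "f \<in> borel_measurable borel" by (rule m)
    show "integrable lborel (\<lambda>t. (norm (f t))\<^sup>2)"
    proof (rule Bochner_Integration.integrable_bound)
      show "integrable lborel (\<lambda>t. c * indicator {a-h..a+h} t)"
        by (intro integrable_mult_right) (auto simp: emeasure_lborel_Icc_eq)
      show "AE t in lborel. norm ((norm (f t))\<^sup>2) \<le> norm (c * indicator {a-h..a+h} t)"
        using b by (intro AE_I2) (auto intro: order_trans[OF _ abs_ge_self])
    qed simp
  qed (use m in simp)
  show "L2_curve (\<lambda>t. hat a h t *\<^sub>R e)"
  proof (rule L2)
    show "(\<lambda>t. hat a h t *\<^sub>R e) \<in> borel_measurable borel"
      by (intro borel_measurable_continuous_onI continuous_intros)
    show "(norm (hat a h t *\<^sub>R e))\<^sup>2 \<le> (h\<^sup>2 * (norm e)\<^sup>2) * indicator {a-h..a+h} t" for t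
    proof (cases "t \<in> {a-h..a+h}")
      case True
      have "(hat a h t)\<^sup>2 \<le> h\<^sup>2" using hat_nonneg[OF assms] hat_le[OF assms] by (intro power_mono)
      then show ?thesis using True by (simp add: power_mult_distrib mult_right_mono)
    qed (subst hat_outside[OF assms], simp_all)
  qed
  show "L2_curve (\<lambda>t. hat' a h t *\<^sub>R e)"
  proof (rule L2)
    show "(\<lambda>t. hat' a h t *\<^sub>R e) \<in> borel_measurable borel" unfolding hat'_def[abs_def] by measurable
    show "(norm (hat' a h t *\<^sub>R e))\<^sup>2 \<le> (norm e)\<^sup>2 * indicator {a-h..a+h} t" for t
      using assms by (auto simp: hat'_eq indicator_def)
  qed
qed

text \<open>The part of \<open>mp_paths\<close> that concerns membership and continuity, split off
  so that it can be propagated by induction over the tents; the endpoint conditions are checked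
  separately.\<close>

definition H1_path :: "(real \<Rightarrow> real \<Rightarrow> real ^ 'n) \<Rightarrow> bool" where
  "H1_path \<gamma> \<longleftrightarrow> (\<forall>s\<in>{0..1}. \<gamma> s \<in> H1) \<and>
     (\<forall>s\<in>{0..1}. ((\<lambda>r. H1_dist (\<gamma> r) (\<gamma> s)) \<longlongrightarrow> 0) (at s within {0..1}))"

lemma H1_path_add_scaled:
  assumes \<gamma>: "H1_path \<gamma>" and w: "continuous_on {0..1} w" and v: "v \<in> H1"
  shows "H1_path (\<lambda>s t. \<gamma> s t + w s *\<^sub>R v t)"
  unfolding H1_path_def
proof (intro conjI ballI)
  fix s :: real assume s: "s \<in> {0..1}"
  have \<gamma>H: "\<gamma> r \<in> H1" if "r \<in> {0..1}" for r using \<gamma> that by (simp add: H1_path_def)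
  show "(\<lambda>t. \<gamma> s t + w s *\<^sub>R v t) \<in> H1" by (intro H1_add H1_scaleR \<gamma>H s v)
  let ?b = "\<lambda>r. sqrt (2 * (H1_dist (\<gamma> r) (\<gamma> s))\<^sup>2 + 2 * (\<bar>w r - w s\<bar> * H1_norm v)\<^sup>2)"
  have le: "H1_dist (\<lambda>t. \<gamma> r t + w r *\<^sub>R v t) (\<lambda>t. \<gamma> s t + w s *\<^sub>R v t) \<le> ?b r" if r: "r \<in> {0..1}" for r
  proof -
    have eq: "(\<lambda>t. \<gamma> r t + w r *\<^sub>R v t - (\<gamma> s t + w s *\<^sub>R v t)) = (\<lambda>t. (\<gamma> r t - \<gamma> s t) + (w r - w s) *\<^sub>R v t)"
      by (auto simp: algebra_simps)
    have "(H1_norm (\<lambda>t. (\<gamma> r t - \<gamma> s t) + (w r - w s) *\<^sub>R v t))\<^sup>2 \<le> 2 * (H1_norm (\<lambda>t. \<gamma> r t - \<gamma> s t))\<^sup>2 + 2 * (H1_norm (\<lambda>t. (w r - w s) *\<^sub>R v t))\<^sup>2"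
      by (intro H1_norm_add_square H1_minus H1_scaleR \<gamma>H r s v)
    then show ?thesis unfolding H1_dist_def eq H1_norm_scaleR[OF v] by (rule real_le_rsqrt)
  qed
  have "((\<lambda>r. w r) \<longlongrightarrow> w s) (at s within {0..1})" using w s by (simp add: continuous_on_def)
  moreover have "((\<lambda>r. H1_dist (\<gamma> r) (\<gamma> s)) \<longlongrightarrow> 0) (at s within {0..1})" using \<gamma> s by (simp add: H1_path_def)
  ultimately have "(?b \<longlongrightarrow> sqrt (2 * 0\<^sup>2 + 2 * (\<bar>w s - w s\<bar> * H1_norm v)\<^sup>2)) (at s within {0..1})"
    by (intro tendsto_intros)
  then have B: "(?b \<longlongrightarrow> 0) (at s within {0..1})" by simp
  show "((\<lambda>r. H1_dist (\<lambda>t. \<gamma> r t + w r *\<^sub>R v t) (\<lambda>t. \<gamma> s t + w s *\<^sub>R v t)) \<longlongrightarrow> 0) (at s within {0..1})"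
  proof (rule tendsto_sandwich[OF _ _ tendsto_const B])
    show "\<forall>\<^sub>F r in at s within {0..1}. 0 \<le> H1_dist (\<lambda>t. \<gamma> r t + w r *\<^sub>R v t) (\<lambda>t. \<gamma> s t + w s *\<^sub>R v t)"
      by (simp add: H1_dist_def H1_norm_nonneg)
    show "\<forall>\<^sub>F r in at s within {0..1}. H1_dist (\<lambda>t. \<gamma> r t + w r *\<^sub>R v t) (\<lambda>t. \<gamma> s t + w s *\<^sub>R v t) \<le> ?b r"
      using le by (simp add: eventually_at_filter)
  qed
qed

lemma H1_path_add_sum:
  assumes "finite I" "H1_path \<gamma>" "\<And>i. i \<in> I \<Longrightarrow> continuous_on {0..1} (w i)" "\<And>i. i \<in> I \<Longrightarrow> v i \<in> H1"
  shows "H1_path (\<lambda>s t. \<gamma> s t + (\<Sum>i\<in>I. w i s *\<^sub>R v i t))"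
  using assms
proof (induction I rule: finite_induct)
  case (insert i I)
  then have "H1_path (\<lambda>s t. (\<gamma> s t + (\<Sum>i\<in>I. w i s *\<^sub>R v i t)) + w i s *\<^sub>R v i t)"
    by (intro H1_path_add_scaled insert.IH) auto
  with insert.hyps show ?case by (simp add: algebra_simps)
qed simp

text \<open>The radius is chosen for H1 distance \<open>\<eta> / 2\<close> because the sup norm is
  at most twice the H1 norm.\<close>

lemma H1_path_uniformly_close:
  assumes \<gamma>: "H1_path \<gamma>" and s: "s \<in> {0..1}" and \<eta>: "\<eta> > 0"
  obtains d where "d > 0" "\<And>r t. r \<in> {0..1} \<Longrightarrow> \<bar>r - s\<bar> < d \<Longrightarrow> norm (\<gamma> r t - \<gamma> s t) \<le> \<eta>"
proof -
  have "((\<lambda>r. H1_dist (\<gamma> r) (\<gamma> s)) \<longlongrightarrow> 0) (at s within {0..1})" using \<gamma> s by (simp add: H1_path_def)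
  then have "\<forall>\<^sub>F r in at s within {0..1}. H1_dist (\<gamma> r) (\<gamma> s) < \<eta> / 2"
    by (rule order_tendstoD(2)) (use \<eta> in simp)
  then obtain d where d: "d > 0" "\<And>r. r \<in> {0..1} \<Longrightarrow> r \<noteq> s \<Longrightarrow> dist r s < d \<Longrightarrow> H1_dist (\<gamma> r) (\<gamma> s) < \<eta> / 2"
    unfolding eventually_at by auto
  have "norm (\<gamma> r t - \<gamma> s t) \<le> \<eta>" if r: "r \<in> {0..1}" "\<bar>r - s\<bar> < d" for r t
  proof (cases "r = s")
    case False
    have "(\<lambda>t. \<gamma> r t - \<gamma> s t) \<in> H1" using \<gamma> r s by (intro H1_minus) (auto simp: H1_path_def)
    then have "norm (\<gamma> r t - \<gamma> s t) \<le> 2 * H1_dist (\<gamma> r) (\<gamma> s)"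
      unfolding H1_dist_def by (rule H1_sup_bound)
    also have "\<dots> \<le> \<eta>" using d(2)[OF r(1) False] r(2) by (simp add: dist_real_def)
    finally show ?thesis .
  qed (use \<eta> in simp)
  with d(1) show ?thesis by (rule that)
qed

text \<open>A curve without kinetic energy is constant, which distinct limits exclude. Positivity is
  needed at the end of the deformation, to see that a real upper bound for an energy is not a
  negative number hidden by \<open>ennreal\<close>.\<close>

lemma connecting_energy_pos:
  assumes q: "q \<in> connecting V a b" and ab: "a \<noteq> b" and V: "continuous_on UNIV V" "\<And>u. V u \<ge> 0"
  shows "energy V q > 0"
proof (rule ccontr)
  assume "\<not> ?thesis"
  then have E: "energy V q \<le> ennreal 0" by simp
  have qH: "q \<in> H1loc" and lim: "(q \<longlongrightarrow> a) at_bot" "(q \<longlongrightarrow> b) at_top" using q by (auto simp: connecting_def)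
  note k = kinetic_le_energy[OF qH E order_refl V]
  have "norm (q t - q 0) \<le> sqrt (2 * 0 * \<bar>t - 0\<bar>)" for t
    by (rule primitive_holder_abs[OF H1locD(2)[OF qH] k(3,1)])
  then have "q = (\<lambda>t. q 0)" by auto
  with lim have "((\<lambda>t::real. q 0) \<longlongrightarrow> a) at_bot" "((\<lambda>t::real. q 0) \<longlongrightarrow> b) at_top" by metis+
  then have "q 0 = a" "q 0 = b"
    by (simp_all add: tendsto_const_iff trivial_limit_at_bot_linorder trivial_limit_at_top_linorder)
  then show False using ab by simp
qed

text \<open>A nearly optimal path is pushed below level \<open>c\<close> at all parameters where the curve meets \<open>K\<close>;
  its endpoints do not move, since they stay away from \<open>K\<close>.\<close>

lemma mountain_pass_descent_contradiction:
  fixes V :: "real ^ 'n \<Rightarrow> real" and c M :: real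
  assumes V: "C2_function V" "\<And>u. V u \<ge> 0"
    and b: "\<beta> > 0" "\<And>u. norm u \<ge> R0 \<Longrightarrow> V u \<ge> \<beta>"
    and ab: "a \<noteq> b" and c: "c \<ge> 0" "mp_value V a b F0 F1 = ennreal c"
    and F: "F0 \<union> F1 \<subseteq> minimizers V a b"
    and \<nu>: "\<nu> > 0" "\<And>q t y. q \<in> minimizers V a b \<Longrightarrow> y \<in> K \<Longrightarrow> dist (q t) y \<ge> \<nu>"
    and M: "c < M" "\<And>\<gamma>. \<gamma> \<in> mp_paths a b F0 F1 \<Longrightarrow> max_J V a b \<gamma> \<le> ennreal M \<Longrightarrow>
      \<exists>s\<in>{0..1}. J V a b (\<gamma> s) \<ge> ennreal c \<and> range (\<lambda>t. \<gamma> s t + psi a b t) \<inter> K \<noteq> {}"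
    and \<delta>: "\<delta> > 0" "\<delta> \<le> 1"
      "\<And>q t y. q \<in> connecting V a b \<Longrightarrow> energy V q \<le> ennreal (c + \<delta>) \<Longrightarrow> y \<in> K \<Longrightarrow> dist (q t) y \<le> \<delta> \<Longrightarrow>
        \<exists>x h e. 0 < h \<and> h \<le> 1 \<and> norm e = 1 \<and> residual V x h q \<bullet> e \<le> - \<delta>"
  shows False
proof -
  have Vc: "continuous_on UNIV V" using C2_function_grad[OF V(1)] by auto
  \<comment> \<open>Bounds every curve of energy at most \<open>c + 1\<close>; the Lipschitz
    constant is taken on the radius \<open>R + 1\<close> to leave room for the displacement.\<close>
  define R where "R = R0 + sqrt (2 * (c + 1) * ((c + 1) / \<beta> + 1))"
  obtain C where C: "C \<ge> 0" "\<And>x y. norm x \<le> R + 1 \<Longrightarrow> norm y \<le> R + 1 \<Longrightarrow> norm (grad V y - grad V x) \<le> C * norm (y - x)"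
    using C2_function_grad_lipschitz[OF V(1), of "R + 1"] by metis
  \<comment> \<open>At most \<open>\<delta>\<close>, so that closeness to \<open>K\<close> within
    \<open>\<rho>\<close> provides a descent direction; less than \<open>\<nu>\<close>, so that the
    endpoints are never that close.\<close>
  define \<rho> where "\<rho> = min \<delta> (\<nu> / 2)"
  have \<rho>: "\<rho> > 0" "\<rho> \<le> \<delta>" "\<rho> < \<nu>" using \<delta> \<nu>(1) by (auto simp: \<rho>_def)
  define D where "D = 1 + 2 * C"
  have D: "D \<ge> 1" using C(1) by (simp add: D_def)
  \<comment> \<open>The first bound limits the displacement of a curve to \<open>\<rho> / 2\<close>;
    the second keeps the quadratic remainder within half of the slope \<open>\<delta> / 2\<close>
    available on a neighbourhood.\<close>
  define l where "l = min (\<rho> / 2) (\<delta> / (4 * D))"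
  have l: "l > 0" "l \<le> \<rho> / 2" "l \<le> 1" "l * D \<le> \<delta> / 4"
  proof -
    show "l > 0" "l \<le> \<rho> / 2" using \<rho> \<delta> D by (auto simp: l_def)
    then show "l \<le> 1" using \<rho> \<delta> by linarith
    have "l * D \<le> \<delta> / (4 * D) * D" using D by (intro mult_right_mono) (auto simp: l_def)
    then show "l * D \<le> \<delta> / 4" using D by simp
  qed
  \<comment> \<open>The excess of the path over \<open>c\<close> is less than the gain
    \<open>l * \<delta> / 4\<close> of a full step, small enough for the descent property, and
    leaves the path below \<open>M\<close>.\<close>
  define \<epsilon> where "\<epsilon> = min (min \<delta> (l * \<delta> / 8)) (M - c)"
  have \<epsilon>: "\<epsilon> > 0" "\<epsilon> \<le> \<delta>" "\<epsilon> \<le> l * \<delta> / 8" "c + \<epsilon> \<le> M"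
  proof -
    have "\<epsilon> \<le> min \<delta> (l * \<delta> / 8)" "\<epsilon> \<le> M - c"
      unfolding \<epsilon>_def by (rule min.cobounded1, rule min.cobounded2)
    then show "\<epsilon> \<le> \<delta>" "\<epsilon> \<le> l * \<delta> / 8" "c + \<epsilon> \<le> M" by auto
    have "l * \<delta> / 8 > 0" using l(1) \<delta>(1) by simp
    then show "\<epsilon> > 0" using \<delta>(1) M(1) by (simp add: \<epsilon>_def)
  qed
  have "mp_value V a b F0 F1 < ennreal (c + \<epsilon>)" using c \<epsilon> by (simp add: ennreal_lessI)
  then obtain \<gamma> where \<gamma>: "\<gamma> \<in> mp_paths a b F0 F1" "max_J V a b \<gamma> < ennreal (c + \<epsilon>)"
    unfolding mp_value_def INF_less_iff by blast
  have path: "H1_path \<gamma>" using \<gamma>(1) by (simp add: mp_paths_def H1_path_def)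
  have \<gamma>H: "\<gamma> s \<in> H1" if "s \<in> {0..1}" for s using path that by (simp add: H1_path_def)
  define q where "q s t = \<gamma> s t + psi a b t" for s t
  have qJ: "energy V (q s) = J V a b (\<gamma> s)" for s by (simp add: J_def q_def[abs_def])
  have qE: "energy V (q s) \<le> ennreal (c + \<epsilon>)" if "s \<in> {0..1}" for s
  proof -
    have "J V a b (\<gamma> s) \<le> max_J V a b \<gamma>" unfolding max_J_def using that by (rule SUP_upper)
    then show ?thesis using \<gamma>(2) by (simp add: qJ)
  qed
  have qX: "q s \<in> connecting V a b" if "s \<in> {0..1}" for s
    unfolding q_def[abs_def]
  proof (rule J_finite_connecting[OF \<gamma>H[OF that]])
    show "J V a b (\<gamma> s) < \<infinity>"
      using qE[OF that] unfolding qJ by (simp add: order_le_less_trans)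
  qed
  have qH: "q s \<in> H1loc" if "s \<in> {0..1}" for s using qX[OF that] by (simp add: connecting_def)
  have qR: "norm (q s t) \<le> R" if "s \<in> {0..1}" for s t
    unfolding R_def
  proof (rule energy_sup_bound[OF qH[OF that] _ _ Vc V(2) b])
    show "energy V (q s) \<le> ennreal (c + 1)"
      by (rule order_trans[OF qE[OF that]]) (use \<epsilon> \<delta> in \<open>intro ennreal_leI; linarith\<close>)
  qed (use c in simp)
  define touch where "touch \<eta> f \<longleftrightarrow> (\<exists>t. \<exists>y\<in>K. dist (f t) y \<le> \<eta>)" for \<eta> and f :: "real \<Rightarrow> real ^ 'n"
  have ends: "\<not> touch \<rho> (q s)" if "s = 0 \<or> s = 1" for s
  proof -
    have "\<gamma> s \<in> shifted a b (F0 \<union> F1)" using \<gamma>(1) that by (auto simp: mp_paths_def shifted_def)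
    then obtain f where f: "f \<in> F0 \<union> F1" "\<gamma> s = (\<lambda>t. f t - psi a b t)" by (auto simp: shifted_def)
    then have "q s = f" by (auto simp: q_def[abs_def])
    then have "q s \<in> minimizers V a b" using f F by auto
    then show ?thesis using \<nu>(2) \<rho>(3) unfolding touch_def by (meson less_le_trans not_le)
  qed
  \<comment> \<open>A good set of parameters has one fixed tent along which all its curves descend,
    and it omits 0 and 1 so that the endpoints stay put. On a bad set no curve is within
    \<open>\<rho> / 2\<close> of \<open>K\<close>, and nothing is moved on its account.\<close>
  define good where "good U \<longleftrightarrow> (\<exists>x h e. 0 < h \<and> h \<le> 1 \<and> norm e = 1 \<and> 0 \<notin> U \<and> 1 \<notin> U \<and>
      (\<forall>r\<in>U \<inter> {0..1}. residual V x h (q r) \<bullet> e \<le> - (\<delta> / 2)))" for U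
  define bad where "bad U \<longleftrightarrow> (\<forall>r\<in>U \<inter> {0..1}. \<not> touch (\<rho> / 2) (q r))" for U
  have close: "\<exists>d>0. \<forall>r t. r \<in> {0..1} \<longrightarrow> \<bar>r - s\<bar> < d \<longrightarrow> norm (q r t - q s t) \<le> \<eta>" if "s \<in> {0..1}" "\<eta> > 0" for s \<eta>
    by (rule H1_path_uniformly_close[OF path that]) (auto simp: q_def)
  have cover: "\<exists>U. open U \<and> s \<in> U \<and> (good U \<or> bad U)" if s: "s \<in> {0..1}" for s
  proof (cases "touch \<rho> (q s)")
    case True
    then obtain t y where ty: "y \<in> K" "dist (q s t) y \<le> \<rho>" unfolding touch_def by blast
    have s01: "0 < s" "s < 1"
      using s ends[of s] True by (auto simp: less_le)
    have "energy V (q s) \<le> ennreal (c + \<delta>)"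
      by (rule order_trans[OF qE[OF s]]) (use \<epsilon> in \<open>intro ennreal_leI; linarith\<close>)
    then obtain x h e where xhe: "0 < h" "h \<le> 1" "norm e = 1" "residual V x h (q s) \<bullet> e \<le> - \<delta>"
      using \<delta>(3)[OF qX[OF s] _ ty(1)] ty(2) \<rho>(2) by (meson order_trans)
    \<comment> \<open>Chosen so that passing from \<open>s\<close> to a nearby parameter changes the
      residual by at most \<open>\<delta> / 2\<close>, leaving half of the slope.\<close>
    define \<eta> where "\<eta> = \<delta> / (2 * (4 + C))"
    have \<eta>: "\<eta> > 0" using \<delta> C by (simp add: \<eta>_def)
    obtain d where d: "d > 0" "\<And>r t. r \<in> {0..1} \<Longrightarrow> \<bar>r - s\<bar> < d \<Longrightarrow> norm (q r t - q s t) \<le> \<eta>"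
      using close[OF s \<eta>] by blast
    define U where "U = ball s (min d (min s (1 - s)))"
    have U: "open U" "s \<in> U" "0 \<notin> U" "1 \<notin> U" using d s01 by (auto simp: U_def dist_real_def)
    have "residual V x h (q r) \<bullet> e \<le> - (\<delta> / 2)" if r: "r \<in> U \<inter> {0..1}" for r
    proof -
      have rd: "r \<in> {0..1}" "\<bar>r - s\<bar> < d" using r by (auto simp: U_def dist_real_def)
      have "norm (residual V x h (q r) - residual V x h (q s)) \<le> (4 + C) * \<eta>"
      proof (rule residual_diff_le[OF V(1) C(1)])
        show "norm (grad V y - grad V x) \<le> C * norm (y - x)" if "norm x \<le> R" "norm y \<le> R" for x y
          using that by (intro C(2)) auto
      qed (use H1locD(3)[OF qH] qR d(2) rd s xhe in auto)
      also have "(4 + C) * \<eta> = \<delta> / 2"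
      proof -
        have "w * (\<delta> / (2 * w)) = \<delta> / 2" if "w \<noteq> 0" for w :: real using that by simp
        from this[of "4 + C"] show ?thesis using C(1) by (simp only: \<eta>_def)
      qed
      finally have "(residual V x h (q r) - residual V x h (q s)) \<bullet> e \<le> \<delta> / 2"
        using norm_cauchy_schwarz[of "residual V x h (q r) - residual V x h (q s)" e] xhe(3) by simp
      then show ?thesis using xhe(4) by (simp add: inner_diff_left)
    qed
    then have "good U" unfolding good_def using xhe U by blast
    then show ?thesis using U by blast
  next
    case False
    obtain d where d: "d > 0" "\<And>r t. r \<in> {0..1} \<Longrightarrow> \<bar>r - s\<bar> < d \<Longrightarrow> norm (q r t - q s t) \<le> \<rho> / 2"
      using close[OF s, of "\<rho> / 2"] \<rho>(1) by auto
    have "bad (ball s d)"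
      unfolding bad_def
    proof (intro ballI notI)
      fix r assume r: "r \<in> ball s d \<inter> {0..1}" "touch (\<rho> / 2) (q r)"
      then obtain t y where ty: "y \<in> K" "dist (q r t) y \<le> \<rho> / 2" unfolding touch_def by blast
      have "norm (q r t - q s t) \<le> \<rho> / 2" using r d(2)[of r t] by (auto simp: dist_real_def)
      then have "dist (q s t) y \<le> \<rho>"
        using ty(2) dist_triangle[of "q s t" y "q r t"] by (simp add: dist_norm norm_minus_commute)
      then show False using False ty(1) unfolding touch_def by blast
    qed
    then show ?thesis using d(1) by (intro exI[of _ "ball s d"]) auto
  qed
  define \<U> where "\<U> = {U. open U \<and> (good U \<or> bad U)}"
  have "compact {0..1::real}" by simp
  moreover have "{0..1} \<subseteq> \<Union>\<U>" 
  proof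
    fix s :: real assume "s \<in> {0..1}"
    then obtain U where "open U" "s \<in> U" "good U \<or> bad U" using cover by blast
    then show "s \<in> \<Union>\<U>" by (auto simp: \<U>_def)
  qed
  moreover have "\<And>U. U \<in> \<U> \<Longrightarrow> open U" by (simp add: \<U>_def)
  ultimately obtain \<C> where \<C>: "\<C> \<subseteq> \<U>" "finite \<C>" "{0..1} \<subseteq> \<Union>\<C>" by (rule compactE)
  obtain W :: "real set \<Rightarrow> real \<Rightarrow> real" where W: "\<And>U. U \<in> \<C> \<Longrightarrow> continuous_on {0..1} (W U) \<and> (\<forall>x\<in>{0..1}. 0 \<le> W U x)"
    "\<And>x U. U \<in> \<C> \<Longrightarrow> x \<in> {0..1} \<Longrightarrow> x \<notin> U \<Longrightarrow> W U x = 0"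
    "\<And>x. x \<in> {0..1} \<Longrightarrow> supp_sum (\<lambda>U. W U x) \<C> = 1"
  proof (rule subordinate_partition_of_unity[OF \<C>(3)])
    show "open T" if "T \<in> \<C>" for T using that \<C>(1) by (auto simp: \<U>_def)
    show "\<exists>V. open V \<and> x \<in> V \<and> finite {U \<in> \<C>. U \<inter> V \<noteq> {}}" for x :: real
      using \<C>(2) by (intro exI[of _ UNIV]) auto
  next
    fix F :: "real set \<Rightarrow> real \<Rightarrow> real"
    assume F: "\<And>U. U \<in> \<C> \<Longrightarrow> continuous_on {0..1} (F U) \<and> (\<forall>x\<in>{0..1}. 0 \<le> F U x)"
      "\<And>x U. U \<in> \<C> \<Longrightarrow> x \<in> {0..1} \<Longrightarrow> x \<notin> U \<Longrightarrow> F U x = 0"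
      "\<And>x. x \<in> {0..1} \<Longrightarrow> supp_sum (\<lambda>U. F U x) \<C> = 1"
    show thesis by (rule that) (fact F)+
  qed
  have Wsum: "(\<Sum>U\<in>\<C>. W U x) = 1" if "x \<in> {0..1}" for x
  proof -
    have "supp_sum (\<lambda>U. W U x) \<C> = (\<Sum>U\<in>\<C>. W U x)"
      unfolding supp_sum_def support_on_def by (rule sum.mono_neutral_left) (use \<C>(2) in auto)
    then show ?thesis using W(3)[OF that] by simp
  qed
  define G where "G = {U \<in> \<C>. good U}"
  have G: "finite G" "G \<subseteq> \<C>" using \<C>(2) by (auto simp: G_def)
  have W0: "W U x \<ge> 0" if "U \<in> \<C>" "x \<in> {0..1}" for U x using W(1) that by blast
  have "\<forall>U\<in>G. \<exists>x h e. 0 < h \<and> h \<le> 1 \<and> norm e = 1 \<and> 0 \<notin> U \<and> 1 \<notin> U \<and>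
      (\<forall>r\<in>U \<inter> {0..1}. residual V x h (q r) \<bullet> e \<le> - (\<delta> / 2))"
    by (auto simp: G_def good_def)
  then obtain x h and e :: "real set \<Rightarrow> real ^ 'n" where xhe: "\<And>U. U \<in> G \<Longrightarrow> 0 < h U \<and> h U \<le> 1 \<and> norm (e U) = 1"
    "\<And>U. U \<in> G \<Longrightarrow> 0 \<notin> U \<and> 1 \<notin> U"
    "\<And>U r. U \<in> G \<Longrightarrow> r \<in> U \<Longrightarrow> r \<in> {0..1} \<Longrightarrow> residual V (x U) (h U) (q r) \<bullet> e U \<le> - (\<delta> / 2)"
    by (metis IntI)
  \<comment> \<open>The share of the good sets in the partition of unity; the energy gained at
    \<open>s\<close> is proportional to it.\<close>
  define \<Lambda> where "\<Lambda> s = (\<Sum>U\<in>G. W U s)" for s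
  have \<Lambda>: "0 \<le> \<Lambda> s" "\<Lambda> s \<le> 1" if "s \<in> {0..1}" for s
  proof -
    show "0 \<le> \<Lambda> s" unfolding \<Lambda>_def using W0 G(2) that by (intro sum_nonneg) auto
    have "\<Lambda> s \<le> (\<Sum>U\<in>\<C>. W U s)" unfolding \<Lambda>_def using \<C>(2) G(2) W0 that by (intro sum_mono2) auto
    then show "\<Lambda> s \<le> 1" using Wsum[OF that] by simp
  qed
  \<comment> \<open>The tents belong to the sets and only the weights depend on the parameter, so
    continuity of the new path in H1 reduces to continuity of finitely many scalar
    functions.\<close>
  define \<phi> where "\<phi> s t = (\<Sum>U\<in>G. W U s *\<^sub>R hat (x U) (h U) t *\<^sub>R e U)" for s t
  define \<gamma>' where "\<gamma>' s t = \<gamma> s t + l *\<^sub>R \<phi> s t" for s t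
  have \<phi>1: "norm (\<phi> s t) \<le> 1" if "s \<in> {0..1}" for s t
  proof -
    have "norm (\<phi> s t) \<le> (\<Sum>U\<in>G. norm (W U s *\<^sub>R hat (x U) (h U) t *\<^sub>R e U))" unfolding \<phi>_def by (rule norm_sum)
    also have "\<dots> \<le> (\<Sum>U\<in>G. W U s)"
    proof (rule sum_mono)
      fix U assume U: "U \<in> G"
      have "0 \<le> hat (x U) (h U) t" "hat (x U) (h U) t \<le> 1"
        using xhe(1)[OF U] hat_nonneg[of "h U" "x U" t] hat_le[of "h U" "x U" t] by auto
      moreover have "W U s \<ge> 0" using W0 U G(2) that by auto
      ultimately show "norm (W U s *\<^sub>R hat (x U) (h U) t *\<^sub>R e U) \<le> W U s"
        using xhe(1)[OF U] by (simp add: mult_left_le)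
    qed
    also have "\<dots> \<le> 1" using \<Lambda>(2)[OF that] by (simp add: \<Lambda>_def)
    finally show ?thesis .
  qed
  \<comment> \<open>Per unit of weight the first order gain is \<open>l * \<delta> / 2\<close> and
    the remainder at most \<open>l * \<delta> / 4\<close>. The bound is stated with a real
    \<open>E\<close> because the right side is not yet known to be nonnegative.\<close>
  have expand: "\<exists>E. E \<le> c + \<epsilon> - \<Lambda> s * (l * \<delta> / 4) \<and> J V a b (\<gamma>' s) \<le> ennreal E" if s: "s \<in> {0..1}" for s
  proof -
    have "energy V (q s) < \<infinity>" using qX[OF s] by (simp add: connecting_def)
    then obtain E where E: "energy V (q s) = ennreal E" "E \<ge> 0" by (cases "energy V (q s)") auto
    have "c + \<epsilon> \<ge> 0" using c(1) \<epsilon>(1) by linarith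
    then have Ec: "E \<le> c + \<epsilon>" using qE[OF s] unfolding E(1) by (simp only: ennreal_le_iff)
    let ?S = "\<Sum>U\<in>G. W U s * (residual V (x U) (h U) (q s) \<bullet> e U)"
    have "J V a b (\<gamma>' s) = energy V (\<lambda>t. q s t + l *\<^sub>R (\<Sum>U\<in>G. W U s *\<^sub>R hat (x U) (h U) t *\<^sub>R e U))"
      by (simp add: J_def \<gamma>'_def q_def \<phi>_def algebra_simps)
    also have "\<dots> \<le> ennreal (E + l * ?S + l\<^sup>2 * (1 + 2 * C) * (\<Sum>U\<in>G. W U s))"
    proof (rule energy_hat_expansion[OF V C qH[OF s] E qR[OF s] G(1)])
      show "W U s \<ge> 0" if "U \<in> G" for U using W0 that G(2) s by auto
      show "(\<Sum>U\<in>G. W U s) \<le> 1" using \<Lambda>(2)[OF s] by (simp add: \<Lambda>_def)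
      show "0 < h U \<and> h U \<le> 1 \<and> norm (e U) = 1" if "U \<in> G" for U by (rule xhe(1)[OF that])
    qed (use l in auto)
    finally have J: "J V a b (\<gamma>' s) \<le> ennreal (E + l * ?S + l\<^sup>2 * D * \<Lambda> s)" by (simp add: D_def \<Lambda>_def)
    have "?S \<le> (\<Sum>U\<in>G. W U s * (- (\<delta> / 2)))"
    proof (rule sum_mono)
      fix U assume U: "U \<in> G"
      show "W U s * (residual V (x U) (h U) (q s) \<bullet> e U) \<le> W U s * (- (\<delta> / 2))"
      proof (cases "s \<in> U")
        case True
        then show ?thesis using xhe(3)[OF U _ s] W0[of U s] U G(2) s by (intro mult_left_mono) auto
      next
        case False
        then show ?thesis using W(2)[of U s] U G(2) s by auto
      qed
    qed
    also have "\<dots> = - (\<delta> / 2) * \<Lambda> s" by (simp add: \<Lambda>_def sum_distrib_left mult.commute)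
    finally have "l * ?S \<le> l * (- (\<delta> / 2) * \<Lambda> s)" using l by (intro mult_left_mono) auto
    moreover have "l\<^sup>2 * D * \<Lambda> s \<le> l * (\<delta> / 4) * \<Lambda> s"
    proof -
      have "l * (l * D) \<le> l * (\<delta> / 4)" using l by (intro mult_left_mono) auto
      then show ?thesis using \<Lambda>(1)[OF s] by (intro mult_right_mono) (auto simp: power2_eq_square mult.assoc)
    qed
    moreover have "l * (- (\<delta> / 2) * \<Lambda> s) + l * (\<delta> / 4) * \<Lambda> s = - (\<Lambda> s * (l * \<delta> / 4))"
      by (simp add: algebra_simps)
    ultimately have "E + l * ?S + l\<^sup>2 * D * \<Lambda> s \<le> c + \<epsilon> - \<Lambda> s * (l * \<delta> / 4)" using Ec by linarith
    then show ?thesis using J by blast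
  qed
  have ends': "\<gamma>' s = \<gamma> s" if "s = 0 \<or> s = 1" for s
  proof -
    have "W U s = 0" if "U \<in> G" for U
      using W(2)[of U s] xhe(2)[OF that] that G(2) \<open>s = 0 \<or> s = 1\<close> by auto
    then show ?thesis by (auto simp: \<gamma>'_def \<phi>_def)
  qed
  have "H1_path \<gamma>'"
  proof -
    have "H1_path (\<lambda>s t. \<gamma> s t + (\<Sum>U\<in>G. W U s *\<^sub>R (l *\<^sub>R (hat (x U) (h U) t *\<^sub>R e U))))"
    proof (rule H1_path_add_sum[OF G(1) path])
      show "continuous_on {0..1} (W U)" if "U \<in> G" for U using W(1) that G(2) by blast
      show "(\<lambda>t. l *\<^sub>R hat (x U) (h U) t *\<^sub>R e U) \<in> H1" if "U \<in> G" for U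
        using xhe(1)[OF that] by (intro H1_scaleR hat_H1) auto
    qed
    moreover have "(\<lambda>s t. \<gamma> s t + (\<Sum>U\<in>G. W U s *\<^sub>R (l *\<^sub>R (hat (x U) (h U) t *\<^sub>R e U)))) = \<gamma>'"
      by (intro ext) (simp add: \<gamma>'_def \<phi>_def scaleR_sum_right mult.commute mult.left_commute)
    ultimately show ?thesis by simp
  qed
  moreover have "\<gamma>' 0 \<in> shifted a b F0" "\<gamma>' 1 \<in> shifted a b F1"
    using \<gamma>(1) ends'[of 0] ends'[of 1] by (auto simp: mp_paths_def)
  ultimately have \<gamma>': "\<gamma>' \<in> mp_paths a b F0 F1" by (simp add: mp_paths_def H1_path_def)
  have "max_J V a b \<gamma>' \<le> ennreal M"
    unfolding max_J_def
  proof (rule SUP_least)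
    fix s :: real assume s: "s \<in> {0..1}"
    obtain E where E: "E \<le> c + \<epsilon> - \<Lambda> s * (l * \<delta> / 4)" "J V a b (\<gamma>' s) \<le> ennreal E" using expand[OF s] by blast
    have "\<Lambda> s * (l * \<delta> / 4) \<ge> 0" using \<Lambda>(1)[OF s] l \<delta> by simp
    then have "E \<le> M" using E(1) \<epsilon>(4) by linarith
    then show "J V a b (\<gamma>' s) \<le> ennreal M" using E(2) by (meson ennreal_leI order_trans)
  qed
  from M(2)[OF \<gamma>' this] obtain s t where s: "s \<in> {0..1}" "J V a b (\<gamma>' s) \<ge> ennreal c" "\<gamma>' s t + psi a b t \<in> K"
    by blast
  have "dist (q s t) (\<gamma>' s t + psi a b t) = l * norm (\<phi> s t)"
    using l by (simp add: q_def \<gamma>'_def dist_norm)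
  also have "\<dots> \<le> l * 1" using \<phi>1[OF s(1)] l by (intro mult_left_mono) auto
  finally have "dist (q s t) (\<gamma>' s t + psi a b t) \<le> \<rho> / 2" using l(2) by linarith
  then have "touch (\<rho> / 2) (q s)" unfolding touch_def using s(3) by blast
  \<comment> \<open>The step moved the curve by at most \<open>\<rho> / 2\<close>, so contact with
    \<open>K\<close> afterwards means distance at most \<open>\<rho> / 2\<close> before. Hence no
    bad set contains \<open>s\<close>, the good sets carry the full weight 1, and the gain is
    complete.\<close>
  then have nb: "s \<notin> U" if "U \<in> \<C>" "U \<notin> G" for U
    using that \<C>(1) s(1) by (auto simp: G_def \<U>_def bad_def)
  have "\<Lambda> s = (\<Sum>U\<in>\<C>. W U s)"
    unfolding \<Lambda>_def by (rule sum.mono_neutral_left) (use \<C>(2) G nb W(2) s(1) in auto)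
  then have \<Lambda>1: "\<Lambda> s = 1" using Wsum[OF s(1)] by simp
  obtain E where E: "E \<le> c + \<epsilon> - \<Lambda> s * (l * \<delta> / 4)" "J V a b (\<gamma>' s) \<le> ennreal E" using expand[OF s(1)] by blast
  have "l * \<delta> > 0" using l \<delta> by simp
  then have Ec: "E < c" using E(1) \<epsilon>(3) \<Lambda>1 by simp
  have "(\<lambda>t. \<gamma>' s t + psi a b t) \<in> connecting V a b"
  proof (rule J_finite_connecting)
    show "\<gamma>' s \<in> H1" using \<gamma>' s(1) by (simp add: mp_paths_def)
    show "J V a b (\<gamma>' s) < \<infinity>" using E(2) by (simp add: order_le_less_trans)
  qed
  \<comment> \<open>With \<open>E > 0\<close> the inequality \<open>E < c\<close> remains strict
    under \<open>ennreal\<close>, which sends all nonpositive numbers to 0.\<close>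
  from connecting_energy_pos[OF this ab Vc V(2)] have "J V a b (\<gamma>' s) > 0" by (simp add: J_def)
  then have "ennreal E > 0" using E(2) by (rule order_less_le_trans)
  then have "E > 0" by simp
  then have "ennreal E < ennreal c" using Ec by (simp add: ennreal_lessI)
  then show False using s(2) E(2) by simp
qed

section \<open>Classification of the limit curve\<close>

text \<open>Two limits among two wells leave three cases. Equal limits give the first alternative,
  limits in the right order the second. In the opposite order the curve is reversed in time, which
  preserves the equation, the energy and the value at time 0.\<close>

theorem theorem1:
  fixes V :: "real ^ 'n \<Rightarrow> real"
    and \<Sigma> K :: "(real ^ 'n) set"
    and \<sigma>m \<sigma>p :: "real ^ 'n"
    and F0 F1 :: "(real \<Rightarrow> real ^ 'n) set"
  assumes dim: "CARD('n) \<ge> 2"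
    and wells: "finite \<Sigma>" "\<sigma>m \<in> \<Sigma>" "\<sigma>p \<in> \<Sigma>" "\<sigma>m \<noteq> \<sigma>p"
    and a: "C2_function V" "\<forall>u. V u \<ge> 0" "\<forall>u. V u = 0 \<longleftrightarrow> u \<in> \<Sigma>"
    and b: "\<exists>\<alpha>0>0. \<exists>\<beta>0>0. \<exists>R0>0. \<forall>u. norm u \<ge> R0 \<longrightarrow>
              grad V u \<bullet> u \<ge> \<alpha>0 * (norm u)\<^sup>2 \<and> V u \<ge> \<beta>0"
    and c: "\<forall>\<sigma>\<in>\<Sigma>. positive_definite (hessian V \<sigma>)"
    and d: "minimizers V \<sigma>m \<sigma>p = F0 \<union> F1" "F0 \<noteq> {}" "F1 \<noteq> {}" "H1_setdist F0 F1 > 0"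
    and e: "mp_value V \<sigma>m \<sigma>p F0 F1 < m_star V \<Sigma> \<sigma>m \<sigma>p"
    and f: "closed K"
    and f1: "\<exists>\<nu>0>0. \<forall>q\<in>minimizers V \<sigma>m \<sigma>p. setdist (range q) K \<ge> \<nu>0"
    and f2: "\<exists>M::real. ennreal M > mp_value V \<sigma>m \<sigma>p F0 F1 \<and>
               (\<forall>\<gamma>\<in>mp_paths \<sigma>m \<sigma>p F0 F1. max_J V \<sigma>m \<sigma>p \<gamma> \<le> ennreal M \<longrightarrow>
                  (\<exists>s\<in>{0..1}. J V \<sigma>m \<sigma>p (\<gamma> s) \<ge> mp_value V \<sigma>m \<sigma>p F0 F1 \<and>
                     range (\<lambda>t. \<gamma> s t + psi \<sigma>m \<sigma>p t) \<inter> K \<noteq> {}))"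
  shows "\<exists>u. u \<in> H1loc \<and> C2_curve u \<and>
           (\<forall>t. vector_derivative (\<lambda>s. vector_derivative u (at s)) (at t) = grad V (u t)) \<and>
           ((\<not> u constant_on UNIV \<and> energy V u \<le> mp_value V \<sigma>m \<sigma>p F0 F1 \<and>
               (\<exists>\<sigma>\<in>{\<sigma>m, \<sigma>p}. (u \<longlongrightarrow> \<sigma>) at_bot \<and> (u \<longlongrightarrow> \<sigma>) at_top)) \<or>
            (u \<in> connecting V \<sigma>m \<sigma>p \<and> mp_value V \<sigma>m \<sigma>p F0 F1 \<ge> energy V u \<and>
               energy V u > min_energy V \<sigma>m \<sigma>p)) \<and>
           u 0 \<in> K"
proof -
  have V: "C2_function V" "\<And>u. V u \<ge> 0" "\<And>u. V u = 0 \<longleftrightarrow> u \<in> \<Sigma>" using a by auto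
  have Vc: "continuous_on UNIV V" using C2_function_grad[OF V(1)] by auto
  obtain \<beta> R0 where \<beta>: "\<beta> > 0" "\<And>u. norm u \<ge> R0 \<Longrightarrow> V u \<ge> \<beta>" using b by blast
  obtain \<nu> where \<nu>: "\<nu> > 0" "\<And>q. q \<in> minimizers V \<sigma>m \<sigma>p \<Longrightarrow> setdist (range q) K \<ge> \<nu>" using f1 by blast
  have away: "dist (q t) y \<ge> \<nu>" if "q \<in> minimizers V \<sigma>m \<sigma>p" "y \<in> K" for q t y
    using \<nu>(2)[OF that(1)] setdist_le_dist[of "q t" "range q" y K] that(2) by auto
  have "mp_value V \<sigma>m \<sigma>p F0 F1 < \<infinity>" using e by (simp add: order_less_le_trans)
  then obtain c0 where c0: "mp_value V \<sigma>m \<sigma>p F0 F1 = ennreal c0" "c0 \<ge> 0"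
    by (cases "mp_value V \<sigma>m \<sigma>p F0 F1") auto
  obtain M :: real where M: "ennreal M > ennreal c0" "\<And>\<gamma>. \<gamma> \<in> mp_paths \<sigma>m \<sigma>p F0 F1 \<Longrightarrow> max_J V \<sigma>m \<sigma>p \<gamma> \<le> ennreal M \<Longrightarrow>
      \<exists>s\<in>{0..1}. J V \<sigma>m \<sigma>p (\<gamma> s) \<ge> ennreal c0 \<and> range (\<lambda>t. \<gamma> s t + psi \<sigma>m \<sigma>p t) \<inter> K \<noteq> {}"
    using f2 unfolding c0(1) by blast
  have Mc: "c0 < M" using M(1) c0(2) by (metis ennreal_leI not_le)
  have ms: "ennreal c0 < m_star V \<Sigma> \<sigma>m \<sigma>p" using e c0 by simp
  have "\<exists>u. critical_curve V u \<and> energy V u \<le> ennreal c0 \<and> u 0 \<in> K \<and>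
    (\<exists>\<sigma>\<in>{\<sigma>m, \<sigma>p}. (u \<longlongrightarrow> \<sigma>) at_bot) \<and> (\<exists>\<sigma>\<in>{\<sigma>m, \<sigma>p}. (u \<longlongrightarrow> \<sigma>) at_top)"
  proof (rule ccontr)
    assume none: "\<not> ?thesis"
    obtain \<delta> where \<delta>: "\<delta> > 0" "\<delta> \<le> 1"
      "\<And>q t y. q \<in> connecting V \<sigma>m \<sigma>p \<Longrightarrow> energy V q \<le> ennreal (c0 + \<delta>) \<Longrightarrow> y \<in> K \<Longrightarrow> dist (q t) y \<le> \<delta> \<Longrightarrow>
        \<exists>x h e. 0 < h \<and> h \<le> 1 \<and> norm e = 1 \<and> residual V x h q \<bullet> e \<le> - \<delta>"
    proof (rule uniform_descent[OF V wells(1) \<beta>(1) _ c0(2) ms f none])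
      show "V u \<ge> \<beta>" if "norm u \<ge> R0" for u by (rule \<beta>(2)[OF that])
    next
      fix \<delta> :: real assume "\<delta> > 0" "\<delta> \<le> 1"
        "\<And>q t y. q \<in> connecting V \<sigma>m \<sigma>p \<Longrightarrow> energy V q \<le> ennreal (c0 + \<delta>) \<Longrightarrow> y \<in> K \<Longrightarrow> dist (q t) y \<le> \<delta> \<Longrightarrow>
          \<exists>x h e. 0 < h \<and> h \<le> 1 \<and> norm e = 1 \<and> residual V x h q \<bullet> e \<le> - \<delta>"
      then show thesis by (rule that)
    qed
    have sub: "F0 \<union> F1 \<subseteq> minimizers V \<sigma>m \<sigma>p" using d(1) by simp
    show False
      by (rule mountain_pass_descent_contradiction[where V = V and \<beta> = \<beta> and ?R0.0 = R0 and a = \<sigma>m and b = \<sigma>p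
            and c = c0 and ?F0.0 = F0 and ?F1.0 = F1 and \<nu> = \<nu> and K = K and M = M and \<delta> = \<delta>])
        (fact V \<beta> wells c0 sub \<nu>(1) away Mc M(2) \<delta>)+
  qed
  then obtain u \<tau> \<sigma> where u: "critical_curve V u" "energy V u \<le> ennreal c0" "u 0 \<in> K"
    and lim: "\<tau> \<in> {\<sigma>m, \<sigma>p}" "\<sigma> \<in> {\<sigma>m, \<sigma>p}" "(u \<longlongrightarrow> \<tau>) at_bot" "(u \<longlongrightarrow> \<sigma>) at_top"
    by blast
  \<comment> \<open>Stated for an arbitrary curve because it is applied to \<open>u\<close> in one
    case and to its time reversal in another.\<close>
  have heteroclinic: "v \<in> connecting V \<sigma>m \<sigma>p \<and> energy V v \<le> ennreal c0 \<and> energy V v > min_energy V \<sigma>m \<sigma>p"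
    if v: "critical_curve V v" "energy V v \<le> ennreal c0" "v 0 \<in> K" "(v \<longlongrightarrow> \<sigma>m) at_bot" "(v \<longlongrightarrow> \<sigma>p) at_top" for v
  proof -
    have "energy V v < \<infinity>" using v(2) by (simp add: order_le_less_trans)
    then have X: "v \<in> connecting V \<sigma>m \<sigma>p"
      using v critical_curveD(2)[OF v(1) V(1)] by (simp add: connecting_def)
    then have "min_energy V \<sigma>m \<sigma>p \<le> energy V v" unfolding min_energy_def by (rule INF_lower)
    moreover have "v \<notin> minimizers V \<sigma>m \<sigma>p" using away[of v "v 0" 0] v(3) \<nu>(1) by auto
    then have "energy V v \<noteq> min_energy V \<sigma>m \<sigma>p" using X by (simp add: minimizers_def)
    ultimately show ?thesis using X v(2) by auto
  qed
  consider (het) "\<tau> = \<sigma>m" "\<sigma> = \<sigma>p" | (rev) "\<tau> = \<sigma>p" "\<sigma> = \<sigma>m" | (hom) "\<tau> = \<sigma>" using lim by auto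
  then show ?thesis
  proof cases
    case het
    then show ?thesis
      using critical_curveD[OF u(1) V(1)] heteroclinic[OF u] lim u(3) unfolding c0(1) by blast
  next
    case rev
    let ?v = "\<lambda>t. u (- t)"
    have cr: "critical_curve V ?v" by (rule critical_curve_reflect[OF u(1)])
    have "energy V ?v \<le> ennreal c0"
      using u(2) H1loc_reflect(2)[OF critical_curveD(2)[OF u(1) V(1)] Vc] by simp
    moreover have "(?v \<longlongrightarrow> \<sigma>m) at_bot" "(?v \<longlongrightarrow> \<sigma>p) at_top"
      using lim rev by (simp_all add: filterlim_at_bot_mirror)
    ultimately have "?v \<in> connecting V \<sigma>m \<sigma>p \<and> energy V ?v \<le> ennreal c0 \<and> energy V ?v > min_energy V \<sigma>m \<sigma>p"
      using heteroclinic[OF cr] u(3) by simp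
    moreover have "?v 0 \<in> K" using u(3) by simp
    ultimately show ?thesis
      using critical_curveD[OF cr V(1)] unfolding c0(1) by (intro exI[of _ ?v]) blast
  next
    case hom
    have "\<not> u constant_on UNIV"
    proof
      assume "u constant_on UNIV"
      then obtain k where k: "u = (\<lambda>_. k)" unfolding constant_on_def by blast
      have "k = \<sigma>" using lim(4) unfolding k by (simp add: tendsto_const_iff trivial_limit_at_top_linorder)
      then have \<sigma>K: "\<sigma> \<in> K" using u(3) by (simp add: k)
      obtain q where q: "q \<in> minimizers V \<sigma>m \<sigma>p" using d by blast
      then have "\<exists>t. dist (q t) \<sigma> < \<nu>"
      proof -
        have qlim: "(q \<longlongrightarrow> \<sigma>m) at_bot" "(q \<longlongrightarrow> \<sigma>p) at_top" using q by (auto simp: minimizers_def connecting_def)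
        have "\<exists>t. dist (q t) \<sigma>m < \<nu>"
          using tendstoD[OF qlim(1) \<nu>(1)] by (meson eventually_at_bot_linorder order_refl)
        moreover have "\<exists>t. dist (q t) \<sigma>p < \<nu>"
          using tendstoD[OF qlim(2) \<nu>(1)] by (meson eventually_at_top_linorder order_refl)
        ultimately show ?thesis using lim(2) by auto
      qed
      then show False using away[OF q \<sigma>K] by (meson not_le)
    qed
    then show ?thesis
      using critical_curveD[OF u(1) V(1)] u(2,3) lim(2,3,4) unfolding c0(1) hom
      by (intro exI[of _ u] conjI disjI1 allI bexI[of _ \<sigma>])
  qed
qed

end
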